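(* Assume that the density $g$ of the shifts satisfies the polynomial decay assumption: there are $\beta\ge 0$ and $C_{max}\ge C_{min}>0$ with $C_{min}|k|^{-\beta}\le|\gamma_k|\le C_{max}|k|^{-\beta}$ for all $k\in\mathbb{Z}\setminus\{0\}$. Let $\theta^\star$ be the spectral cut-off estimator with data-driven cut-off $N^\star$ defined in the context. Then there exist $\gamma_1\in(0,1)$, a function $h_1$ with $h_1(\gamma)\to 0$ as $\gamma\to 0$, and a positive constant $C_1$, all independent of $\epsilon$ and $n$, such that for all $\epsilon>0$, all $n\ge 2$ and all $0<\gamma<\gamma_1$, $$\mathbb{E}_\theta\|\theta^\star-\theta\|^2\le (1+h_1(\gamma))\inf_{N\le m_0}\bar R(\theta,N)+\frac{C_1\epsilon^2}{n}\frac{1}{\gamma^{4\beta+1}}+\frac{C_1}{n\gamma},$$ where $$\bar R(\theta,N)=\sum_{|k|>N}|\theta_k|^2+\frac{\epsilon^2}{n}\sum_{|k|\le N}|\gamma_k|^{-2}+\frac{\log^2(n)}{n}\sum_{|k|\le N}|\gamma_k|^{-2}|\theta_k|^2.$$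
   Context: Model: $f:\mathbb{R}\to\mathbb{R}$ is an unknown 1-periodic function, square integrable on $[0,1]$, with Fourier coefficients $\theta_k=\int_0^1 e^{-2ik\pi x}f(x)\,dx$, $\theta=(\theta_k)_{k\in\mathbb{Z}}$. One observes $dY_j(x)=f(x-\tau_j)\,dx+\epsilon\,dW_j(x)$, $x\in[0,1]$, $j=1,\dots,n$, where $\epsilon>0$, the $W_j$ are independent standard Brownian motions on $[0,1]$, and the $\tau_j$ are i.i.d. real random variables, independent of the $W_j$, with known density $g$ with respect to Lebesgue measure on $\mathbb{R}$. Put $\gamma_k=\mathbb{E}(e^{-2i\pi k\tau_1})=\int_{\mathbb{R}}e^{-2i\pi kx}g(x)\,dx$, assumed nonzero for all $k$, and $$\tilde c_k=\frac1n\sum_{j=1}^n\int_0^1e^{-2ik\pi x}dY_j(x)=\theta_k\tilde\gamma_k+\frac{\epsilon}{\sqrt n}\xi_k,\qquad \tilde\gamma_k=\frac1n\sum_{j=1}^ne^{-2i\pi k\tau_j},\qquad \xi_k=\frac1{\sqrt n}\sum_{j=1}^n\int_0^1e^{-2ik\pi x}dW_j(x).$$ Here $\|\cdot\|$ is the $\ell^2(\mathbb{Z})$ norm and $\mathbb{E}_\theta$ is expectation under the model. The function $f$ and density $g$ are fixed; constants may depend on them. Estimator: $m_0=\inf\{k\in\mathbb{N}: |\gamma_k|^2\le \log^2(n)/n\}-1$. For $N\in\mathbb{N}=\{0,1,2,\dots\}$, $$\bar U(Y,N)=-\sum_{|k|\le N}|\gamma_k|^{-2}\Big\{|\tilde c_k|^2-\frac{\epsilon^2}{n}\Big\}+\frac{\epsilon^2}{n}\sum_{|k|\le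 N}|\gamma_k|^{-2}+\frac{\log^2(n)}{n}\sum_{|k|\le N}|\gamma_k|^{-4}\Big\{|\tilde c_k|^2-\frac{\epsilon^2}{n}\Big\},$$ $N^\star$ is a minimizer of $N\mapsto\bar U(Y,N)$ over $N\le m_0$, and $\theta^\star_k=\frac{\tilde c_k}{\gamma_k}\mathbf 1_{\{|k|\le N^\star\}}$, $k\in\mathbb{Z}$. *)

theory Defs
  imports "HOL-Probability.Probability"
begin

section \<open>Brownian motion and the Wiener integral on the unit interval\<close>

definition std_brownian_motion :: "'w measure \<Rightarrow> (real \<Rightarrow> 'w \<Rightarrow> real) \<Rightarrow> bool" where
  "std_brownian_motion M W \<longleftrightarrow>
     (\<forall>t\<in>{0..1}. W t \<in> borel_measurable M) \<and>
     (AE \<omega> in M. W 0 \<omega> = 0) \<and>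
     (AE \<omega> in M. continuous_on {0..1} (\<lambda>t. W t \<omega>)) \<and>
     (\<forall>s t. 0 \<le> s \<longrightarrow> s < t \<longrightarrow> t \<le> 1 \<longrightarrow>
        distributed M lborel (\<lambda>\<omega>. W t \<omega> - W s \<omega>) (normal_density 0 (sqrt (t - s)))) \<and>
     (\<forall>(m::nat) u. 0 \<le> u 0 \<longrightarrow> (\<forall>i<m. u i < u (Suc i)) \<longrightarrow> u m \<le> 1 \<longrightarrow>
        prob_space.indep_vars M (\<lambda>_. borel) (\<lambda>i \<omega>. W (u (Suc i)) \<omega> - W (u i) \<omega>) {..<m})"

text \<open>A list of triples \<open>(s, t, a)\<close> encodes the step function that is the sum of the
  \<open>a\<close> times the indicators of \<open>(s, t]\<close>; the intervals may overlap.\<close>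

type_synonym step = "(real \<times> real \<times> complex) list"

definition valid_step :: "step \<Rightarrow> bool" where
  "valid_step p \<longleftrightarrow> (\<forall>(s, t, a)\<in>set p. 0 \<le> s \<and> s \<le> t \<and> t \<le> 1)"

definition step_fun :: "step \<Rightarrow> real \<Rightarrow> complex" where
  "step_fun p x = (\<Sum>(s, t, a)\<leftarrow>p. a * indicator {s<..t} x)"

definition step_integral :: "(real \<Rightarrow> 'w \<Rightarrow> real) \<Rightarrow> step \<Rightarrow> 'w \<Rightarrow> complex" where
  "step_integral W p \<omega> = (\<Sum>(s, t, a)\<leftarrow>p. a * of_real (W t \<omega> - W s \<omega>))"

text \<open>\<open>Z\<close> is a version of the integral of \<open>\<phi>\<close> over \<open>[0,1]\<close> against \<open>dW\<close>: the mean-square limit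
  of the integrals of step functions that converge to \<open>\<phi>\<close> in \<open>L\<^sup>2[0,1]\<close>. By the Ito isometry
  it is unique up to almost sure equality.\<close>

definition has_wiener_integral ::
    "'w measure \<Rightarrow> (real \<Rightarrow> 'w \<Rightarrow> real) \<Rightarrow> (real \<Rightarrow> complex) \<Rightarrow> ('w \<Rightarrow> complex) \<Rightarrow> bool" where
  "has_wiener_integral M W \<phi> Z \<longleftrightarrow>
     Z \<in> borel_measurable M \<and>
     (\<exists>p :: nat \<Rightarrow> step. (\<forall>r. valid_step (p r)) \<and>
        (\<lambda>r. \<integral>\<^sup>+x\<in>{0..1}. ennreal ((cmod (step_fun (p r) x - \<phi> x))\<^sup>2) \<partial>lborel)
          \<longlonglongrightarrow> 0 \<and>
        (\<lambda>r. \<integral>\<^sup>+\<omega>. ennreal ((cmod (step_integral W (p r) \<omega> - Z \<omega>))\<^sup>2) \<partial>M)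
          \<longlonglongrightarrow> 0)"

section \<open>The shifted curves model\<close>

definition fourier_char :: "int \<Rightarrow> real \<Rightarrow> complex" where
  "fourier_char k x = exp (- 2 * \<i> * of_int k * of_real pi * of_real x)"

definition fourier_coeff :: "(real \<Rightarrow> real) \<Rightarrow> int \<Rightarrow> complex" where
  "fourier_coeff f k = set_lebesgue_integral lebesgue {0..1} (\<lambda>x. fourier_char k x * of_real (f x))"

definition shift_coeff :: "(real \<Rightarrow> real) \<Rightarrow> int \<Rightarrow> complex" where
  "shift_coeff g k = integral\<^sup>L lborel (\<lambda>x. fourier_char k x * of_real (g x))"

definition prob_density :: "(real \<Rightarrow> real) \<Rightarrow> bool" where
  "prob_density g \<longleftrightarrow>
     g \<in> borel_measurable borel \<and> (\<forall>x. 0 \<le> g x) \<and> (\<integral>\<^sup>+x. ennreal (g x) \<partial>lborel) = 1"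

definition shifted_curves_model ::
    "'w measure \<Rightarrow> (real \<Rightarrow> real) \<Rightarrow> nat \<Rightarrow> (nat \<Rightarrow> 'w \<Rightarrow> real) \<Rightarrow> (nat \<Rightarrow> real \<Rightarrow> 'w \<Rightarrow> real) \<Rightarrow> bool"
  where
  "shifted_curves_model M g n \<tau> W \<longleftrightarrow>
     prob_space M \<and>
     (\<forall>j\<in>{1..n}. std_brownian_motion M (W j)) \<and>
     prob_space.indep_vars M (\<lambda>_. \<Pi>\<^sub>M t\<in>{0..1}. borel) (\<lambda>j \<omega>. \<lambda>t\<in>{0..1}. W j t \<omega>) {1..n} \<and>
     (\<forall>j\<in>{1..n}. distributed M lborel (\<tau> j) (\<lambda>x. ennreal (g x))) \<and>
     prob_space.indep_vars M (\<lambda>_. borel) \<tau> {1..n} \<and>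
     prob_space.indep_set M
       (sets (vimage_algebra (space M) (\<lambda>\<omega>. \<lambda>j\<in>{1..n}. \<lambda>t\<in>{0..1}. W j t \<omega>)
          (\<Pi>\<^sub>M j\<in>{1..n}. \<Pi>\<^sub>M t\<in>{0..1}. borel)))
       (sets (vimage_algebra (space M) (\<lambda>\<omega>. \<lambda>j\<in>{1..n}. \<tau> j \<omega>) (\<Pi>\<^sub>M j\<in>{1..n}. borel)))"

text \<open>\<open>I j k\<close> stands for the Wiener integral of \<open>fourier_char k\<close> against \<open>dW\<^sub>j\<close>, so that the summand
  is the integral of \<open>fourier_char k\<close> against \<open>dY\<^sub>j(x) = f(x - \<tau>\<^sub>j) dx + \<epsilon> dW\<^sub>j(x)\<close>.\<close>

definition c_tilde ::
    "(real \<Rightarrow> real) \<Rightarrow> real \<Rightarrow> nat \<Rightarrow> (nat \<Rightarrow> 'w \<Rightarrow> real) \<Rightarrow> (nat \<Rightarrow> int \<Rightarrow> 'w \<Rightarrow> complex)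
      \<Rightarrow> 'w \<Rightarrow> int \<Rightarrow> complex" where
  "c_tilde f \<epsilon> n \<tau> I \<omega> k =
     (1 / of_nat n) * (\<Sum>j=1..n.
        set_lebesgue_integral lebesgue {0..1} (\<lambda>x. fourier_char k x * of_real (f (x - \<tau> j \<omega>)))
        + of_real \<epsilon> * I j k \<omega>)"

section \<open>The spectral cut-off estimator\<close>

text \<open>Truncated subtraction and the infimum of the empty set play no role here: the coefficient
  at \<open>0\<close> of a density is \<open>1\<close>, and \<open>ln(n)\<^sup>2/n < 1\<close>, so \<open>0\<close> is not in the set; for \<open>n \<ge> 2\<close> the set
  is nonempty by the Riemann-Lebesgue lemma.\<close>

definition m_zero :: "(real \<Rightarrow> real) \<Rightarrow> nat \<Rightarrow> nat" where
  "m_zero g n = Inf {k::nat. (cmod (shift_coeff g (int k)))\<^sup>2 \<le> (ln (real n))\<^sup>2 / real n} - 1"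

definition U_bar :: "(real \<Rightarrow> real) \<Rightarrow> real \<Rightarrow> nat \<Rightarrow> (int \<Rightarrow> complex) \<Rightarrow> nat \<Rightarrow> real" where
  "U_bar g \<epsilon> n c N =
     - (\<Sum>k\<in>{- int N..int N}. ((cmod (c k))\<^sup>2 - \<epsilon>\<^sup>2 / real n) / (cmod (shift_coeff g k))\<^sup>2)
     + \<epsilon>\<^sup>2 / real n * (\<Sum>k\<in>{- int N..int N}. 1 / (cmod (shift_coeff g k))\<^sup>2)
     + (ln (real n))\<^sup>2 / real n *
         (\<Sum>k\<in>{- int N..int N}. ((cmod (c k))\<^sup>2 - \<epsilon>\<^sup>2 / real n) / (cmod (shift_coeff g k)) ^ 4)"

definition theta_star :: "(real \<Rightarrow> real) \<Rightarrow> (int \<Rightarrow> complex) \<Rightarrow> nat \<Rightarrow> int \<Rightarrow> complex" where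
  "theta_star g c N k = (if \<bar>k\<bar> \<le> int N then c k / shift_coeff g k else 0)"

definition R_bar ::
    "(real \<Rightarrow> real) \<Rightarrow> real \<Rightarrow> nat \<Rightarrow> (int \<Rightarrow> complex) \<Rightarrow> nat \<Rightarrow> real" where
  "R_bar g \<epsilon> n \<theta> N =
     (\<Sum>\<^sub>\<infinity>k\<in>{k. \<bar>k\<bar> > int N}. (cmod (\<theta> k))\<^sup>2)
     + \<epsilon>\<^sup>2 / real n * (\<Sum>k\<in>{- int N..int N}. 1 / (cmod (shift_coeff g k))\<^sup>2)
     + (ln (real n))\<^sup>2 / real n *
         (\<Sum>k\<in>{- int N..int N}. (cmod (\<theta> k))\<^sup>2 / (cmod (shift_coeff g k))\<^sup>2)"

text \<open>The squared distance in \<open>\<ell>\<^sup>2(\<int>)\<close>, extended-real valued so that a divergent sum is infinite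
  (and not \<open>0\<close>).\<close>

definition l2_dist_sq :: "(int \<Rightarrow> complex) \<Rightarrow> (int \<Rightarrow> complex) \<Rightarrow> ennreal" where
  "l2_dist_sq a b = (\<Sum>\<^sub>\<infinity>k. ennreal ((cmod (a k - b k))\<^sup>2))"

end

theory Submission
  imports Defs "HOL-Real_Asymp.Real_Asymp"
begin

text \<open>
  Write \<open>\<eta>\<^sub>k = c\<^sub>k / \<gamma>\<^sub>k - \<theta>\<^sub>k = \<theta>\<^sub>k r\<^sub>k + s\<^sub>k\<close>, where \<open>r\<close> comes from the random shifts and \<open>s\<close> from the
  Brownian noise. Comparing the criterion at its minimizer \<open>N\<close> with its value at a deterministic \<open>N\<^sub>0\<close>
  bounds the loss at \<open>N\<close> plus \<open>\<kappa>\<close> times the risk at \<open>N\<close> by \<open>1 + \<kappa>\<close> times the risk at \<open>N\<^sub>0\<close> plus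
  fluctuation terms. By the arithmetic-geometric inequality the fluctuations are a small multiple of
  the two risks plus positive parts of centred variables minus a penalty. For the shifts, the penalty
  of order \<open>ln\<^sup>2 n / n\<close> dominates the Hoeffding tail, as \<open>n exp (- c ln\<^sup>2 n)\<close> is \<open>O(1 / n)\<close>. For the
  noise, exponential moments of linear and quadratic forms of the Gaussian coefficients give bounds
  that are summable in the cut-off. The cross terms of shifts and noise need no independence.

  This gives the inequality with the factor \<open>1 + 2 \<kappa>\<close> and some constant \<open>C(\<kappa>)\<close>, for every \<open>\<kappa>\<close>. As
  the rate of \<open>h\<^sub>1\<close> is free, \<open>\<kappa>\<close> may tend to \<open>0\<close> so slowly with \<open>\<gamma>\<close> that \<open>C(\<kappa>) \<le> 1 / \<gamma>\<close>.
\<close>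

section \<open>Convergence in mean square\<close>

text \<open>The minimizer depends on the noise, so fluctuations at it are not centred and must be
  controlled at all cut-offs up to \<open>m_zero g n\<close> at once. A supremum over cut-offs is
  replaced by a sum of positive parts. This is affordable because the penalty at cut-off
  \<open>P\<close> is at least of order \<open>P\<close> times the largest weight there, which makes
  the terms decay exponentially in \<open>P\<close>; polynomial decay of the shift coefficients
  enters here.

  The bound \<open>m_zero\<close> keeps the factors \<open>1 - b k\<close> nonnegative and the
  weights below \<open>n\<close> over the squared logarithm; that factor \<open>n\<close> is what
  the Hoeffding tail has to beat. Cross terms are compared only as a difference between two
  cut-offs: a full band would leave a multiple of the energy of \<theta>, which the risk does not
  absorb.

  The Wiener integrals are given only as mean-square limits. The Gaussian input is therefore reduced
  to second moments and to upper bounds on exponential moments of real linear functionals, obtained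
  by Fatou's lemma; quadratic forms are derived from these.\<close>

definition sqint :: "'a measure \<Rightarrow> ('a \<Rightarrow> complex) \<Rightarrow> ennreal" where
  "sqint M u = (\<integral>\<^sup>+x. ennreal ((cmod (u x))\<^sup>2) \<partial>M)"

text \<open>Stated in \<open>ennreal\<close>, so that the rules below carry no integrability
  conditions; finiteness is recovered only in \<open>l2_conv_sqint\<close>.\<close>

definition l2_conv :: "'a measure \<Rightarrow> (nat \<Rightarrow> 'a \<Rightarrow> complex) \<Rightarrow> ('a \<Rightarrow> complex) \<Rightarrow> bool" where
  "l2_conv M u v \<longleftrightarrow> (\<lambda>r. sqint M (\<lambda>x. u r x - v x)) \<longlonglongrightarrow> 0"

text \<open>Young's inequality with a free weight: small \<open>t\<close> gives continuity of the
  norm, and \<open>t = \<delta>\<close> later keeps the factor of the noise close to 1.\<close>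

lemma sq_norm_add_le:
  fixes a b :: complex
  assumes "t > 0"
  shows "(cmod (a + b))\<^sup>2 \<le> (1 + t) * (cmod a)\<^sup>2 + (1 + 1/t) * (cmod b)\<^sup>2"
proof -
  have "(cmod (a + b))\<^sup>2 \<le> (cmod a + cmod b)\<^sup>2"
    by (intro power_mono norm_triangle_ineq) auto
  also have "\<dots> \<le> (1 + t) * (cmod a)\<^sup>2 + (1 + 1/t) * (cmod b)\<^sup>2"
  proof -
    have "0 \<le> (t * cmod a - cmod b)\<^sup>2 / t" using assms by simp
    also have "\<dots> = t * (cmod a)\<^sup>2 - 2 * cmod a * cmod b + (cmod b)\<^sup>2 / t"
      using assms by (simp add: power2_eq_square field_simps)
    finally show ?thesis using assms by (simp add: power2_eq_square field_simps)
  qed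
  finally show ?thesis .
qed

lemma sqint_add_le:
  assumes [measurable]: "u \<in> borel_measurable M" "v \<in> borel_measurable M" and t: "t > 0"
  shows "sqint M (\<lambda>x. u x + v x) \<le> ennreal (1 + t) * sqint M u + ennreal (1 + 1/t) * sqint M v"
proof -
  have "sqint M (\<lambda>x. u x + v x) \<le> (\<integral>\<^sup>+x. ennreal (1 + t) * ennreal ((cmod (u x))\<^sup>2)
      + ennreal (1 + 1/t) * ennreal ((cmod (v x))\<^sup>2) \<partial>M)"
    unfolding sqint_def using t sq_norm_add_le[OF t]
    by (intro nn_integral_mono) (simp flip: ennreal_mult'' ennreal_plus)
  also have "\<dots> = ennreal (1 + t) * sqint M u + ennreal (1 + 1/t) * sqint M v"
    unfolding sqint_def by (subst nn_integral_add) (auto simp: nn_integral_cmult)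
  finally show ?thesis .
qed

lemma sqint_cmult:
  assumes [measurable]: "u \<in> borel_measurable M"
  shows "sqint M (\<lambda>x. c * u x) = ennreal ((cmod c)\<^sup>2) * sqint M u"
  unfolding sqint_def by (subst nn_integral_cmult[symmetric])
    (auto simp: norm_mult power_mult_distrib ennreal_mult)

lemma l2_conv_cmult:
  assumes [measurable]: "\<And>r. u r \<in> borel_measurable M" "v \<in> borel_measurable M"
    and "l2_conv M u v"
  shows "l2_conv M (\<lambda>r x. c * u r x) (\<lambda>x. c * v x)"
proof -
  have "(\<lambda>r. ennreal ((cmod c)\<^sup>2) * sqint M (\<lambda>x. u r x - v x)) \<longlonglongrightarrow> ennreal ((cmod c)\<^sup>2) * 0"
    using assms(3) unfolding l2_conv_def by (intro ennreal_tendsto_cmult) auto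
  then show ?thesis
    unfolding l2_conv_def by (simp flip: sqint_cmult right_diff_distrib)
qed

lemma l2_conv_add:
  assumes [measurable]: "\<And>r. u r \<in> borel_measurable M" "v \<in> borel_measurable M"
     "\<And>r. u' r \<in> borel_measurable M" "v' \<in> borel_measurable M"
    and "l2_conv M u v" "l2_conv M u' v'"
  shows "l2_conv M (\<lambda>r x. u r x + u' r x) (\<lambda>x. v x + v' x)"
proof -
  have *: "sqint M (\<lambda>x. u r x + u' r x - (v x + v' x))
      \<le> ennreal 2 * sqint M (\<lambda>x. u r x - v x) + ennreal 2 * sqint M (\<lambda>x. u' r x - v' x)" for r
    using sqint_add_le[of "\<lambda>x. u r x - v x" M "\<lambda>x. u' r x - v' x" 1]
    by (simp add: algebra_simps)
  have lim: "(\<lambda>r. ennreal 2 * sqint M (\<lambda>x. u r x - v x) + ennreal 2 * sqint M (\<lambda>x. u' r x - v' x))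
     \<longlonglongrightarrow> ennreal 2 * 0 + ennreal 2 * 0"
    using assms(5,6) unfolding l2_conv_def by (intro tendsto_add ennreal_tendsto_cmult) auto
  show ?thesis
    unfolding l2_conv_def
    by (rule tendsto_sandwich[OF _ _ tendsto_const lim[simplified]]) (use * in \<open>auto simp: eventually_sequentially\<close>)
qed

lemma l2_conv_sum:
  assumes "finite A"
    and "\<And>i r. i \<in> A \<Longrightarrow> u i r \<in> borel_measurable M" "\<And>i. i \<in> A \<Longrightarrow> v i \<in> borel_measurable M"
    and "\<And>i. i \<in> A \<Longrightarrow> l2_conv M (u i) (v i)"
  shows "l2_conv M (\<lambda>r x. \<Sum>i\<in>A. u i r x) (\<lambda>x. \<Sum>i\<in>A. v i x)"
  using assms
proof (induction A rule: finite_induct)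
  case empty
  then show ?case by (simp add: l2_conv_def sqint_def)
next
  case (insert a A)
  then show ?case by (simp add: l2_conv_add borel_measurable_sum)
qed

text \<open>Taking real parts is a contraction. The parts are cast back to complex numbers so that
  \<open>l2_conv\<close> still applies.\<close>

lemma l2_conv_Re:
  assumes "l2_conv M u v"
  shows "l2_conv M (\<lambda>r x. of_real (Re (u r x))) (\<lambda>x. of_real (Re (v x)))"
proof -
  have "sqint M (\<lambda>x. of_real (Re (u r x)) - of_real (Re (v x))) \<le> sqint M (\<lambda>x. u r x - v x)" for r
    unfolding sqint_def
  proof (intro nn_integral_mono ennreal_leI power_mono)
    fix x
    show "cmod (of_real (Re (u r x)) - of_real (Re (v x))) \<le> cmod (u r x - v x)"
      using abs_Re_le_cmod[of "u r x - v x"] by (simp flip: of_real_diff)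
  qed simp
  then show ?thesis
    using assms unfolding l2_conv_def
    by (auto intro: tendsto_sandwich[OF _ _ tendsto_const, where h = "\<lambda>r. sqint M (\<lambda>x. u r x - v x)"])
qed

text \<open>Continuity of the norm. The weighted Young inequality, used in both directions, replaces
  the reverse triangle inequality, so that no square roots or differences of \<open>ennreal\<close>
  values occur.\<close>

lemma l2_conv_sqint:
  assumes m[measurable]: "\<And>r. u r \<in> borel_measurable M" "v \<in> borel_measurable M"
    and conv: "l2_conv M u v" and fin: "\<And>r. sqint M (u r) < \<infinity>"
  shows "sqint M v < \<infinity>" "(\<lambda>r. sqint M (u r)) \<longlonglongrightarrow> sqint M v"
proof -
  let ?e = "\<lambda>r. sqint M (\<lambda>x. u r x - v x)"
  have sym: "?e r = sqint M (\<lambda>x. v x - u r x)" for r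
    unfolding sqint_def by (simp add: norm_minus_commute)
  have "eventually (\<lambda>r. ?e r < 1) sequentially"
    using conv unfolding l2_conv_def by (rule order_tendstoD) simp
  then obtain r0 where r0: "?e r0 < 1" by (auto simp: eventually_sequentially)
  have le1: "sqint M v \<le> ennreal (1 + t) * sqint M (u r) + ennreal (1 + 1/t) * ?e r" if "t > 0" for t r
    unfolding sym using sqint_add_le[of "u r" M "\<lambda>x. v x - u r x" t] that by simp
  have le2: "sqint M (u r) \<le> ennreal (1 + t) * sqint M v + ennreal (1 + 1/t) * ?e r" if "t > 0" for t r
    using sqint_add_le[of v M "\<lambda>x. u r x - v x" t] that by simp
  have le3: "?e r \<le> ennreal 2 * sqint M (u r) + ennreal 2 * sqint M v" for r
    using sqint_add_le[of "u r" M "\<lambda>x. - v x" 1] by (simp add: sqint_def)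
  have "sqint M v \<le> ennreal 2 * sqint M (u r0) + ennreal 2 * ?e r0"
    using le1[of 1 r0] by simp
  also have "\<dots> < \<infinity>"
    using fin[of r0] less_trans[OF r0, of \<infinity>] by (simp add: ennreal_mult_less_top)
  finally show fv: "sqint M v < \<infinity>" .
  have fe: "?e r < \<infinity>" for r
    using fin[of r] fv by (intro le_less_trans[OF le3[of r]]) (simp add: ennreal_mult_less_top)
  obtain V where V: "sqint M v = ennreal V" "V \<ge> 0" using fv by (cases "sqint M v") auto
  define U where "U r = enn2real (sqint M (u r))" for r
  define E where "E r = enn2real (?e r)" for r
  have U: "sqint M (u r) = ennreal (U r)" "U r \<ge> 0" for r
    using fin[of r] by (auto simp: U_def)
  have E: "?e r = ennreal (E r)" "E r \<ge> 0" for r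
    using fe[of r] by (auto simp: E_def)
  have E0: "E \<longlonglongrightarrow> 0"
    using conv unfolding l2_conv_def E by (subst (asm) ennreal_0[symmetric], subst (asm) tendsto_ennreal_iff) (auto simp: E)
  have l1: "V \<le> (1 + t) * U r + (1 + 1/t) * E r" if "t > 0" for t r
    using le1[OF that, of r] that U E V
    by (simp add: U E V flip: ennreal_mult'' ennreal_plus)
  have l2: "U r \<le> (1 + t) * V + (1 + 1/t) * E r" if "t > 0" for t r
    using le2[OF that, of r] that U E V
    by (simp add: U E V flip: ennreal_mult'' ennreal_plus)
  have "U \<longlonglongrightarrow> V"
  proof (rule LIMSEQ_I)
    fix s :: real assume s: "s > 0"
    \<comment> \<open>With this weight the terms proportional to \<open>V\<close> stay within about
      \<open>s / 2\<close>; once \<open>t\<close> is fixed, the factor \<open>1 / t\<close> is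
      beaten by the convergence of \<open>E\<close>.\<close>
    define t where "t = min 1 (s / (4 * (V + 1)))"
    have t: "t > 0" "t \<le> 1" "2 * t * V < s / 2 + s/100"
    proof -
      show "t > 0" "t \<le> 1" using s V by (auto simp: t_def)
      have "t \<le> s / (4 * (V + 1))" by (simp add: t_def)
      then have "t * (4 * (V + 1)) \<le> s" using V by (subst (asm) pos_le_divide_eq) auto
      then have "t * (V + 1) \<le> s / 4" by (simp add: algebra_simps)
      then show "2 * t * V < s / 2 + s/100" using \<open>t > 0\<close> s by (simp add: algebra_simps)
    qed
    have "(\<lambda>r. (3 + 1/t) * E r) \<longlonglongrightarrow> (3 + 1/t) * 0" by (intro tendsto_intros E0)
    then have "eventually (\<lambda>r. (3 + 1/t) * E r < s / 4) sequentially"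
      by (rule order_tendstoD) (use s in auto)
    then obtain R where R: "\<And>r. r \<ge> R \<Longrightarrow> (3 + 1/t) * E r < s / 4"
      by (auto simp: eventually_sequentially)
    have "norm (U r - V) < s" if "r \<ge> R" for r
    proof -
      have a: "U r - V \<le> t * V + (1 + 1/t) * E r" using l2[OF t(1), of r] by (simp add: algebra_simps)
      \<comment> \<open>The inequality for \<open>V\<close> leaves \<open>t * U r\<close> on the
        right; weight 1 bounds it in terms of \<open>V\<close>.\<close>
      have "U r \<le> 2 * V + 2 * E r" using l2[of 1 r] by simp
      then have "t * U r \<le> t * (2 * V + 2 * E r)" using t by (intro mult_left_mono) auto
      moreover have "t * (2 * E r) \<le> 2 * E r" using t E[of r] by (simp add: mult_left_le_one_le)
      ultimately have b: "V - U r \<le> 2 * t * V + 2 * E r + (1 + 1/t) * E r" using l1[OF t(1), of r]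
        by (simp add: algebra_simps)
      have c: "0 \<le> t * V" "0 \<le> (1/t) * E r" using t V E[of r] by auto
      have d: "(3 + 1/t) * E r = 2 * E r + (1 + 1/t) * E r" by (simp add: algebra_simps)
      show ?thesis using a b c d R[OF that] t(3) s E(2)[of r] by (simp add: abs_less_iff)
    qed
    then show "\<exists>no. \<forall>r\<ge>no. norm (U r - V) < s" by auto
  qed
  then show "(\<lambda>r. sqint M (u r)) \<longlonglongrightarrow> sqint M v"
    unfolding U V by (intro tendsto_ennrealI)
qed

section \<open>Wiener integrals of step functions\<close>

text \<open>Each difference of \<open>F\<close> telescopes over the grid. The coefficients are
  independent of \<open>F\<close>, so the same \<alpha> describes the step function
  (\<open>F\<close> an indicator) and its stochastic integral (\<open>F\<close> a path).\<close>

lemma combination_of_increments: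
  fixes u :: "nat \<Rightarrow> real" and p :: step
  assumes "valid_step p" "\<And>s t a. (s, t, a) \<in> set p \<Longrightarrow> s \<in> u ` {..m} \<and> t \<in> u ` {..m}"
    and inc: "strict_mono_on {..m} u"
  shows "\<exists>\<alpha>::nat \<Rightarrow> complex. \<forall>F. (\<Sum>(s, t, a)\<leftarrow>p. a * (F t - F s)) = (\<Sum>i<m. \<alpha> i * (F (u (Suc i)) - F (u i)))"
  using assms(1,2)
proof (induction p)
  case Nil
  then show ?case by (auto intro!: exI[of _ "\<lambda>_. 0"])
next
  case (Cons x p)
  obtain s t a where x: "x = (s, t, a)" by (cases x)
  have "valid_step p" using Cons.prems(1) by (auto simp: valid_step_def)
  with Cons obtain \<alpha> where \<alpha>: "\<And>F. (\<Sum>(s, t, a)\<leftarrow>p. a * (F t - F s)) = (\<Sum>i<m. \<alpha> i * (F (u (Suc i)) - F (u i)))"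
    by force
  obtain i0 i1 where i: "s = u i0" "t = u i1" "i0 \<le> m" "i1 \<le> m"
    using Cons.prems(2)[of s t a] x by auto
  have "i0 \<le> i1"
  proof (rule ccontr)
    assume "\<not> i0 \<le> i1"
    then have "u i1 < u i0" using inc i by (auto simp: strict_mono_on_def)
    then show False using Cons.prems(1) x i by (auto simp: valid_step_def)
  qed
  show ?case
  proof (intro exI[of _ "\<lambda>i. \<alpha> i + (if i0 \<le> i \<and> i < i1 then a else 0)"] allI)
    fix F :: "real \<Rightarrow> complex"
    have "F t - F s = (\<Sum>i\<in>{i0..<i1}. F (u (Suc i)) - F (u i))"
      using sum_Suc_diff'[OF \<open>i0 \<le> i1\<close>, of "\<lambda>i. F (u i)"] by (simp add: i)
    then have "a * (F t - F s) = (\<Sum>i\<in>{i0..<i1}. a * (F (u (Suc i)) - F (u i)))"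
      by (simp add: sum_distrib_left)
    also have "\<dots> = (\<Sum>i<m. (if i0 \<le> i \<and> i < i1 then a else 0) * (F (u (Suc i)) - F (u i)))"
      using i by (intro sum.mono_neutral_cong_left) auto
    finally show "(\<Sum>(s, t, a)\<leftarrow>x # p. a * (F t - F s)) =
        (\<Sum>i<m. (\<alpha> i + (if i0 \<le> i \<and> i < i1 then a else 0)) * (F (u (Suc i)) - F (u i)))"
      using \<alpha>[of F] x by (simp add: sum.distrib distrib_right)
  qed
qed

text \<open>Overlapping intervals carry dependent increments; cutting at all endpoints gives
  disjoint cells, where independence of increments applies.\<close>

lemma step_refinement:
  assumes p: "valid_step p"
  obtains m u \<alpha> where "0 \<le> u 0" "\<And>i. i < m \<Longrightarrow> u i < u (Suc i)" "u m \<le> (1::real)"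
    "\<And>x. step_fun p x = (\<Sum>i<m. \<alpha> i * indicator {u i<..u (Suc i)} x)"
    "\<And>W \<omega>. step_integral W p \<omega> = (\<Sum>i<m. \<alpha> i * of_real (W (u (Suc i)) \<omega> - W (u i) \<omega>))"
proof -
  \<comment> \<open>The point 0 keeps the grid nonempty when the list is empty.\<close>
  define S where "S = insert 0 (\<Union>(s, t, a)\<in>set p. {s, t})"
  have S: "finite S" "S \<noteq> {}" "S \<subseteq> {0..1}"
    using p by (auto simp: S_def valid_step_def)
  define D where "D = sorted_list_of_set S"
  define m where "m = length D - 1"
  define u where "u i = D ! i" for i
  have D: "set D = S" "distinct D" "sorted D" "length D = Suc m"
  proof -
    have "0 < card S" using S by (simp add: card_gt_0_iff)
    then show "set D = S" "distinct D" "sorted D" "length D = Suc m"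
      using S by (simp_all add: D_def m_def)
  qed
  have im: "u ` {..m} = S"
    using D by (auto simp: u_def set_conv_nth less_Suc_eq_le)
  have inc: "strict_mono_on {..m} u"
    using D by (auto simp: strict_mono_on_def u_def intro!: sorted_wrt_nth_less[of "(<)"] simp: strict_sorted_iff)
  have "\<exists>\<alpha>::nat \<Rightarrow> complex. \<forall>F. (\<Sum>(s, t, a)\<leftarrow>p. a * (F t - F s)) = (\<Sum>i<m. \<alpha> i * (F (u (Suc i)) - F (u i)))"
    by (rule combination_of_increments[OF p _ inc]) (unfold im, force simp: S_def)
  then obtain \<alpha> :: "nat \<Rightarrow> complex" where
    \<alpha>: "\<And>F. (\<Sum>(s, t, a)\<leftarrow>p. a * (F t - F s)) = (\<Sum>i<m. \<alpha> i * (F (u (Suc i)) - F (u i)))" by auto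
  have uinc: "u i < u (Suc i)" if "i < m" for i
    using inc that by (auto simp: strict_mono_on_def)
  show ?thesis
  proof (rule that[of u m \<alpha>])
    have uS: "u i \<in> S" if "i \<le> m" for i using im that by auto
    show "0 \<le> u 0" using uS[of 0] S by auto
    show "u m \<le> 1" using uS[of m] S by auto
    show "u i < u (Suc i)" if "i < m" for i by (rule uinc[OF that])
    fix x
    \<comment> \<open>Writes the indicator as an increment of \<open>indicator {x..}\<close>, so
      that \<alpha> applies to the step function itself.\<close>
    have ind: "(indicator {s<..t} x :: complex) = indicator {x..} t - indicator {x..} s"
      if "s \<le> t" for s t :: real
      using that by (auto simp: indicator_def)
    have "step_fun p x = (\<Sum>(s, t, a)\<leftarrow>p. a * (indicator {x..} t - indicator {x..} s))"
      unfolding step_fun_def using p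
      by (intro arg_cong[where f = sum_list] map_cong refl) (auto simp: valid_step_def ind)
    also have "\<dots> = (\<Sum>i<m. \<alpha> i * (indicator {x..} (u (Suc i)) - indicator {x..} (u i)))" by (rule \<alpha>)
    also have "\<dots> = (\<Sum>i<m. \<alpha> i * indicator {u i<..u (Suc i)} x)"
      by (intro sum.cong refl) (use uinc in \<open>simp add: ind less_imp_le\<close>)
    finally show "step_fun p x = (\<Sum>i<m. \<alpha> i * indicator {u i<..u (Suc i)} x)" .
  next
    fix W :: "real \<Rightarrow> 'w \<Rightarrow> real" and \<omega>
    show "step_integral W p \<omega> = (\<Sum>i<m. \<alpha> i * of_real (W (u (Suc i)) \<omega> - W (u i) \<omega>))"
      unfolding step_integral_def using \<alpha>[of "\<lambda>t. of_real (W t \<omega>)"] by simp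
  qed
qed

text \<open>The moments of a centred normal variable, degenerate ones included: a sum of normal variables
  that happens to vanish has no density.\<close>

definition gauss_moments :: "'w measure \<Rightarrow> ('w \<Rightarrow> real) \<Rightarrow> real \<Rightarrow> bool" where
  "gauss_moments M Y v \<longleftrightarrow> Y \<in> borel_measurable M \<and> integrable M (\<lambda>\<omega>. (Y \<omega>)\<^sup>2) \<and>
     integral\<^sup>L M Y = 0 \<and> integral\<^sup>L M (\<lambda>\<omega>. (Y \<omega>)\<^sup>2) = v \<and>
     (\<forall>t. (\<integral>\<^sup>+\<omega>. ennreal (exp (t * Y \<omega>)) \<partial>M) = ennreal (exp (t\<^sup>2 * v / 2)))"

text \<open>Completing the square: tilting the density by \<open>exp (t * x)\<close> moves its mean
  to \<open>t * s\<^sup>2\<close>.\<close>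

lemma normal_density_mgf:
  assumes "s > 0"
  shows "(\<integral>\<^sup>+x. ennreal (normal_density 0 s x * exp (t * x)) \<partial>lborel) = ennreal (exp (t\<^sup>2 * s\<^sup>2 / 2))"
proof -
  have "normal_density 0 s x * exp (t * x) = exp (t\<^sup>2 * s\<^sup>2 / 2) * normal_density (t * s\<^sup>2) s x" for x
  proof -
    have "- (x - 0)\<^sup>2 / (2 * s\<^sup>2) + t * x = t\<^sup>2 * s\<^sup>2 / 2 + - (x - t * s\<^sup>2)\<^sup>2 / (2 * s\<^sup>2)"
      using assms by (simp add: field_simps power2_eq_square)
    then have "exp (- (x - 0)\<^sup>2 / (2 * s\<^sup>2)) * exp (t * x) =
        exp (t\<^sup>2 * s\<^sup>2 / 2) * exp (- (x - t * s\<^sup>2)\<^sup>2 / (2 * s\<^sup>2))"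
      by (simp only: exp_add[symmetric])
    then show ?thesis unfolding normal_density_def by (simp add: mult_ac)
  qed
  then have "(\<integral>\<^sup>+x. ennreal (normal_density 0 s x * exp (t * x)) \<partial>lborel) =
      (\<integral>\<^sup>+x. ennreal (exp (t\<^sup>2 * s\<^sup>2 / 2)) * ennreal (normal_density (t * s\<^sup>2) s x) \<partial>lborel)"
    by (simp add: ennreal_mult)
  also have "\<dots> = ennreal (exp (t\<^sup>2 * s\<^sup>2 / 2)) * 1"
  proof (subst nn_integral_cmult)
    show "ennreal (exp (t\<^sup>2 * s\<^sup>2 / 2)) * (\<integral>\<^sup>+x. ennreal (normal_density (t * s\<^sup>2) s x) \<partial>lborel)
      = ennreal (exp (t\<^sup>2 * s\<^sup>2 / 2)) * 1"
      using assms by (subst nn_integral_eq_integral) auto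
  qed auto
  finally show ?thesis by simp
qed

context prob_space
begin

lemma integrable_of_sq:
  fixes Y :: "'a \<Rightarrow> real"
  assumes [measurable]: "Y \<in> borel_measurable M" and "integrable M (\<lambda>\<omega>. (Y \<omega>)\<^sup>2)"
  shows "integrable M Y"
proof (rule Bochner_Integration.integrable_bound)
  show "integrable M (\<lambda>\<omega>. 1 + (Y \<omega>)\<^sup>2)" using assms by simp
  have "\<bar>y\<bar> \<le> 1 + y\<^sup>2" for y :: real
    using zero_le_power2[of "\<bar>y\<bar> - 1"] by (simp add: power2_eq_square algebra_simps)
  then show "AE \<omega> in M. norm (Y \<omega>) \<le> norm (1 + (Y \<omega>)\<^sup>2)" by simp
qed simp

lemma gauss_moments_normal:
  assumes "distributed M lborel Y (normal_density 0 s)" "s > 0"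
  shows "gauss_moments M (\<lambda>\<omega>. c * Y \<omega>) (c\<^sup>2 * s\<^sup>2)"
proof -
  have m[measurable]: "Y \<in> borel_measurable M" using distributed_measurable[OF assms(1)] by simp
  have E0: "expectation Y = 0" using normal_distributed_expectation[OF assms(2,1)] .
  have "integrable M (\<lambda>\<omega>. (Y \<omega>)\<^sup>2) \<longleftrightarrow> integrable lborel (\<lambda>x. normal_density 0 s x * x\<^sup>2)"
    by (rule distributed_integrable[OF assms(1), symmetric]) auto
  then have i: "integrable M (\<lambda>\<omega>. (Y \<omega>)\<^sup>2)"
    using integrable_normal_moment[OF assms(2), of 0 2] by simp
  have E2: "expectation (\<lambda>\<omega>. (Y \<omega>)\<^sup>2) = s\<^sup>2"
    using normal_distributed_variance[OF assms(2,1)] E0 by simp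
  have mgf: "(\<integral>\<^sup>+\<omega>. ennreal (exp (t * Y \<omega>)) \<partial>M) = ennreal (exp (t\<^sup>2 * s\<^sup>2 / 2))" for t
  proof -
    have "(\<integral>\<^sup>+\<omega>. ennreal (exp (t * Y \<omega>)) \<partial>M) =
        (\<integral>\<^sup>+x. ennreal (normal_density 0 s x) * ennreal (exp (t * x)) \<partial>lborel)"
      by (rule distributed_nn_integral[OF assms(1), symmetric]) auto
    also have "\<dots> = ennreal (exp (t\<^sup>2 * s\<^sup>2 / 2))"
      using normal_density_mgf[OF assms(2), of t] by (simp add: ennreal_mult)
    finally show ?thesis .
  qed
  show ?thesis
    unfolding gauss_moments_def using i E0 E2 mgf[of "_ * c"]
    by (auto simp: power_mult_distrib mult_ac)
qed

text \<open>By independence the exponential moments multiply. The second moments add because the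
  cross term of one summand with the rest has mean zero, which is why that half goes by
  induction.\<close>

lemma gauss_moments_sum:
  assumes "finite A" "indep_vars (\<lambda>_. borel) X A" "\<And>i. i \<in> A \<Longrightarrow> gauss_moments M (X i) (v i)"
  shows "gauss_moments M (\<lambda>\<omega>. \<Sum>i\<in>A. X i \<omega>) (\<Sum>i\<in>A. v i)"
proof -
  have mgf: "(\<integral>\<^sup>+\<omega>. ennreal (exp (t * (\<Sum>i\<in>A. X i \<omega>))) \<partial>M) = ennreal (exp (t\<^sup>2 * (\<Sum>i\<in>A. v i) / 2))" for t
  proof -
    have "(\<integral>\<^sup>+\<omega>. ennreal (exp (t * (\<Sum>i\<in>A. X i \<omega>))) \<partial>M) = (\<integral>\<^sup>+\<omega>. (\<Prod>i\<in>A. ennreal (exp (t * X i \<omega>))) \<partial>M)"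
      using assms(1) by (simp add: sum_distrib_left exp_sum prod_ennreal)
    also have "\<dots> = (\<Prod>i\<in>A. \<integral>\<^sup>+\<omega>. ennreal (exp (t * X i \<omega>)) \<partial>M)"
      by (intro indep_vars_nn_integral assms(1) indep_vars_compose2[OF assms(2)]) auto
    also have "\<dots> = (\<Prod>i\<in>A. ennreal (exp (t\<^sup>2 * v i / 2)))"
      using assms(3) by (intro prod.cong) (auto simp: gauss_moments_def)
    also have "\<dots> = ennreal (exp (t\<^sup>2 * (\<Sum>i\<in>A. v i) / 2))"
      using assms(1) by (simp add: prod_ennreal exp_sum[symmetric] sum_distrib_left sum_divide_distrib)
    finally show ?thesis .
  qed
  have "integrable M (\<lambda>\<omega>. (\<Sum>i\<in>A. X i \<omega>)\<^sup>2) \<and> expectation (\<lambda>\<omega>. \<Sum>i\<in>A. X i \<omega>) = 0 \<and>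
      expectation (\<lambda>\<omega>. (\<Sum>i\<in>A. X i \<omega>)\<^sup>2) = (\<Sum>i\<in>A. v i)"
    using assms
  proof (induction A rule: finite_induct)
    case empty then show ?case by simp
  next
    case (insert a A)
    let ?S = "\<lambda>\<omega>. \<Sum>i\<in>A. X i \<omega>"
    have ind: "indep_var borel (X a) borel ?S" by (rule indep_vars_sum[OF insert(1,2,4)])
    have [measurable]: "\<And>i. i \<in> insert a A \<Longrightarrow> X i \<in> borel_measurable M" using insert by (auto simp: gauss_moments_def)
    have [measurable]: "?S \<in> borel_measurable M" "X a \<in> borel_measurable M" by auto
    have IH: "integrable M (\<lambda>\<omega>. (?S \<omega>)\<^sup>2)" "expectation ?S = 0" "expectation (\<lambda>\<omega>. (?S \<omega>)\<^sup>2) = (\<Sum>i\<in>A. v i)"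
      using insert indep_vars_subset[OF insert(4), of A] by auto
    have a: "integrable M (\<lambda>\<omega>. (X a \<omega>)\<^sup>2)" "expectation (X a) = 0" "expectation (\<lambda>\<omega>. (X a \<omega>)\<^sup>2) = v a"
      using insert(5)[of a] by (auto simp: gauss_moments_def)
    have i: "integrable M (X a)" "integrable M ?S" using a IH by (auto intro: integrable_of_sq)
    have p: "integrable M (\<lambda>\<omega>. X a \<omega> * ?S \<omega>)" "expectation (\<lambda>\<omega>. X a \<omega> * ?S \<omega>) = 0"
      using indep_var_integrable[OF ind i] indep_var_lebesgue_integral[OF ind i] a by auto
    have e: "(\<Sum>i\<in>insert a A. X i \<omega>) = X a \<omega> + ?S \<omega>" for \<omega> using insert by simp
    have sq: "(X a \<omega> + ?S \<omega>)\<^sup>2 = (X a \<omega>)\<^sup>2 + (?S \<omega>)\<^sup>2 + 2 * (X a \<omega> * ?S \<omega>)" for \<omega>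
      by (simp add: power2_sum)
    show ?case
      unfolding e sq using i a IH p insert(1,2) by simp
  qed
  moreover have "(\<lambda>\<omega>. \<Sum>i\<in>A. X i \<omega>) \<in> borel_measurable M"
    using assms(3) by (intro borel_measurable_sum) (auto simp: gauss_moments_def)
  ultimately show ?thesis using mgf by (auto simp: gauss_moments_def)
qed

end

text \<open>Real parts suffice: an imaginary part is the real part after multiplication of the
  coefficients by \<open>- \<i>\<close>.\<close>

definition step_energy :: "step \<Rightarrow> real" where
  "step_energy p = (\<integral>x\<in>{0..1}. (Re (step_fun p x))\<^sup>2 \<partial>lborel)"

text \<open>The Ito isometry for step functions. On disjoint cells the square of the sum is the sum
  of the squares, which matches the variance of a sum of independent increments.\<close>

lemma step_energy_properties:
  fixes M :: "'w measure"
  assumes p: "valid_step p"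
  shows "ennreal (step_energy p) = (\<integral>\<^sup>+x\<in>{0..1}. ennreal ((Re (step_fun p x))\<^sup>2) \<partial>lborel)" (is ?A)
    and "prob_space M \<Longrightarrow> std_brownian_motion M W \<Longrightarrow>
      gauss_moments M (\<lambda>\<omega>. Re (step_integral W p \<omega>)) (step_energy p)" (is "?P \<Longrightarrow> ?Q \<Longrightarrow> ?B")
proof -
  obtain m u \<alpha> where u: "0 \<le> u 0" "\<And>i. i < m \<Longrightarrow> u i < u (Suc i)" "u m \<le> (1::real)"
    and sf: "\<And>x. step_fun p x = (\<Sum>i<m. \<alpha> i * indicator {u i<..u (Suc i)} x)"
    and si: "\<And>(W :: real \<Rightarrow> 'w \<Rightarrow> real) \<omega>. step_integral W p \<omega> = (\<Sum>i<m. \<alpha> i * of_real (W (u (Suc i)) \<omega> - W (u i) \<omega>))"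
    by (rule step_refinement[OF p]) blast
  have mono: "u i \<le> u j" if "i \<le> j" "j \<le> m" for i j
    using that
  proof (induction j rule: dec_induct)
    case (step n)
    then show ?case using u(2)[of n] by auto
  qed simp
  have u01: "0 \<le> u i" "u i \<le> 1" if "i \<le> m" for i
    using mono[of 0 i] mono[of i m] that u by auto
  have re: "Re (step_fun p x) = (\<Sum>i<m. Re (\<alpha> i) * indicator {u i<..u (Suc i)} x)" for x
    unfolding sf Re_sum by (intro sum.cong) (auto simp: indicator_def)
  have disj: "indicator {u i<..u (Suc i)} x * indicator {u j<..u (Suc j)} x = (0::real)"
    if "i < m" "j < m" "i \<noteq> j" for i j x
    using mono[of "Suc i" j] mono[of "Suc j" i] that by (cases "i < j") (auto simp: indicator_def)
  have sq: "(Re (step_fun p x))\<^sup>2 = (\<Sum>i<m. (Re (\<alpha> i))\<^sup>2 * indicator {u i<..u (Suc i)} x)" for x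
  proof -
    have "(Re (step_fun p x))\<^sup>2 = (\<Sum>i<m. \<Sum>j<m. (Re (\<alpha> i) * indicator {u i<..u (Suc i)} x) * (Re (\<alpha> j) * indicator {u j<..u (Suc j)} x))"
      unfolding re power2_eq_square sum_product ..
    also have "\<dots> = (\<Sum>i<m. \<Sum>j<m. if j = i then (Re (\<alpha> i))\<^sup>2 * indicator {u i<..u (Suc i)} x else 0)"
    proof (intro sum.cong refl)
      fix i j assume "i \<in> {..<m}" "j \<in> {..<m}"
      then show "Re (\<alpha> i) * indicator {u i<..u (Suc i)} x * (Re (\<alpha> j) * indicator {u j<..u (Suc j)} x) =
           (if j = i then (Re (\<alpha> i))\<^sup>2 * indicator {u i<..u (Suc i)} x else 0)"
        using disj[of i j x] by (auto simp: power2_eq_square indicator_def)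
    qed
    also have "\<dots> = (\<Sum>i<m. (Re (\<alpha> i))\<^sup>2 * indicator {u i<..u (Suc i)} x)" by simp
    finally show ?thesis .
  qed
  have ind: "indicator {0..1} x * indicator {u i<..u (Suc i)} x = (indicator {u i<..u (Suc i)} x :: real)"
    if "i < m" for i x using u01[of i] u01[of "Suc i"] that by (auto simp: indicator_def)
  have integrand: "indicator {0..1} x * (Re (step_fun p x))\<^sup>2 = (\<Sum>i<m. (Re (\<alpha> i))\<^sup>2 * indicator {u i<..u (Suc i)} x)" for x
    unfolding sq sum_distrib_left by (intro sum.cong refl) (use ind in \<open>auto simp: mult.left_commute\<close>)
  have int: "set_integrable lborel {0..1} (\<lambda>x. (Re (step_fun p x))\<^sup>2)"
    unfolding set_integrable_def real_scaleR_def integrand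
    by (intro Bochner_Integration.integrable_sum integrable_mult_right integrable_real_indicator)
       (auto simp: less_imp_le u(2))
  have en: "step_energy p = (\<Sum>i<m. (Re (\<alpha> i))\<^sup>2 * (u (Suc i) - u i))"
    unfolding step_energy_def set_lebesgue_integral_def real_scaleR_def integrand
    by (subst Bochner_Integration.integral_sum)
       (auto simp: less_imp_le u(2) intro!: sum.cong integrable_mult_right integrable_real_indicator)
  have nn: "(\<integral>\<^sup>+x\<in>{0..1}. ennreal ((Re (step_fun p x))\<^sup>2) \<partial>lborel) =
      (\<integral>\<^sup>+x. ennreal (indicator {0..1} x * (Re (step_fun p x))\<^sup>2) \<partial>lborel)"
    by (intro nn_integral_cong) (auto simp: indicator_def)
  show ?A
    unfolding nn step_energy_def set_lebesgue_integral_def real_scaleR_def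
    using int unfolding set_integrable_def real_scaleR_def
    by (subst nn_integral_eq_integral) auto
  show ?B if ?P ?Q
  proof -
    interpret prob_space M by fact
    have bm: "distributed M lborel (\<lambda>\<omega>. W t \<omega> - W s \<omega>) (normal_density 0 (sqrt (t - s)))"
      if "0 \<le> s" "s < t" "t \<le> 1" for s t using \<open>?Q\<close> that by (auto simp: std_brownian_motion_def)
    have inc: "indep_vars (\<lambda>_. borel) (\<lambda>i \<omega>. W (u (Suc i)) \<omega> - W (u i) \<omega>) {..<m}"
      using \<open>?Q\<close> u unfolding std_brownian_motion_def by blast
    have "gauss_moments M (\<lambda>\<omega>. \<Sum>i<m. Re (\<alpha> i) * (W (u (Suc i)) \<omega> - W (u i) \<omega>))
        (\<Sum>i<m. (Re (\<alpha> i))\<^sup>2 * (sqrt (u (Suc i) - u i))\<^sup>2)"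
      by (intro gauss_moments_sum gauss_moments_normal indep_vars_compose2[OF inc] bm)
         (use u u01 in \<open>auto simp: Suc_le_eq\<close>)
    moreover have "(\<Sum>i<m. (Re (\<alpha> i))\<^sup>2 * (sqrt (u (Suc i) - u i))\<^sup>2) = step_energy p"
      unfolding en by (intro sum.cong refl) (use u(2) in \<open>auto simp: less_imp_le\<close>)
    moreover have "Re (step_integral W p \<omega>) = (\<Sum>i<m. Re (\<alpha> i) * (W (u (Suc i)) \<omega> - W (u i) \<omega>))" for \<omega>
      unfolding si by (simp add: Re_sum)
    ultimately show ?thesis by simp
  qed
qed

section \<open>Trigonometric polynomials on the unit interval\<close>

lemma norm_fourier_char [simp]: "cmod (fourier_char k x) = 1"
proof -
  have "fourier_char k x = exp (\<i> * of_real (- 2 * of_int k * pi * x))"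
    by (simp add: fourier_char_def algebra_simps)
  then show ?thesis by (simp only: norm_exp_i_times)
qed

lemma fourier_char_mult: "fourier_char k x * fourier_char l x = fourier_char (k + l) x"
  by (simp add: fourier_char_def exp_add[symmetric] algebra_simps)

lemma fourier_char_zero [simp]: "fourier_char 0 x = 1"
  by (simp add: fourier_char_def)

lemma cnj_fourier_char: "cnj (fourier_char k x) = fourier_char (- k) x"
  by (simp add: fourier_char_def exp_cnj)

lemma fourier_char_int: "fourier_char k (x + of_int m) = fourier_char k x"
proof -
  have "exp ((2 * of_real (of_int (- k * m)) * of_real pi) * \<i>) = (1::complex)"
    using exp_integer_2pi[of "of_int (- k * m)"] by simp
  then have "exp (- 2 * \<i> * of_int k * of_real pi * of_int m) = (1::complex)"
    by (simp add: mult_ac)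
  moreover have "fourier_char k (x + of_int m) = fourier_char k x * exp (- 2 * \<i> * of_int k * of_real pi * of_int m)"
    by (simp add: fourier_char_def exp_add[symmetric] algebra_simps)
  ultimately show ?thesis by simp
qed

lemma continuous_on_fourier_char [continuous_intros]: "continuous_on S (fourier_char k)"
  unfolding fourier_char_def by (intro continuous_intros)

lemma borel_measurable_fourier_char [measurable]: "fourier_char k \<in> borel_measurable borel"
  by (intro borel_measurable_continuous_onI continuous_on_fourier_char)

lemma integral_fourier_char:
  "(\<integral>x\<in>{0..1}. fourier_char m x \<partial>lborel) = (if m = 0 then 1 else 0)"
proof (cases "m = 0")
  case True
  then show ?thesis by (simp add: set_lebesgue_integral_def)
next
  case False
  define c where "c = - 2 * \<i> * of_int m * of_real pi"
  have c: "c \<noteq> 0" using False by (simp add: c_def)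
  have fc: "fourier_char m x = exp (c * of_real x)" for x by (simp add: fourier_char_def c_def)
  have "integral\<^sup>L lborel (\<lambda>x. indicator {0..1} x *\<^sub>R fourier_char m x) = fourier_char m 1 / c - fourier_char m 0 / c"
  proof (rule integral_FTC_atLeastAtMost)
    fix x :: real
    have "((\<lambda>x. exp (c * of_real x) / c) has_vector_derivative exp (c * of_real x)) (at x within {0..1})"
      using c by (auto intro!: derivative_eq_intros has_vector_derivative_real_field)
    then show "((\<lambda>x. fourier_char m x / c) has_vector_derivative fourier_char m x) (at x within {0..1})"
      by (simp add: fc)
  qed (auto intro!: continuous_intros)
  also have "\<dots> = 0" using fourier_char_int[of m 0 1] by simp
  finally show ?thesis using False by (simp add: set_lebesgue_integral_def)
qed

text \<open>Orthogonality of the characters. The bilinear identity \<open>gen\<close> is used with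
  \<open>s = -1\<close> and conjugated coefficients for Parseval, and with \<open>s = 1\<close> for
  the plain square, which measures how unevenly the variance splits between real and imaginary
  parts.\<close>

lemma trig_poly_integrals:
  fixes z :: "int \<Rightarrow> complex"
  assumes K: "finite K"
  shows "(\<integral>x\<in>{0..1}. (cmod (\<Sum>k\<in>K. z k * fourier_char k x))\<^sup>2 \<partial>lborel) = (\<Sum>k\<in>K. (cmod (z k))\<^sup>2)"
    and "(\<integral>x\<in>{0..1}. (\<Sum>k\<in>K. z k * fourier_char k x)\<^sup>2 \<partial>lborel) = (\<Sum>k\<in>K. \<Sum>l\<in>K. if k + l = 0 then z k * z l else 0)"
proof -
  have si: "set_integrable lborel {0..1} (\<lambda>x. c * fourier_char m x)" for c m
    by (intro borel_integrable_atLeastAtMost' continuous_intros)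
  have gen: "(\<integral>x\<in>{0..1}. (\<Sum>k\<in>K. z k * fourier_char k x) * (\<Sum>l\<in>K. y l * fourier_char (s * l) x) \<partial>lborel)
     = (\<Sum>k\<in>K. \<Sum>l\<in>K. if k + s * l = 0 then z k * y l else 0)" for y s
  proof -
    have "(\<integral>x\<in>{0..1}. (\<Sum>k\<in>K. z k * fourier_char k x) * (\<Sum>l\<in>K. y l * fourier_char (s * l) x) \<partial>lborel)
      = (\<integral>x\<in>{0..1}. (\<Sum>k\<in>K. \<Sum>l\<in>K. z k * y l * fourier_char (k + s * l) x) \<partial>lborel)"
      unfolding sum_product by (simp add: mult_ac fourier_char_mult[symmetric])
    also have "\<dots> = (\<Sum>k\<in>K. \<integral>x\<in>{0..1}. (\<Sum>l\<in>K. z k * y l * fourier_char (k + s * l) x) \<partial>lborel)"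
      unfolding set_lebesgue_integral_def scaleR_sum_right
      using si unfolding set_integrable_def
      by (intro Bochner_Integration.integral_sum Bochner_Integration.integrable_sum) auto
    also have "\<dots> = (\<Sum>k\<in>K. \<Sum>l\<in>K. \<integral>x\<in>{0..1}. z k * y l * fourier_char (k + s * l) x \<partial>lborel)"
      unfolding set_lebesgue_integral_def scaleR_sum_right
      using si unfolding set_integrable_def
      by (intro sum.cong refl Bochner_Integration.integral_sum) auto
    also have "\<dots> = (\<Sum>k\<in>K. \<Sum>l\<in>K. if k + s * l = 0 then z k * y l else 0)"
      by (intro sum.cong refl) (simp add: integral_fourier_char)
    finally show ?thesis .
  qed
  show "(\<integral>x\<in>{0..1}. (\<Sum>k\<in>K. z k * fourier_char k x)\<^sup>2 \<partial>lborel) = (\<Sum>k\<in>K. \<Sum>l\<in>K. if k + l = 0 then z k * z l else 0)"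
    using gen[of z 1] by (simp add: power2_eq_square)
  have "complex_of_real (\<integral>x\<in>{0..1}. (cmod (\<Sum>k\<in>K. z k * fourier_char k x))\<^sup>2 \<partial>lborel)
     = (\<integral>x\<in>{0..1}. of_real ((cmod (\<Sum>k\<in>K. z k * fourier_char k x))\<^sup>2) \<partial>lborel)"
    by (rule set_integral_complex_of_real[symmetric])
  also have "\<dots> = (\<integral>x\<in>{0..1}. (\<Sum>k\<in>K. z k * fourier_char k x) * (\<Sum>l\<in>K. cnj (z l) * fourier_char ((-1) * l) x) \<partial>lborel)"
    unfolding complex_norm_square by (simp add: cnj_fourier_char cnj_sum)
  also have "\<dots> = (\<Sum>k\<in>K. \<Sum>l\<in>K. if k + (-1) * l = 0 then z k * cnj (z l) else 0)" by (rule gen)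
  also have "\<dots> = (\<Sum>k\<in>K. \<Sum>l\<in>K. if l = k then z k * cnj (z k) else 0)"
    by (intro sum.cong refl) auto
  also have "\<dots> = of_real (\<Sum>k\<in>K. (cmod (z k))\<^sup>2)"
    using K by (simp add: complex_norm_square[symmetric])
  finally show "(\<integral>x\<in>{0..1}. (cmod (\<Sum>k\<in>K. z k * fourier_char k x))\<^sup>2 \<partial>lborel) = (\<Sum>k\<in>K. (cmod (z k))\<^sup>2)"
    by (simp only: of_real_eq_iff)
qed

text \<open>The variance of the real part of the sum of \<open>z k * \<Xi> k\<close>, with the
  Gaussian coefficients \<Xi> introduced later.\<close>

definition trig_energy :: "int set \<Rightarrow> (int \<Rightarrow> complex) \<Rightarrow> real" where
  "trig_energy K z = (\<integral>x\<in>{0..1}. (Re (\<Sum>k\<in>K. z k * fourier_char k x))\<^sup>2 \<partial>lborel)"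

lemma trig_energy_integrable: "set_integrable lborel {0..1} (\<lambda>x. (Re (\<Sum>k\<in>K. z k * fourier_char k x))\<^sup>2)"
  by (intro borel_integrable_atLeastAtMost' continuous_intros)

text \<open>Covers two-sided frequency sets as well; it serves the linear functionals, where a lost
  factor 2 affects only constants.\<close>

lemma trig_energy_le:
  assumes "finite K"
  shows "trig_energy K z \<le> (\<Sum>k\<in>K. (cmod (z k))\<^sup>2)"
  unfolding trig_energy_def trig_poly_integrals(1)[OF assms, symmetric]
proof (rule set_integral_mono[OF trig_energy_integrable])
  show "set_integrable lborel {0..1} (\<lambda>x. (cmod (\<Sum>k\<in>K. z k * fourier_char k x))\<^sup>2)"
    by (intro borel_integrable_atLeastAtMost' continuous_intros)
  show "(Re (\<Sum>k\<in>K. z k * fourier_char k x))\<^sup>2 \<le> (cmod (\<Sum>k\<in>K. z k * fourier_char k x))\<^sup>2" for x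
    using abs_Re_le_cmod by (metis abs_le_square_iff abs_norm_cancel)
qed

text \<open>For frequencies of one sign the square of the polynomial has no constant term; this is why the
  positive and the negative frequencies are treated separately below.\<close>

lemma trig_energy_half:
  assumes K: "finite K" and pos: "\<And>k l. k \<in> K \<Longrightarrow> l \<in> K \<Longrightarrow> k + l \<noteq> 0"
  shows "trig_energy K z = (\<Sum>k\<in>K. (cmod (z k))\<^sup>2) / 2"
proof -
  let ?u = "\<lambda>x. \<Sum>k\<in>K. z k * fourier_char k x"
  have eq: "(Re w)\<^sup>2 = (cmod w)\<^sup>2 / 2 + Re (w\<^sup>2) / 2" for w
    unfolding cmod_power2 by (simp add: power2_eq_square field_simps)
  have i1: "set_integrable lborel {0..1} (\<lambda>x. (cmod (?u x))\<^sup>2 / 2)" "set_integrable lborel {0..1} (\<lambda>x. Re ((?u x)\<^sup>2) / 2)"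
    "set_integrable lborel {0..1} (\<lambda>x. (?u x)\<^sup>2)"
    by (intro borel_integrable_atLeastAtMost' continuous_intros; simp)+
  have "(\<integral>x\<in>{0..1}. Re ((?u x)\<^sup>2) \<partial>lborel) = Re (\<integral>x\<in>{0..1}. (?u x)\<^sup>2 \<partial>lborel)"
    unfolding set_lebesgue_integral_def using i1(3) unfolding set_integrable_def
    by (subst integral_Re[symmetric]) auto
  also have "(\<integral>x\<in>{0..1}. (?u x)\<^sup>2 \<partial>lborel) = 0"
    unfolding trig_poly_integrals(2)[OF K] using pos by (intro sum.neutral ballI) auto
  finally have 0: "(\<integral>x\<in>{0..1}. Re ((?u x)\<^sup>2) \<partial>lborel) = 0" by simp
  show ?thesis
    unfolding trig_energy_def eq set_integral_add(2)[OF i1(1,2)] set_integral_divide_zero 0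
    by (simp add: trig_poly_integrals(1)[OF K])
qed

section \<open>The Gaussian noise in the Fourier coefficients\<close>

definition step_scale :: "complex \<Rightarrow> step \<Rightarrow> step" where
  "step_scale z p = map (\<lambda>(s, t, a). (s, t, z * a)) p"

lemma step_fun_scale: "step_fun (step_scale z p) x = z * step_fun p x"
  by (induction p) (auto simp: step_fun_def step_scale_def algebra_simps)

lemma step_integral_scale: "step_integral W (step_scale z p) \<omega> = z * step_integral W p \<omega>"
  by (induction p) (auto simp: step_integral_def step_scale_def algebra_simps)

lemma valid_step_scale: "valid_step p \<Longrightarrow> valid_step (step_scale z p)"
  by (auto simp: valid_step_def step_scale_def)

text \<open>The approximating sequences belong to single characters. Gluing scaled lists keeps their
  linear combinations within the class for which the isometry and the Gaussian moments are
  known.\<close>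

lemma step_combination:
  assumes "finite K" and "\<And>k. k \<in> K \<Longrightarrow> valid_step (q k)"
  shows "\<exists>p. valid_step p \<and> (\<forall>x. step_fun p x = (\<Sum>k\<in>K. z k * step_fun (q k) x)) \<and>
    (\<forall>(W :: real \<Rightarrow> 'w \<Rightarrow> real) \<omega>. step_integral W p \<omega> = (\<Sum>k\<in>K. z k * step_integral W (q k) \<omega>))"
  using assms
proof (induction K rule: finite_induct)
  case empty
  show ?case by (rule exI[of _ "[]"]) (simp add: valid_step_def step_fun_def step_integral_def)
next
  case (insert a K)
  then obtain p where p: "valid_step p" "\<And>x. step_fun p x = (\<Sum>k\<in>K. z k * step_fun (q k) x)"
    "\<And>(W :: real \<Rightarrow> 'w \<Rightarrow> real) \<omega>. step_integral W p \<omega> = (\<Sum>k\<in>K. z k * step_integral W (q k) \<omega>)" by auto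
  have f: "step_fun (step_scale (z a) (q a) @ p) x = z a * step_fun (q a) x + step_fun p x" for x
    using step_fun_scale[of "z a" "q a" x] by (simp add: step_fun_def)
  have i: "step_integral W (step_scale (z a) (q a) @ p) \<omega> = z a * step_integral W (q a) \<omega> + step_integral W p \<omega>"
    for W :: "real \<Rightarrow> 'w \<Rightarrow> real" and \<omega>
    using step_integral_scale[of W "z a" "q a" \<omega>] by (simp add: step_integral_def)
  have v: "valid_step (step_scale (z a) (q a) @ p)"
    using valid_step_scale[of "q a" "z a"] insert.prems[of a] p(1) by (auto simp: valid_step_def)
  show ?case
    using v f i p insert.hyps by (intro exI[of _ "step_scale (z a) (q a) @ p"]) simp
qed

lemma borel_measurable_step_fun [measurable]: "step_fun p \<in> borel_measurable borel"
proof (induction p)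
  case Nil
  then show ?case by (simp add: step_fun_def[abs_def])
next
  case (Cons x p)
  obtain s t a where x: "x = (s, t, a)" by (cases x)
  have "step_fun (x # p) = (\<lambda>y. a * indicator {s<..t} y + step_fun p y)"
    by (simp add: step_fun_def fun_eq_iff x)
  then show ?case using Cons by simp
qed

lemma borel_measurable_step_integral:
  assumes "valid_step p" "\<And>t. t \<in> {0..1} \<Longrightarrow> W t \<in> borel_measurable M"
  shows "step_integral W p \<in> borel_measurable M"
  using assms(1)
proof (induction p)
  case Nil
  then show ?case by (simp add: step_integral_def[abs_def])
next
  case (Cons x p)
  obtain s t a where x: "x = (s, t, a)" by (cases x)
  have "valid_step p" "s \<in> {0..1}" "t \<in> {0..1}" using Cons.prems by (auto simp: valid_step_def x)
  with Cons have [measurable]: "step_integral W p \<in> borel_measurable M" "W s \<in> borel_measurable M" "W t \<in> borel_measurable M"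
    using assms(2) by auto
  have "step_integral W (x # p) = (\<lambda>\<omega>. a * of_real (W t \<omega> - W s \<omega>) + step_integral W p \<omega>)"
    by (simp add: step_integral_def fun_eq_iff x)
  then show ?case by simp
qed

lemma gauss_moments_cmult:
  assumes "gauss_moments M Y v"
  shows "gauss_moments M (\<lambda>\<omega>. c * Y \<omega>) (c\<^sup>2 * v)"
proof -
  have "(\<integral>\<^sup>+\<omega>. ennreal (exp (t * (c * Y \<omega>))) \<partial>M) = ennreal (exp (t\<^sup>2 * (c\<^sup>2 * v) / 2))" for t
  proof -
    have "(\<integral>\<^sup>+\<omega>. ennreal (exp ((t * c) * Y \<omega>)) \<partial>M) = ennreal (exp ((t * c)\<^sup>2 * v / 2))"
      using assms by (simp add: gauss_moments_def)
    then show ?thesis by (simp only: mult.assoc power_mult_distrib)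
  qed
  then show ?thesis
    using assms by (auto simp: gauss_moments_def power_mult_distrib intro: borel_measurable_times)
qed

text \<open>Nonnegativity of the variance of the absolute value.\<close>

lemma (in prob_space) expectation_abs_le_sqrt:
  assumes [measurable]: "Y \<in> borel_measurable M" and "integrable M (\<lambda>\<omega>. (Y \<omega>)\<^sup>2 :: real)"
  shows "expectation (\<lambda>\<omega>. \<bar>Y \<omega>\<bar>) \<le> sqrt (expectation (\<lambda>\<omega>. (Y \<omega>)\<^sup>2))"
proof -
  have i: "integrable M Y" by (rule integrable_of_sq[OF assms])
  have "variance (\<lambda>\<omega>. \<bar>Y \<omega>\<bar>) = expectation (\<lambda>\<omega>. \<bar>Y \<omega>\<bar>\<^sup>2) - (expectation (\<lambda>\<omega>. \<bar>Y \<omega>\<bar>))\<^sup>2"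
    by (rule variance_eq) (use assms i in auto)
  then have "(expectation (\<lambda>\<omega>. \<bar>Y \<omega>\<bar>))\<^sup>2 \<le> expectation (\<lambda>\<omega>. (Y \<omega>)\<^sup>2)"
    using variance_positive[of "\<lambda>\<omega>. \<bar>Y \<omega>\<bar>"] by simp
  then show ?thesis by (rule real_le_rsqrt)
qed

text \<open>Mean-square convergence gives an almost surely convergent subsequence, and Fatou's lemma
  passes to the limit under the unbounded exponential. The resulting inequality is the direction
  that tail bounds use.\<close>

lemma (in prob_space) exp_moment_l2_limit:
  fixes Y :: "'a \<Rightarrow> real" and Yr :: "nat \<Rightarrow> 'a \<Rightarrow> real"
  assumes [measurable]: "\<And>r. Yr r \<in> borel_measurable M" "Y \<in> borel_measurable M"
    and conv: "l2_conv M (\<lambda>r \<omega>. of_real (Yr r \<omega>)) (\<lambda>\<omega>. of_real (Y \<omega>))"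
    and sq: "\<And>r. integrable M (\<lambda>\<omega>. (Yr r \<omega>)\<^sup>2)" "integrable M (\<lambda>\<omega>. (Y \<omega>)\<^sup>2)"
    and mgf: "\<And>r. (\<integral>\<^sup>+\<omega>. ennreal (exp (Yr r \<omega>)) \<partial>M) = ennreal (exp (V r / 2))"
    and V: "V \<longlonglongrightarrow> v"
  shows "(\<integral>\<^sup>+\<omega>. ennreal (exp (Y \<omega>)) \<partial>M) \<le> ennreal (exp (v / 2))"
proof -
  define D where "D r \<omega> = Yr r \<omega> - Y \<omega>" for r \<omega>
  have [measurable]: "D r \<in> borel_measurable M" for r unfolding D_def by simp
  have le: "(D r \<omega>)\<^sup>2 \<le> 2 * (Yr r \<omega>)\<^sup>2 + 2 * (Y \<omega>)\<^sup>2" for r \<omega>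
    using zero_le_power2[of "Yr r \<omega> + Y \<omega>"] by (simp add: D_def power2_eq_square algebra_simps)
  have D2: "integrable M (\<lambda>\<omega>. (D r \<omega>)\<^sup>2)" for r
    by (rule Bochner_Integration.integrable_bound[of _ "\<lambda>\<omega>. 2 * (Yr r \<omega>)\<^sup>2 + 2 * (Y \<omega>)\<^sup>2"])
       (use sq le in auto)
  have "(\<lambda>r. ennreal (expectation (\<lambda>\<omega>. (D r \<omega>)\<^sup>2))) \<longlonglongrightarrow> 0"
  proof -
    have "sqint M (\<lambda>\<omega>. of_real (Yr r \<omega>) - of_real (Y \<omega>)) = ennreal (expectation (\<lambda>\<omega>. (D r \<omega>)\<^sup>2))" for r
      unfolding sqint_def of_real_diff[symmetric] norm_of_real
      by (subst nn_integral_eq_integral[symmetric]) (use D2 in \<open>auto simp: D_def\<close>)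
    then show ?thesis using conv by (simp add: l2_conv_def)
  qed
  then have "(\<lambda>r. expectation (\<lambda>\<omega>. (D r \<omega>)\<^sup>2)) \<longlonglongrightarrow> 0"
    by (subst (asm) ennreal_0[symmetric], subst (asm) tendsto_ennreal_iff) auto
  then have s0: "(\<lambda>r. sqrt (expectation (\<lambda>\<omega>. (D r \<omega>)\<^sup>2))) \<longlonglongrightarrow> 0"
    using tendsto_real_sqrt by fastforce
  have n0: "(\<lambda>r. expectation (\<lambda>\<omega>. norm (D r \<omega>))) \<longlonglongrightarrow> 0"
  proof (rule tendsto_sandwich[OF _ _ tendsto_const s0])
    show "\<forall>\<^sub>F r in sequentially. 0 \<le> expectation (\<lambda>\<omega>. norm (D r \<omega>))" by simp
    show "\<forall>\<^sub>F r in sequentially. expectation (\<lambda>\<omega>. norm (D r \<omega>)) \<le> sqrt (expectation (\<lambda>\<omega>. (D r \<omega>)\<^sup>2))"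
      using expectation_abs_le_sqrt[OF _ D2] by simp
  qed
  have iD: "integrable M (D r)" for r by (rule integrable_of_sq[OF _ D2]) simp
  obtain \<rho> :: "nat \<Rightarrow> nat" where \<rho>: "strict_mono \<rho>" "AE \<omega> in M. (\<lambda>r. D (\<rho> r) \<omega>) \<longlonglongrightarrow> 0"
    using tendsto_L1_AE_subseq[of M D, OF iD n0] by blast
  have lim: "AE \<omega> in M. ennreal (exp (Y \<omega>)) = liminf (\<lambda>r. ennreal (exp (Yr (\<rho> r) \<omega>)))"
    using \<rho>(2)
  proof eventually_elim
    fix \<omega> assume "(\<lambda>r. D (\<rho> r) \<omega>) \<longlonglongrightarrow> 0"
    then have "(\<lambda>r. D (\<rho> r) \<omega> + Y \<omega>) \<longlonglongrightarrow> 0 + Y \<omega>" by (intro tendsto_intros)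
    then have "(\<lambda>r. Yr (\<rho> r) \<omega>) \<longlonglongrightarrow> Y \<omega>" by (simp add: D_def)
    then have "(\<lambda>r. ennreal (exp (Yr (\<rho> r) \<omega>))) \<longlonglongrightarrow> ennreal (exp (Y \<omega>))"
      by (intro tendsto_ennrealI tendsto_exp)
    then show "ennreal (exp (Y \<omega>)) = liminf (\<lambda>r. ennreal (exp (Yr (\<rho> r) \<omega>)))"
      by (rule lim_imp_Liminf[OF trivial_limit_sequentially, symmetric])
  qed
  have "(\<integral>\<^sup>+\<omega>. ennreal (exp (Y \<omega>)) \<partial>M) = (\<integral>\<^sup>+\<omega>. liminf (\<lambda>r. ennreal (exp (Yr (\<rho> r) \<omega>))) \<partial>M)"
    by (rule nn_integral_cong_AE[OF lim])
  also have "\<dots> \<le> liminf (\<lambda>r. \<integral>\<^sup>+\<omega>. ennreal (exp (Yr (\<rho> r) \<omega>)) \<partial>M)"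
    by (rule nn_integral_liminf) simp
  also have "\<dots> = liminf (\<lambda>r. ennreal (exp (V (\<rho> r) / 2)))" by (simp add: mgf)
  also have "\<dots> = ennreal (exp (v / 2))"
  proof (rule lim_imp_Liminf)
    have "(\<lambda>r. V (\<rho> r)) \<longlonglongrightarrow> v" using LIMSEQ_subseq_LIMSEQ[OF V \<rho>(1)] by (simp add: o_def)
    then show "(\<lambda>r. ennreal (exp (V (\<rho> r) / 2))) \<longlonglongrightarrow> ennreal (exp (v / 2))"
      by (intro tendsto_ennrealI tendsto_exp tendsto_divide tendsto_const) auto
  qed simp
  finally show ?thesis .
qed

section \<open>Linear functionals of the Gaussian Fourier noise\<close>

locale wiener_noise = prob_space M for M :: "'w measure" +
  fixes n :: nat and W :: "nat \<Rightarrow> real \<Rightarrow> 'w \<Rightarrow> real" and I :: "nat \<Rightarrow> int \<Rightarrow> 'w \<Rightarrow> complex"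
  assumes n_pos: "n > 0"
    and brownian: "\<And>j. j \<in> {1..n} \<Longrightarrow> std_brownian_motion M (W j)"
    and indep: "indep_vars (\<lambda>_. \<Pi>\<^sub>M t\<in>{0..1}. borel) (\<lambda>j \<omega>. \<lambda>t\<in>{0..1}. W j t \<omega>) {1..n}"
    and wiener: "\<And>j k. j \<in> {1..n} \<Longrightarrow> has_wiener_integral M (W j) (fourier_char k) (I j k)"
begin

text \<open>The noise variable of the averaged coefficients, normalized to second moment 1 for every
  \<open>n\<close>.\<close>

definition \<Xi> :: "int \<Rightarrow> 'w \<Rightarrow> complex" where
  "\<Xi> k \<omega> = (\<Sum>j=1..n. I j k \<omega>) / of_real (sqrt (real n))"

lemma measurable_\<Xi> [measurable]: "\<Xi> k \<in> borel_measurable M"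
proof -
  have "\<And>j. j \<in> {1..n} \<Longrightarrow> I j k \<in> borel_measurable M"
    using wiener by (auto simp: has_wiener_integral_def)
  then show ?thesis unfolding \<Xi>_def[abs_def] by measurable
qed

text \<open>For each \<open>j\<close> the characters are approximated by step functions and combined
  into one. The resulting real step integrals are independent over \<open>j\<close> and have
  Gaussian moments, and the normalized sum over \<open>j\<close> converges in mean square to
  \<open>Y\<close>.\<close>

lemma gaussian_functional:
  fixes z :: "int \<Rightarrow> complex"
  assumes K: "finite K"
  defines "Y \<equiv> \<lambda>\<omega>. Re (\<Sum>k\<in>K. z k * \<Xi> k \<omega>)"
  shows "(\<integral>\<^sup>+\<omega>. ennreal (exp (Y \<omega>)) \<partial>M) \<le> ennreal (exp (trig_energy K z / 2))"
    and "(\<integral>\<^sup>+\<omega>. ennreal ((Y \<omega>)\<^sup>2) \<partial>M) = ennreal (trig_energy K z)"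
proof -
  let ?J = "{1..n}"
  have "\<exists>p. \<forall>jk\<in>?J \<times> UNIV. (\<forall>r. valid_step (p jk r)) \<and>
        (\<lambda>r. \<integral>\<^sup>+x\<in>{0..1}. ennreal ((cmod (step_fun (p jk r) x - fourier_char (snd jk) x))\<^sup>2) \<partial>lborel) \<longlonglongrightarrow> 0 \<and>
        (\<lambda>r. \<integral>\<^sup>+\<omega>. ennreal ((cmod (step_integral (W (fst jk)) (p jk r) \<omega> - I (fst jk) (snd jk) \<omega>))\<^sup>2) \<partial>M) \<longlonglongrightarrow> 0"
    by (rule bchoice) (use wiener in \<open>auto simp: has_wiener_integral_def\<close>)
  then obtain q where q: "\<forall>jk\<in>?J \<times> UNIV. (\<forall>r. valid_step (q jk r)) \<and>
        (\<lambda>r. \<integral>\<^sup>+x\<in>{0..1}. ennreal ((cmod (step_fun (q jk r) x - fourier_char (snd jk) x))\<^sup>2) \<partial>lborel) \<longlonglongrightarrow> 0 \<and>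
        (\<lambda>r. \<integral>\<^sup>+\<omega>. ennreal ((cmod (step_integral (W (fst jk)) (q jk r) \<omega> - I (fst jk) (snd jk) \<omega>))\<^sup>2) \<partial>M) \<longlonglongrightarrow> 0"
    ..
  define p where "p j k = q (j, k)" for j k
  have p: "valid_step (p j k r)" if "j \<in> ?J" for j k r
    using q[THEN bspec, of "(j, k)"] that by (simp add: p_def)
  have pf: "(\<lambda>r. \<integral>\<^sup>+x\<in>{0..1}. ennreal ((cmod (step_fun (p j k r) x - fourier_char k x))\<^sup>2) \<partial>lborel) \<longlonglongrightarrow> 0" if "j \<in> ?J" for j k
    using q[THEN bspec, of "(j, k)"] that by (simp add: p_def)
  have pI: "l2_conv M (\<lambda>r. step_integral (W j) (p j k r)) (I j k)" if "j \<in> ?J" for j k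
    using q[THEN bspec, of "(j, k)"] that by (simp add: p_def l2_conv_def sqint_def)
  \<comment> \<open>As a measure of its own, the unit interval makes convergence of step functions
    another instance of \<open>l2_conv\<close>.\<close>
  define uI where "uI = restrict_space lborel {0..1::real}"
  have uI: "(\<integral>\<^sup>+x. f x \<partial>uI) = (\<integral>\<^sup>+x\<in>{0..1}. f x \<partial>lborel)" for f
    unfolding uI_def by (rule nn_integral_restrict_space) simp
  have muI: "f \<in> borel_measurable borel \<Longrightarrow> f \<in> borel_measurable uI" for f :: "real \<Rightarrow> complex"
    unfolding uI_def by (intro measurable_restrict_space1) simp
  have pf: "l2_conv uI (\<lambda>r. step_fun (p j k r)) (fourier_char k)" if "j \<in> ?J" for j k
    using pf[OF that] by (simp add: l2_conv_def sqint_def uI)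
  have "\<exists>P. \<forall>jr\<in>?J \<times> UNIV. valid_step (P jr) \<and>
    (\<forall>x. step_fun (P jr) x = (\<Sum>k\<in>K. z k * step_fun (p (fst jr) k (snd jr)) x)) \<and>
    (\<forall>(W :: real \<Rightarrow> 'w \<Rightarrow> real) \<omega>. step_integral W (P jr) \<omega> = (\<Sum>k\<in>K. z k * step_integral W (p (fst jr) k (snd jr)) \<omega>))"
    by (intro bchoice ballI step_combination K p) auto
  then obtain Q where Q: "\<forall>jr\<in>?J \<times> UNIV. valid_step (Q jr) \<and>
    (\<forall>x. step_fun (Q jr) x = (\<Sum>k\<in>K. z k * step_fun (p (fst jr) k (snd jr)) x)) \<and>
    (\<forall>(W :: real \<Rightarrow> 'w \<Rightarrow> real) \<omega>. step_integral W (Q jr) \<omega> = (\<Sum>k\<in>K. z k * step_integral W (p (fst jr) k (snd jr)) \<omega>))"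
    ..
  define P where "P j r = Q (j, r)" for j r
  have P: "valid_step (P j r)" if "j \<in> ?J" for j r
    using Q[THEN bspec, of "(j, r)"] that by (simp add: P_def)
  have Pf: "step_fun (P j r) x = (\<Sum>k\<in>K. z k * step_fun (p j k r) x)" if "j \<in> ?J" for j r x
    using Q[THEN bspec, of "(j, r)"] that by (simp add: P_def)
  have PI: "step_integral W (P j r) \<omega> = (\<Sum>k\<in>K. z k * step_integral W (p j k r) \<omega>)" if "j \<in> ?J"
    for j r \<omega> and W :: "real \<Rightarrow> 'w \<Rightarrow> real"
    using Q[THEN bspec, of "(j, r)"] that by (simp add: P_def)
  have mI: "j \<in> ?J \<Longrightarrow> I j k \<in> borel_measurable M" for j k
    using wiener by (auto simp: has_wiener_integral_def)
  have ms: "j \<in> ?J \<Longrightarrow> valid_step q \<Longrightarrow> step_integral (W j) q \<in> borel_measurable M" for j q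
    by (rule borel_measurable_step_integral) (use brownian in \<open>auto simp: std_brownian_motion_def\<close>)

  let ?c = "1 / sqrt (real n)"
  have c2: "?c\<^sup>2 = 1 / real n" by (simp add: power_divide)
  have energy: "(\<lambda>r. step_energy (P j r)) \<longlonglongrightarrow> trig_energy K z" if j: "j \<in> ?J" for j
  proof -
    have mf: "(\<lambda>x. complex_of_real (Re (step_fun (P j r) x))) \<in> borel_measurable uI"
      "(\<lambda>x. complex_of_real (Re (\<Sum>k\<in>K. z k * fourier_char k x))) \<in> borel_measurable uI" for r
      by (intro muI; measurable)+
    have "l2_conv uI (\<lambda>r x. \<Sum>k\<in>K. z k * step_fun (p j k r) x) (\<lambda>x. \<Sum>k\<in>K. z k * fourier_char k x)"
      by (intro l2_conv_sum K l2_conv_cmult pf[OF j] muI borel_measurable_times) auto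
    then have "l2_conv uI (\<lambda>r. step_fun (P j r)) (\<lambda>x. \<Sum>k\<in>K. z k * fourier_char k x)"
      using Pf[OF j] by (simp add: l2_conv_def)
    then have c: "l2_conv uI (\<lambda>r x. of_real (Re (step_fun (P j r) x))) (\<lambda>x. of_real (Re (\<Sum>k\<in>K. z k * fourier_char k x)))"
      by (rule l2_conv_Re)
    have e: "sqint uI (\<lambda>x. of_real (Re (step_fun (P j r) x))) = ennreal (step_energy (P j r))" for r
      unfolding sqint_def uI step_energy_properties(1)[OF P[OF j]] by simp
    have e': "sqint uI (\<lambda>x. of_real (Re (\<Sum>k\<in>K. z k * fourier_char k x))) = ennreal (trig_energy K z)"
    proof -
      have "sqint uI (\<lambda>x. of_real (Re (\<Sum>k\<in>K. z k * fourier_char k x))) =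
          (\<integral>\<^sup>+x. ennreal (indicator {0..1} x * (Re (\<Sum>k\<in>K. z k * fourier_char k x))\<^sup>2) \<partial>lborel)"
        unfolding sqint_def uI norm_of_real power2_abs by (intro nn_integral_cong) (auto simp: indicator_def)
      also have "\<dots> = ennreal (trig_energy K z)"
        unfolding trig_energy_def set_lebesgue_integral_def real_scaleR_def
        using trig_energy_integrable[where K = K and z = z] unfolding set_integrable_def real_scaleR_def
        by (subst nn_integral_eq_integral) auto
      finally show ?thesis .
    qed
    have "(\<lambda>r. sqint uI (\<lambda>x. of_real (Re (step_fun (P j r) x)))) \<longlonglongrightarrow> sqint uI (\<lambda>x. of_real (Re (\<Sum>k\<in>K. z k * fourier_char k x)))"
      by (rule l2_conv_sqint(2)[OF mf c]) (simp only: e ennreal_less_top infinity_ennreal_def)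
    then show ?thesis unfolding e e'
      by (subst (asm) tendsto_ennreal_iff)
         (auto simp: step_energy_def trig_energy_def set_lebesgue_integral_def intro!: Bochner_Integration.integral_nonneg)
  qed
  define Yr where "Yr r \<omega> = ?c * (\<Sum>j\<in>?J. Re (step_integral (W j) (P j r) \<omega>))" for r \<omega>
  define V where "V r = ?c\<^sup>2 * (\<Sum>j\<in>?J. step_energy (P j r))" for r
  \<comment> \<open>The \<open>n\<close> energies have the same limit, which cancels the factor
    \<open>1 / n\<close>.\<close>
  have "(\<lambda>r. ?c\<^sup>2 * (\<Sum>j\<in>?J. step_energy (P j r))) \<longlonglongrightarrow> ?c\<^sup>2 * (\<Sum>j\<in>?J. trig_energy K z)"
    by (intro tendsto_intros energy)
  then have V: "V \<longlonglongrightarrow> trig_energy K z" using n_pos by (simp add: V_def[abs_def] c2)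
  have ind: "indep_vars (\<lambda>_. borel) (\<lambda>j \<omega>. Re (step_integral (W j) (P j r) \<omega>)) ?J" for r
  proof -
    \<comment> \<open>Independence is given for paths restricted to the unit interval. With the
      coordinate maps in place of \<open>W\<close>, the step integral becomes a measurable function
      of the path.\<close>
    have "indep_vars (\<lambda>_. borel) (\<lambda>j \<omega>. Re (step_integral (\<lambda>t \<phi>. \<phi> t) (P j r) (\<lambda>t\<in>{0..1}. W j t \<omega>))) ?J"
      by (rule indep_vars_compose2[OF indep])
         (intro measurable_compose[OF borel_measurable_step_integral borel_measurable_Re] P
            measurable_component_singleton; simp)
    moreover have "step_integral (\<lambda>t \<phi>. \<phi> t) (P j r) (\<lambda>t\<in>{0..1}. W j t \<omega>) = step_integral (W j) (P j r) \<omega>" if "j \<in> ?J" for j \<omega>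
      unfolding step_integral_def using P[OF that, of r]
      by (intro arg_cong[where f = sum_list] map_cong refl) (auto simp: valid_step_def)
    ultimately show ?thesis by (subst indep_vars_cong) auto
  qed
  have g: "gauss_moments M (Yr r) (V r)" for r
    unfolding Yr_def[abs_def] V_def
    by (intro gauss_moments_cmult gauss_moments_sum ind step_energy_properties(2) P brownian) (auto intro: prob_space_axioms)
  have mY[measurable]: "Yr r \<in> borel_measurable M" "Y \<in> borel_measurable M" for r
    using g[of r] by (auto simp: gauss_moments_def Y_def)
  have conv: "l2_conv M (\<lambda>r \<omega>. of_real (Yr r \<omega>)) (\<lambda>\<omega>. of_real (Y \<omega>))"
  proof -
    have "l2_conv M (\<lambda>r \<omega>. \<Sum>k\<in>K. z k * step_integral (W j) (p j k r) \<omega>) (\<lambda>\<omega>. \<Sum>k\<in>K. z k * I j k \<omega>)" if "j \<in> ?J" for j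
      using that by (intro l2_conv_sum K l2_conv_cmult pI borel_measurable_times ms mI p) auto
    then have "l2_conv M (\<lambda>r. step_integral (W j) (P j r)) (\<lambda>\<omega>. \<Sum>k\<in>K. z k * I j k \<omega>)" if "j \<in> ?J" for j
      using PI that by (simp add: l2_conv_def)
    then have "l2_conv M (\<lambda>r \<omega>. of_real ?c * (\<Sum>j\<in>?J. step_integral (W j) (P j r) \<omega>)) (\<lambda>\<omega>. of_real ?c * (\<Sum>j\<in>?J. \<Sum>k\<in>K. z k * I j k \<omega>))"
      by (intro l2_conv_sum l2_conv_cmult borel_measurable_sum ms mI P borel_measurable_times) auto
    then have "l2_conv M (\<lambda>r \<omega>. of_real (Re (of_real ?c * (\<Sum>j\<in>?J. step_integral (W j) (P j r) \<omega>)))) (\<lambda>\<omega>. of_real (Re (of_real ?c * (\<Sum>j\<in>?J. \<Sum>k\<in>K. z k * I j k \<omega>))))"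
      by (rule l2_conv_Re)
    moreover have "Re (of_real ?c * (\<Sum>j\<in>?J. step_integral (W j) (P j r) \<omega>)) = Yr r \<omega>" for r \<omega>
      unfolding Yr_def by (simp add: Re_sum)
    moreover have "of_real ?c * (\<Sum>j\<in>?J. \<Sum>k\<in>K. z k * I j k \<omega>) = (\<Sum>k\<in>K. z k * \<Xi> k \<omega>)" for \<omega>
      unfolding \<Xi>_def
      by (subst sum.swap) (simp add: sum_distrib_left sum_divide_distrib mult_ac)
    ultimately show ?thesis unfolding Y_def by (simp only:)
  qed
  have e: "sqint M (\<lambda>\<omega>. of_real (Yr r \<omega>)) = ennreal (V r)" for r
  proof -
    have "sqint M (\<lambda>\<omega>. of_real (Yr r \<omega>)) = (\<integral>\<^sup>+\<omega>. ennreal ((Yr r \<omega>)\<^sup>2) \<partial>M)" by (simp add: sqint_def)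
    also have "\<dots> = ennreal (V r)"
      using g[of r] by (subst nn_integral_eq_integral) (auto simp: gauss_moments_def)
    finally show ?thesis .
  qed
  have "(\<lambda>r. sqint M (\<lambda>\<omega>. of_real (Yr r \<omega>))) \<longlonglongrightarrow> sqint M (\<lambda>\<omega>. of_real (Y \<omega>))"
    and fin: "sqint M (\<lambda>\<omega>. of_real (Y \<omega>)) < \<infinity>"
    by (rule l2_conv_sqint[OF _ _ conv]; simp add: e)+
  moreover have "(\<lambda>r. sqint M (\<lambda>\<omega>. of_real (Yr r \<omega>))) \<longlonglongrightarrow> ennreal (trig_energy K z)"
    unfolding e by (intro tendsto_ennrealI V)
  ultimately have "sqint M (\<lambda>\<omega>. of_real (Y \<omega>)) = ennreal (trig_energy K z)"
    using LIMSEQ_unique by blast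
  then show sq: "(\<integral>\<^sup>+\<omega>. ennreal ((Y \<omega>)\<^sup>2) \<partial>M) = ennreal (trig_energy K z)"
    by (simp add: sqint_def)
  have "integrable M (\<lambda>\<omega>. (Y \<omega>)\<^sup>2)"
    by (rule integrableI_nonneg) (auto simp: sq)
  then show "(\<integral>\<^sup>+\<omega>. ennreal (exp (Y \<omega>)) \<partial>M) \<le> ennreal (exp (trig_energy K z / 2))"
  proof (intro exp_moment_l2_limit[OF _ _ conv _ _ _ V])
    show "integrable M (\<lambda>\<omega>. (Yr r \<omega>)\<^sup>2)" for r using g[of r] by (simp add: gauss_moments_def)
    show "(\<integral>\<^sup>+\<omega>. ennreal (exp (Yr r \<omega>)) \<partial>M) = ennreal (exp (V r / 2))" for r
      using g[of r] unfolding gauss_moments_def by (auto dest: spec[of _ 1])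
  qed simp_all
qed

end

section \<open>Exponential moments of Gaussian quadratic forms\<close>

lemma normal_density_exp_square:
  assumes "c < 1 / 2"
  shows "(\<integral>\<^sup>+g. ennreal (normal_density 0 1 g * exp (c * g\<^sup>2)) \<partial>lborel) = ennreal (1 / sqrt (1 - 2 * c))"
proof -
  define s where "s = 1 / sqrt (1 - 2 * c)"
  have s: "s > 0" "s\<^sup>2 = 1 / (1 - 2 * c)" using assms by (auto simp: s_def power_divide)
  have "normal_density 0 1 g * exp (c * g\<^sup>2) = s * normal_density 0 s g" for g
  proof -
    \<comment> \<open>The quadratic tilt only rescales the normal density; \<open>c < 1 / 2\<close>
      keeps the new variance positive.\<close>
    have "- (g - 0)\<^sup>2 / (2 * 1\<^sup>2) + c * g\<^sup>2 = - (g - 0)\<^sup>2 / (2 * s\<^sup>2)"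
      using assms unfolding s(2) by (simp add: field_simps)
    then have "exp (- (g - 0)\<^sup>2 / (2 * 1\<^sup>2)) * exp (c * g\<^sup>2) = exp (- (g - 0)\<^sup>2 / (2 * s\<^sup>2))"
      by (simp only: exp_add[symmetric])
    moreover have "sqrt (2 * pi * s\<^sup>2) = sqrt (2 * pi) * s" using s(1) by (simp add: real_sqrt_mult)
    ultimately show ?thesis using s(1) unfolding normal_density_def by (simp add: field_simps)
  qed
  then have "(\<integral>\<^sup>+g. ennreal (normal_density 0 1 g * exp (c * g\<^sup>2)) \<partial>lborel) =
      (\<integral>\<^sup>+g. ennreal s * ennreal (normal_density 0 s g) \<partial>lborel)"
    using s by (simp add: ennreal_mult)
  also have "\<dots> = ennreal s * (\<integral>\<^sup>+g. ennreal (normal_density 0 s g) \<partial>lborel)"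
    by (rule nn_integral_cmult) simp
  also have "(\<integral>\<^sup>+g. ennreal (normal_density 0 s g) \<partial>lborel) = 1"
    using s(1) by (subst nn_integral_eq_integral) auto
  finally show ?thesis by (simp add: s_def)
qed

text \<open>The square in the exponent is linearized by an auxiliary standard normal variable \<open>g\<close>:
  \<open>exp (\<mu> y\<^sup>2)\<close> is the expectation of \<open>exp (sqrt (2 \<mu>) y g)\<close>.\<close>

lemma (in prob_space) exp_quadratic_moment_aux:
  fixes x :: "'i \<Rightarrow> 'a \<Rightarrow> real"
  assumes S: "finite S" and [measurable]: "\<And>i. x i \<in> borel_measurable M"
    and v: "v \<ge> 0"
    and lin: "\<And>t. (\<integral>\<^sup>+\<omega>. ennreal (exp (\<Sum>i\<in>S. t i * x i \<omega>)) \<partial>M) \<le> ennreal (exp (v / 2 * (\<Sum>i\<in>S. (t i)\<^sup>2)))"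
    and K: "K \<subseteq> S" "\<And>i. i \<in> K \<Longrightarrow> 0 \<le> \<mu> i" "\<And>i. i \<in> K \<Longrightarrow> 2 * v * \<mu> i < 1" "\<And>i. i \<in> K \<Longrightarrow> t i = 0"
  shows "(\<integral>\<^sup>+\<omega>. ennreal (exp ((\<Sum>i\<in>S. t i * x i \<omega>) + (\<Sum>i\<in>K. \<mu> i * (x i \<omega>)\<^sup>2))) \<partial>M)
    \<le> ennreal (exp (v / 2 * (\<Sum>i\<in>S. (t i)\<^sup>2)) * (\<Prod>i\<in>K. 1 / sqrt (1 - 2 * v * \<mu> i)))"
  using finite_subset[OF K(1) S] K
\<comment> \<open>The linear coefficients must vary: linearizing the square at \<open>a\<close>
  creates the coefficient \<open>sqrt (2 * \<mu> a) * g\<close> at \<open>a\<close>, where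
  \<open>t\<close> was 0.\<close>
proof (induction K arbitrary: t rule: finite_induct)
  case empty
  then show ?case using lin[of t] by simp
next
  case (insert a K)
  let ?A = "\<lambda>\<omega>. (\<Sum>i\<in>S. t i * x i \<omega>) + (\<Sum>i\<in>K. \<mu> i * (x i \<omega>)\<^sup>2)"
  let ?c = "sqrt (2 * \<mu> a)"
  let ?P = "\<Prod>i\<in>K. 1 / sqrt (1 - 2 * v * \<mu> i)"
  have a: "a \<in> S" "\<mu> a \<ge> 0" "t a = 0" "2 * v * \<mu> a < 1" using insert.prems by auto
  have P0: "?P \<ge> 0" using insert.prems by (intro prod_nonneg) (auto simp: less_imp_le)
  interpret pair_sigma_finite M lborel ..
  have upd: "(\<Sum>i\<in>S. (t(a := s)) i * x i \<omega>) = (\<Sum>i\<in>S. t i * x i \<omega>) + s * x a \<omega>" for s \<omega>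
    using S a by (simp add: sum.remove[of S a])
  have upd2: "(\<Sum>i\<in>S. ((t(a := s)) i)\<^sup>2) = (\<Sum>i\<in>S. (t i)\<^sup>2) + s\<^sup>2" for s
    using S a by (simp add: sum.remove[of S a])
  \<comment> \<open>The redundant \<open>1\<^sup>2\<close> gives the exponent the form of
    \<open>normal_density_mgf\<close> with standard deviation 1, which then turns it into a Gaussian
    integral.\<close>
  have "(\<integral>\<^sup>+\<omega>. ennreal (exp ((\<Sum>i\<in>S. t i * x i \<omega>) + (\<Sum>i\<in>insert a K. \<mu> i * (x i \<omega>)\<^sup>2))) \<partial>M)
      = (\<integral>\<^sup>+\<omega>. ennreal (exp (?A \<omega>)) * ennreal (exp ((?c * x a \<omega>)\<^sup>2 * 1\<^sup>2 / 2)) \<partial>M)"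
  proof (intro nn_integral_cong)
    fix \<omega>
    have eq: "(?c * x a \<omega>)\<^sup>2 * 1\<^sup>2 / 2 = \<mu> a * (x a \<omega>)\<^sup>2" using a by (simp add: power_mult_distrib)
    show "ennreal (exp ((\<Sum>i\<in>S. t i * x i \<omega>) + (\<Sum>i\<in>insert a K. \<mu> i * (x i \<omega>)\<^sup>2))) =
        ennreal (exp (?A \<omega>)) * ennreal (exp ((?c * x a \<omega>)\<^sup>2 * 1\<^sup>2 / 2))"
      unfolding eq using insert.hyps by (simp add: ennreal_mult[symmetric] exp_add[symmetric] algebra_simps)
  qed
  also have "\<dots> = (\<integral>\<^sup>+\<omega>. ennreal (exp (?A \<omega>)) * (\<integral>\<^sup>+g. ennreal (normal_density 0 1 g * exp (?c * x a \<omega> * g)) \<partial>lborel) \<partial>M)"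
    by (subst normal_density_mgf) simp_all
  also have "\<dots> = (\<integral>\<^sup>+\<omega>. (\<integral>\<^sup>+g. ennreal (exp (?A \<omega>)) * ennreal (normal_density 0 1 g * exp (?c * x a \<omega> * g)) \<partial>lborel) \<partial>M)"
    by (simp add: nn_integral_cmult)
  also have "\<dots> = (\<integral>\<^sup>+g. (\<integral>\<^sup>+\<omega>. ennreal (exp (?A \<omega>)) * ennreal (normal_density 0 1 g * exp (?c * x a \<omega> * g)) \<partial>M) \<partial>lborel)"
    by (rule Fubini'[symmetric]) measurable
  also have "\<dots> \<le> (\<integral>\<^sup>+g. ennreal (exp (v / 2 * (\<Sum>i\<in>S. (t i)\<^sup>2)) * ?P) * ennreal (normal_density 0 1 g * exp (v * \<mu> a * g\<^sup>2)) \<partial>lborel)"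
  proof (intro nn_integral_mono)
    fix g
    have "(\<integral>\<^sup>+\<omega>. ennreal (exp (?A \<omega>)) * ennreal (normal_density 0 1 g * exp (?c * x a \<omega> * g)) \<partial>M)
      = (\<integral>\<^sup>+\<omega>. ennreal (normal_density 0 1 g) * ennreal (exp ((\<Sum>i\<in>S. (t(a := ?c * g)) i * x i \<omega>) + (\<Sum>i\<in>K. \<mu> i * (x i \<omega>)\<^sup>2))) \<partial>M)"
      unfolding upd by (intro nn_integral_cong) (simp add: ennreal_mult[symmetric] exp_add algebra_simps)
    also have "\<dots> = ennreal (normal_density 0 1 g) * (\<integral>\<^sup>+\<omega>. ennreal (exp ((\<Sum>i\<in>S. (t(a := ?c * g)) i * x i \<omega>) + (\<Sum>i\<in>K. \<mu> i * (x i \<omega>)\<^sup>2))) \<partial>M)"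
      by (rule nn_integral_cmult) measurable
    also have "\<dots> \<le> ennreal (normal_density 0 1 g) * ennreal (exp (v / 2 * (\<Sum>i\<in>S. ((t(a := ?c * g)) i)\<^sup>2)) * ?P)"
      by (intro mult_left_mono insert.IH) (use insert.prems insert.hyps in auto)
    also have "\<dots> = ennreal (exp (v / 2 * (\<Sum>i\<in>S. (t i)\<^sup>2)) * ?P) * ennreal (normal_density 0 1 g * exp (v * \<mu> a * g\<^sup>2))"
    proof -
      have "v / 2 * ((\<Sum>i\<in>S. (t i)\<^sup>2) + (?c * g)\<^sup>2) = v / 2 * (\<Sum>i\<in>S. (t i)\<^sup>2) + v * \<mu> a * g\<^sup>2"
        using a by (simp add: power_mult_distrib algebra_simps)
      then have e: "exp (v / 2 * ((\<Sum>i\<in>S. (t i)\<^sup>2) + (?c * g)\<^sup>2)) = exp (v / 2 * (\<Sum>i\<in>S. (t i)\<^sup>2)) * exp (v * \<mu> a * g\<^sup>2)"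
        by (simp only: exp_add)
      show ?thesis
        unfolding upd2 e using P0 by (simp add: ennreal_mult[symmetric] mult_ac)
    qed
    finally show "(\<integral>\<^sup>+\<omega>. ennreal (exp (?A \<omega>)) * ennreal (normal_density 0 1 g * exp (?c * x a \<omega> * g)) \<partial>M)
       \<le> ennreal (exp (v / 2 * (\<Sum>i\<in>S. (t i)\<^sup>2)) * ?P) * ennreal (normal_density 0 1 g * exp (v * \<mu> a * g\<^sup>2))" .
  qed
  also have "\<dots> = ennreal (exp (v / 2 * (\<Sum>i\<in>S. (t i)\<^sup>2)) * ?P) * ennreal (1 / sqrt (1 - 2 * (v * \<mu> a)))"
    using a by (subst nn_integral_cmult) (auto simp: normal_density_exp_square)
  also have "\<dots> = ennreal (exp (v / 2 * (\<Sum>i\<in>S. (t i)\<^sup>2)) * (\<Prod>i\<in>insert a K. 1 / sqrt (1 - 2 * v * \<mu> i)))"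
    using insert.hyps P0 a by (simp add: ennreal_mult[symmetric] mult_ac)
  finally show ?case .
qed

text \<open>Turns an exponential moment directly into a bound on an expected positive part, with no
  integration of tails.\<close>

lemma pos_part_le_exp:
  fixes y :: real
  assumes "l > 0"
  shows "max 0 y \<le> exp (l * y) / l"
proof -
  have "l * y \<le> exp (l * y)" using exp_ge_add_one_self[of "l * y"] by linarith
  then have "y \<le> exp (l * y) / l" using assms by (simp add: field_simps)
  then show ?thesis using assms by simp
qed

context wiener_noise
begin

text \<open>Real and imaginary parts are the functionals with coefficients \<open>1\<close> and
  \<open>- \<i>\<close>, whose energies add up to 1. Unlike the equal split, this includes frequency
  0.\<close>

lemma second_moment_\<Xi>: "(\<integral>\<^sup>+\<omega>. ennreal ((cmod (\<Xi> k \<omega>))\<^sup>2) \<partial>M) = 1"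
proof -
  have 1: "(\<integral>\<^sup>+\<omega>. ennreal ((Re (\<Xi> k \<omega>))\<^sup>2) \<partial>M) = ennreal (trig_energy {k} (\<lambda>_. 1))"
    using gaussian_functional(2)[of "{k}" "\<lambda>_. 1"] by simp
  have 2: "(\<integral>\<^sup>+\<omega>. ennreal ((Im (\<Xi> k \<omega>))\<^sup>2) \<partial>M) = ennreal (trig_energy {k} (\<lambda>_. - \<i>))"
    using gaussian_functional(2)[of "{k}" "\<lambda>_. - \<i>"] by simp
  have "(\<integral>\<^sup>+\<omega>. ennreal ((cmod (\<Xi> k \<omega>))\<^sup>2) \<partial>M) = ennreal (trig_energy {k} (\<lambda>_. 1)) + ennreal (trig_energy {k} (\<lambda>_. - \<i>))"
    unfolding 1[symmetric] 2[symmetric] by (subst nn_integral_add[symmetric]) (auto simp: cmod_power2)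
  also have "\<dots> = ennreal (trig_energy {k} (\<lambda>_. 1) + trig_energy {k} (\<lambda>_. - \<i>))"
    by (rule ennreal_plus[symmetric])
       (auto simp: trig_energy_def set_lebesgue_integral_def intro!: Bochner_Integration.integral_nonneg)
  also have "trig_energy {k} (\<lambda>_. 1) + trig_energy {k} (\<lambda>_. - \<i>) =
      (\<integral>x\<in>{0..1}. (Re (\<Sum>k\<in>{k}. 1 * fourier_char k x))\<^sup>2 + (Re (\<Sum>k\<in>{k}. (- \<i>) * fourier_char k x))\<^sup>2 \<partial>lborel)"
    unfolding trig_energy_def by (rule set_integral_add(2)[symmetric]) (rule trig_energy_integrable)+
  also have "\<dots> = (\<integral>x\<in>{0..1}. (cmod (\<Sum>k\<in>{k}. 1 * fourier_char k x))\<^sup>2 \<partial>lborel)"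
    by (simp add: cmod_power2[symmetric])
  also have "\<dots> = 1" using trig_poly_integrals(1)[of "{k}" "\<lambda>_. 1"] by simp
  finally show ?thesis by simp
qed

lemma integrable_sq_\<Xi>: "integrable M (\<lambda>\<omega>. (cmod (\<Xi> k \<omega>))\<^sup>2)"
  and expectation_sq_\<Xi>: "expectation (\<lambda>\<omega>. (cmod (\<Xi> k \<omega>))\<^sup>2) = 1"
proof -
  show i: "integrable M (\<lambda>\<omega>. (cmod (\<Xi> k \<omega>))\<^sup>2)"
    by (rule integrableI_nonneg) (auto simp: second_moment_\<Xi>)
  show "expectation (\<lambda>\<omega>. (cmod (\<Xi> k \<omega>))\<^sup>2) = 1"
    using second_moment_\<Xi>[of k] by (subst (asm) nn_integral_eq_integral[OF i]) auto
qed

text \<open>On a one-sided frequency set, linear functionals obey the bound for independent real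
  coordinates of variance \<open>1 / 2\<close>. The two coordinates of a frequency each give a
  factor \<open>1 / sqrt (1 - \<mu> k)\<close>.\<close>

lemma exp_quadratic_moment:
  assumes K: "finite K" "\<And>k l. k \<in> K \<Longrightarrow> l \<in> K \<Longrightarrow> k + l \<noteq> 0"
    and \<mu>: "\<And>k. k \<in> K \<Longrightarrow> 0 \<le> \<mu> k" "\<And>k. k \<in> K \<Longrightarrow> \<mu> k < 1"
  shows "(\<integral>\<^sup>+\<omega>. ennreal (exp (\<Sum>k\<in>K. \<mu> k * (cmod (\<Xi> k \<omega>))\<^sup>2)) \<partial>M) \<le> ennreal (\<Prod>k\<in>K. 1 / (1 - \<mu> k))"
proof -
  define x where "x i \<omega> = (if snd i then Re (\<Xi> (fst i) \<omega>) else Im (\<Xi> (fst i) \<omega>))" for i :: "int \<times> bool" and \<omega>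
  let ?S = "K \<times> (UNIV :: bool set)"
  have [measurable]: "x i \<in> borel_measurable M" for i by (cases "snd i") (simp_all add: x_def[abs_def])
  have lin: "(\<integral>\<^sup>+\<omega>. ennreal (exp (\<Sum>i\<in>?S. t i * x i \<omega>)) \<partial>M) \<le> ennreal (exp ((1/2) / 2 * (\<Sum>i\<in>?S. (t i)\<^sup>2)))" for t
  proof -
    \<comment> \<open>The minus sign compensates the one in the real part of a product.\<close>
    define z where "z k = Complex (t (k, True)) (- t (k, False))" for k
    have "(\<Sum>i\<in>?S. t i * x i \<omega>) = Re (\<Sum>k\<in>K. z k * \<Xi> k \<omega>)" for \<omega>
      unfolding sum.cartesian_product' by (simp add: UNIV_bool x_def z_def algebra_simps)
    moreover have "(\<Sum>i\<in>?S. (t i)\<^sup>2) = (\<Sum>k\<in>K. (cmod (z k))\<^sup>2)"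
      unfolding sum.cartesian_product' by (simp add: UNIV_bool z_def cmod_power2 add.commute)
    ultimately show ?thesis
      using gaussian_functional(1)[OF K(1), of z] trig_energy_half[OF K, of z] by simp
  qed
  have "(\<integral>\<^sup>+\<omega>. ennreal (exp (\<Sum>i\<in>?S. \<mu> (fst i) * (x i \<omega>)\<^sup>2)) \<partial>M) \<le> ennreal (\<Prod>i\<in>?S. 1 / sqrt (1 - \<mu> (fst i)))"
    using exp_quadratic_moment_aux[of ?S x "1/2" ?S "\<lambda>i. \<mu> (fst i)" "\<lambda>_. 0", OF _ _ _ lin] K \<mu> by auto
  also have "(\<lambda>\<omega>. \<Sum>i\<in>?S. \<mu> (fst i) * (x i \<omega>)\<^sup>2) = (\<lambda>\<omega>. \<Sum>k\<in>K. \<mu> k * (cmod (\<Xi> k \<omega>))\<^sup>2)"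
    unfolding sum.cartesian_product' by (simp add: UNIV_bool x_def cmod_power2 algebra_simps)
  also have "(\<Prod>i\<in>?S. 1 / sqrt (1 - \<mu> (fst i))) = (\<Prod>k\<in>K. 1 / (1 - \<mu> k))"
    unfolding prod.cartesian_product'
    by (intro prod.cong refl) (use \<mu> in \<open>auto simp: UNIV_bool less_imp_le\<close>)
  finally show ?thesis .
qed

text \<open>A Chernoff bound at parameter \<open>l\<close>. The condition
  \<open>l * a k \<le> 1 / 2\<close> makes the logarithm of each factor at most quadratic beyond its
  linear part, and the centring cancels the linear part.\<close>

lemma quadratic_excess:
  assumes K: "finite K" "\<And>k l. k \<in> K \<Longrightarrow> l \<in> K \<Longrightarrow> k + l \<noteq> 0"
    and a: "\<And>k. k \<in> K \<Longrightarrow> 0 \<le> a k" "\<And>k. k \<in> K \<Longrightarrow> l * a k \<le> 1 / 2" and l: "l > 0"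
  shows "(\<integral>\<^sup>+\<omega>. ennreal (max 0 ((\<Sum>k\<in>K. a k * ((cmod (\<Xi> k \<omega>))\<^sup>2 - 1)) - D)) \<partial>M)
    \<le> ennreal (exp (2 * l\<^sup>2 * (\<Sum>k\<in>K. (a k)\<^sup>2) - l * D) / l)"
proof -
  let ?s = "\<Sum>k\<in>K. a k"
  have "(\<integral>\<^sup>+\<omega>. ennreal (max 0 ((\<Sum>k\<in>K. a k * ((cmod (\<Xi> k \<omega>))\<^sup>2 - 1)) - D)) \<partial>M) \<le>
    (\<integral>\<^sup>+\<omega>. ennreal (exp (- l * (?s + D)) / l) * ennreal (exp (\<Sum>k\<in>K. (l * a k) * (cmod (\<Xi> k \<omega>))\<^sup>2)) \<partial>M)"
  proof (intro nn_integral_mono)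
    fix \<omega>
    have "l * ((\<Sum>k\<in>K. a k * ((cmod (\<Xi> k \<omega>))\<^sup>2 - 1)) - D) = - l * (?s + D) + (\<Sum>k\<in>K. (l * a k) * (cmod (\<Xi> k \<omega>))\<^sup>2)"
      by (simp add: algebra_simps sum_subtractf sum_negf sum_distrib_left sum.distrib)
    then have "exp (l * ((\<Sum>k\<in>K. a k * ((cmod (\<Xi> k \<omega>))\<^sup>2 - 1)) - D)) = exp (- l * (?s + D)) * exp (\<Sum>k\<in>K. (l * a k) * (cmod (\<Xi> k \<omega>))\<^sup>2)"
      by (simp only: exp_add)
    then have "max 0 ((\<Sum>k\<in>K. a k * ((cmod (\<Xi> k \<omega>))\<^sup>2 - 1)) - D) \<le> exp (- l * (?s + D)) / l * exp (\<Sum>k\<in>K. (l * a k) * (cmod (\<Xi> k \<omega>))\<^sup>2)"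
      using pos_part_le_exp[OF l, of "(\<Sum>k\<in>K. a k * ((cmod (\<Xi> k \<omega>))\<^sup>2 - 1)) - D"] by (simp only: times_divide_eq_left)
    then show "ennreal (max 0 ((\<Sum>k\<in>K. a k * ((cmod (\<Xi> k \<omega>))\<^sup>2 - 1)) - D)) \<le>
       ennreal (exp (- l * (?s + D)) / l) * ennreal (exp (\<Sum>k\<in>K. (l * a k) * (cmod (\<Xi> k \<omega>))\<^sup>2))"
      using l by (subst ennreal_mult[symmetric]) (auto intro!: ennreal_leI)
  qed
  also have "\<dots> = ennreal (exp (- l * (?s + D)) / l) * (\<integral>\<^sup>+\<omega>. ennreal (exp (\<Sum>k\<in>K. (l * a k) * (cmod (\<Xi> k \<omega>))\<^sup>2)) \<partial>M)"
    by (rule nn_integral_cmult) measurable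
  also have "\<dots> \<le> ennreal (exp (- l * (?s + D)) / l) * ennreal (\<Prod>k\<in>K. 1 / (1 - l * a k))"
  proof (intro mult_left_mono exp_quadratic_moment K)
    show "0 \<le> l * a k" "l * a k < 1" if "k \<in> K" for k using a[OF that] l by auto
  qed (simp_all add: zero_le)
  also have "\<dots> \<le> ennreal (exp (- l * (?s + D)) / l) * ennreal (\<Prod>k\<in>K. exp (l * a k + 2 * (l * a k)\<^sup>2))"
  proof (intro mult_left_mono ennreal_leI prod_mono conjI)
    fix k assume k: "k \<in> K"
    have p: "1 - l * a k > 0" using a(2)[OF k] by simp
    then show "0 \<le> 1 / (1 - l * a k)" by simp
    \<comment> \<open>The bound \<open>- ln (1 - u) \<le> u + 2 * u\<^sup>2\<close> for
      \<open>u\<close> in \<open>{0..1/2}\<close>, at \<open>u = l * a k\<close>.\<close>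
    have "- (l * a k) - 2 * (l * a k)\<^sup>2 \<le> ln (1 - l * a k)"
      using a[OF k] l by (intro ln_one_minus_pos_lower_bound) auto
    then have "exp (- (l * a k + 2 * (l * a k)\<^sup>2)) \<le> 1 - l * a k" using p by (simp add: ln_ge_iff)
    then have "1 / (1 - l * a k) \<le> 1 / exp (- (l * a k + 2 * (l * a k)\<^sup>2))"
      using p by (intro divide_left_mono) auto
    then show "1 / (1 - l * a k) \<le> exp (l * a k + 2 * (l * a k)\<^sup>2)"
      by (simp only: exp_minus divide_inverse inverse_inverse_eq mult_1)
  qed simp
  also have "\<dots> = ennreal (exp (- l * (?s + D)) / l * exp (\<Sum>k\<in>K. l * a k + 2 * (l * a k)\<^sup>2))"
    using l K(1) by (subst ennreal_mult[symmetric]) (auto simp: exp_sum prod_nonneg)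
  also have "exp (- l * (?s + D)) / l * exp (\<Sum>k\<in>K. l * a k + 2 * (l * a k)\<^sup>2) = exp (2 * l\<^sup>2 * (\<Sum>k\<in>K. (a k)\<^sup>2) - l * D) / l"
    by (simp add: exp_add[symmetric] sum.distrib sum_distrib_left sum_negf power_mult_distrib algebra_simps)
  finally show ?thesis .
qed

text \<open>The Chernoff bound for a linear form, with no restriction on the size of
  \<open>l\<close>. The set may be two-sided, so the general energy bound is used.\<close>

lemma linear_excess:
  assumes K: "finite K" and l: "l > 0"
  shows "(\<integral>\<^sup>+\<omega>. ennreal (max 0 (Re (\<Sum>k\<in>K. z k * \<Xi> k \<omega>) - D)) \<partial>M)
    \<le> ennreal (exp (l\<^sup>2 / 2 * (\<Sum>k\<in>K. (cmod (z k))\<^sup>2) - l * D) / l)"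
proof -
  have "(\<integral>\<^sup>+\<omega>. ennreal (max 0 (Re (\<Sum>k\<in>K. z k * \<Xi> k \<omega>) - D)) \<partial>M) \<le>
    (\<integral>\<^sup>+\<omega>. ennreal (exp (- l * D) / l) * ennreal (exp (Re (\<Sum>k\<in>K. (of_real l * z k) * \<Xi> k \<omega>))) \<partial>M)"
  proof (intro nn_integral_mono)
    fix \<omega>
    have e: "(\<Sum>k\<in>K. (of_real l * z k) * \<Xi> k \<omega>) = of_real l * (\<Sum>k\<in>K. z k * \<Xi> k \<omega>)"
      by (simp add: sum_distrib_left mult_ac)
    have "l * (Re (\<Sum>k\<in>K. z k * \<Xi> k \<omega>) - D) = - l * D + Re (\<Sum>k\<in>K. (of_real l * z k) * \<Xi> k \<omega>)"
      unfolding e by (simp add: algebra_simps del: Re_sum Im_sum)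
    then have "exp (l * (Re (\<Sum>k\<in>K. z k * \<Xi> k \<omega>) - D)) = exp (- l * D) * exp (Re (\<Sum>k\<in>K. (of_real l * z k) * \<Xi> k \<omega>))"
      by (simp only: exp_add)
    then show "ennreal (max 0 (Re (\<Sum>k\<in>K. z k * \<Xi> k \<omega>) - D)) \<le>
       ennreal (exp (- l * D) / l) * ennreal (exp (Re (\<Sum>k\<in>K. (of_real l * z k) * \<Xi> k \<omega>)))"
      using pos_part_le_exp[OF l, of "Re (\<Sum>k\<in>K. z k * \<Xi> k \<omega>) - D"] l
      by (subst ennreal_mult[symmetric]) (auto intro!: ennreal_leI simp del: Re_sum times_complex.sel)
  qed
  also have "\<dots> = ennreal (exp (- l * D) / l) * (\<integral>\<^sup>+\<omega>. ennreal (exp (Re (\<Sum>k\<in>K. (of_real l * z k) * \<Xi> k \<omega>))) \<partial>M)"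
    by (rule nn_integral_cmult) measurable
  also have "\<dots> \<le> ennreal (exp (- l * D) / l) * ennreal (exp (trig_energy K (\<lambda>k. of_real l * z k) / 2))"
    by (intro mult_left_mono gaussian_functional K) simp
  also have "\<dots> \<le> ennreal (exp (- l * D) / l) * ennreal (exp (l\<^sup>2 / 2 * (\<Sum>k\<in>K. (cmod (z k))\<^sup>2)))"
    using trig_energy_le[OF K, of "\<lambda>k. of_real l * z k"]
    by (intro mult_left_mono ennreal_leI) (auto simp: norm_mult power_mult_distrib sum_distrib_left[symmetric])
  also have "\<dots> = ennreal (exp (l\<^sup>2 / 2 * (\<Sum>k\<in>K. (cmod (z k))\<^sup>2) - l * D) / l)"
    using l by (simp add: ennreal_mult[symmetric] exp_add[symmetric] algebra_simps)
  finally show ?thesis .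
qed

end

section \<open>Fourier coefficients of the shifted signal\<close>

lemma fourier_char_measurable_lebesgue [measurable]: "fourier_char k \<in> borel_measurable lebesgue"
  by (intro measurable_completion) simp

lemma periodic_int_shift:
  fixes h :: "real \<Rightarrow> 'b"
  assumes "\<And>x. h (x + 1) = h x"
  shows "h (x + of_int m) = h x"
proof -
  have nat: "h (y + real i) = h y" for y i
  proof (induction i)
    case (Suc i)
    then show ?case using assms[of "y + real i"] by (simp add: add_ac)
  qed simp
  show ?thesis
  proof (cases "m \<ge> 0")
    case True
    then show ?thesis using nat[of x "nat m"] by simp
  next
    case False
    then show ?thesis using nat[of "x + of_int m" "nat (- m)"] by simp
  qed
qed

text \<open>After removing whole periods, the window \<open>{s..<s + 1}\<close> is cut at 1 and the
  overhang is moved back by one period. Completed Lebesgue measure matches the measurability assumed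
  of the signal.\<close>

lemma set_integral_periodic_shift:
  fixes h :: "real \<Rightarrow> complex"
  assumes per: "\<And>x. h (x + 1) = h x" and int: "set_integrable lebesgue {0..1} h"
  shows "(\<integral>x\<in>{0..1}. h (x - a) \<partial>lebesgue) = (\<integral>x\<in>{0..1}. h x \<partial>lebesgue)"
proof -
  \<comment> \<open>Half-open intervals can be cut and reassembled without overlap.\<close>
  have ico: "(\<integral>x\<in>{0..1}. f x \<partial>lebesgue) = (\<integral>x\<in>{0..<1}. f x \<partial>lebesgue)" for f :: "real \<Rightarrow> complex"
    by (rule set_integral_discrete_difference[of "{1}"]) auto
  \<comment> \<open>Only the fractional part \<open>s\<close> of the translation remains.\<close>
  define m where "m = \<lfloor>- a\<rfloor>"
  define s where "s = - a - of_int m"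
  have s: "0 \<le> s" "s < 1" unfolding s_def m_def by linarith+
  have "(\<integral>x\<in>{0..<1}. h (x - a) \<partial>lebesgue) = (\<integral>x. indicator {0..<1} x *\<^sub>R h (x + s) \<partial>lebesgue)"
    unfolding set_lebesgue_integral_def
  proof (intro Bochner_Integration.integral_cong refl)
    fix x
    have e: "x - a = (x + s) + of_int m" by (simp add: s_def)
    have "h (x - a) = h (x + s)" unfolding e by (rule periodic_int_shift[of h, OF per])
    then show "indicator {0..<1} x *\<^sub>R h (x - a) = indicator {0..<1} x *\<^sub>R h (x + s)" by simp
  qed
  also have "\<dots> = (\<integral>x. indicator {s..<s + 1} x *\<^sub>R h x \<partial>lebesgue)"
  proof -
    have "indicator {s..<s + 1} (s + 1 * x) *\<^sub>R h (s + 1 * x) = indicator {0..<1} x *\<^sub>R h (x + s)" for x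
      by (auto simp: indicator_def add.commute)
    then show ?thesis
      using lebesgue_integral_real_affine[of 1 "\<lambda>x. indicator {s..<s + 1} x *\<^sub>R h x" s] by simp
  qed
  also have "\<dots> = (\<integral>x. indicator {s..<1} x *\<^sub>R h x \<partial>lebesgue) + (\<integral>x. indicator {1..<1 + s} x *\<^sub>R h x \<partial>lebesgue)"
  proof -
    have i1: "integrable lebesgue (\<lambda>x. indicator {s..<1} x *\<^sub>R h x)"
      by (rule set_integrable_subset[OF int, unfolded set_integrable_def]) (use s in auto)
    have i0: "integrable lebesgue (\<lambda>x. indicator {0..<s} x *\<^sub>R h x)"
      by (rule set_integrable_subset[OF int, unfolded set_integrable_def]) (use s in auto)
    have "indicator {1..<1 + s} (1 + 1 * x) *\<^sub>R h (1 + 1 * x) = indicator {0..<s} x *\<^sub>R h x" for x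
      using per[of x] by (auto simp: indicator_def add.commute)
    then have i2: "integrable lebesgue (\<lambda>x. indicator {1..<1 + s} x *\<^sub>R h x)"
      using lebesgue_integrable_real_affine_iff[of 1 "\<lambda>x. indicator {1..<1 + s} x *\<^sub>R h x" 1] i0 by simp
    show ?thesis
      unfolding Bochner_Integration.integral_add[OF i1 i2, symmetric]
      using s by (intro Bochner_Integration.integral_cong refl) (auto simp: indicator_def)
  qed
  also have "(\<integral>x. indicator {1..<1 + s} x *\<^sub>R h x \<partial>lebesgue) = (\<integral>x. indicator {0..<s} x *\<^sub>R h x \<partial>lebesgue)"
  proof -
    have "indicator {1..<1 + s} (1 + 1 * x) *\<^sub>R h (1 + 1 * x) = indicator {0..<s} x *\<^sub>R h x" for x
      using per[of x] by (auto simp: indicator_def add.commute)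
    then show ?thesis
      using lebesgue_integral_real_affine[of 1 "\<lambda>x. indicator {1..<1 + s} x *\<^sub>R h x" 1] by simp
  qed
  also have "(\<integral>x. indicator {s..<1} x *\<^sub>R h x \<partial>lebesgue) + (\<integral>x. indicator {0..<s} x *\<^sub>R h x \<partial>lebesgue)
      = (\<integral>x\<in>{0..<1}. h x \<partial>lebesgue)"
  proof -
    have i1: "integrable lebesgue (\<lambda>x. indicator {s..<1} x *\<^sub>R h x)"
      by (rule set_integrable_subset[OF int, unfolded set_integrable_def]) (use s in auto)
    have i0: "integrable lebesgue (\<lambda>x. indicator {0..<s} x *\<^sub>R h x)"
      by (rule set_integrable_subset[OF int, unfolded set_integrable_def]) (use s in auto)
    show ?thesis
      unfolding Bochner_Integration.integral_add[OF i1 i0, symmetric] set_lebesgue_integral_def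
      using s by (intro Bochner_Integration.integral_cong refl) (auto simp: indicator_def)
  qed
  finally show ?thesis unfolding ico .
qed

locale periodic_signal =
  fixes f :: "real \<Rightarrow> real"
  assumes periodic: "\<And>x. f (x + 1) = f x"
    and measurable_f [measurable]: "f \<in> borel_measurable lebesgue"
    and square_integrable: "set_integrable lebesgue {0..1} (\<lambda>x. (f x)\<^sup>2)"
begin

lemma integrable_fourier: "set_integrable lebesgue {0..1} (\<lambda>x. fourier_char k x * of_real (f x))"
proof -
  have "set_integrable lebesgue {0..1} (\<lambda>x. 1 + (f x)\<^sup>2)"
    by (intro set_integral_add square_integrable) (auto simp: set_integrable_def)
  then show ?thesis
    unfolding set_integrable_def
  proof (rule Bochner_Integration.integrable_bound)
    have "\<bar>y\<bar> \<le> 1 + y\<^sup>2" for y :: real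
      using zero_le_power2[of "\<bar>y\<bar> - 1"] by (simp add: power2_eq_square algebra_simps)
    then show "AE x in lebesgue. norm (indicator {0..1} x *\<^sub>R (fourier_char k x * complex_of_real (f x)))
        \<le> norm (indicator {0..1} x *\<^sub>R (1 + (f x)\<^sup>2))"
      by (auto simp: norm_mult indicator_def)
    have "(\<lambda>x. complex_of_real (f x)) \<in> borel_measurable lebesgue"
      by (rule measurable_compose[OF measurable_f borel_measurable_of_real])
    then show "(\<lambda>x. indicator {0..1} x *\<^sub>R (fourier_char k x * complex_of_real (f x))) \<in> borel_measurable lebesgue"
      by (intro borel_measurable_scaleR borel_measurable_times fourier_char_measurable_lebesgue borel_measurable_indicator) auto
  qed
qed

text \<open>Completing the character to \<open>fourier_char k (x - t)\<close> makes the integrand a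
  translate of a periodic function. Each random shift thus becomes multiplication by a unimodular
  number.\<close>

lemma shifted_fourier_integral:
  "(\<integral>x\<in>{0..1}. fourier_char k x * of_real (f (x - t)) \<partial>lebesgue) = fourier_coeff f k * fourier_char k t"
proof -
  have e: "fourier_char k x * of_real (f (x - t)) = fourier_char k t * (fourier_char k (x - t) * of_real (f (x - t)))" for x
  proof -
    have "fourier_char k (x - t) * fourier_char k t = fourier_char k x"
      by (simp add: fourier_char_def exp_add[symmetric] algebra_simps)
    then show ?thesis by (simp add: mult_ac flip: mult.assoc)
  qed
  have "(\<integral>x\<in>{0..1}. fourier_char k x * of_real (f (x - t)) \<partial>lebesgue) =
      fourier_char k t * (\<integral>x\<in>{0..1}. fourier_char k (x - t) * of_real (f (x - t)) \<partial>lebesgue)"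
    unfolding e by (rule set_integral_mult_right)
  also have "(\<integral>x\<in>{0..1}. fourier_char k (x - t) * of_real (f (x - t)) \<partial>lebesgue) = fourier_coeff f k"
    unfolding fourier_coeff_def
    using fourier_char_int[of k _ 1] periodic integrable_fourier
    by (intro set_integral_periodic_shift) simp_all
  finally show ?thesis by simp
qed

lemma fourier_coeff_uminus: "fourier_coeff f (- k) = cnj (fourier_coeff f k)"
proof -
  have "fourier_coeff f (- k) = (\<integral>x. cnj (indicator {0..1} x *\<^sub>R (fourier_char k x * of_real (f x))) \<partial>lebesgue)"
    unfolding fourier_coeff_def set_lebesgue_integral_def
    by (intro Bochner_Integration.integral_cong refl) (simp add: cnj_fourier_char)
  also have "\<dots> = cnj (fourier_coeff f k)"
    unfolding fourier_coeff_def set_lebesgue_integral_def by (rule Bochner_Integration.integral_cnj)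
  finally show ?thesis .
qed

text \<open>Nonnegativity of the squared distance from the signal to a partial Fourier sum. It makes
  the squared coefficients summable; otherwise \<open>infsum\<close> would return the default value
  0.\<close>

lemma bessel:
  assumes "finite F"
  shows "(\<Sum>k\<in>F. (cmod (fourier_coeff f k))\<^sup>2) \<le> (\<integral>x\<in>{0..1}. (f x)\<^sup>2 \<partial>lebesgue)"
proof -
  \<comment> \<open>The characters have a negative exponent, so the Fourier series attaches the
    coefficient of index \<open>- l\<close> to \<open>fourier_char l\<close>.\<close>
  let ?K = "uminus ` F"
  let ?z = "\<lambda>l. fourier_coeff f (- l)"
  let ?u = "\<lambda>x. \<Sum>l\<in>?K. ?z l * fourier_char l x"
  let ?S = "\<Sum>k\<in>F. (cmod (fourier_coeff f k))\<^sup>2"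
  have K: "finite ?K" using assms by simp
  have S: "(\<Sum>l\<in>?K. (cmod (?z l))\<^sup>2) = ?S" by (subst sum.reindex) (auto simp: o_def)
  have u2: "(\<integral>x\<in>{0..1}. (cmod (?u x))\<^sup>2 \<partial>lebesgue) = ?S"
  proof -
    have "(\<integral>x\<in>{0..1}. (cmod (?u x))\<^sup>2 \<partial>lebesgue) = (\<integral>x\<in>{0..1}. (cmod (?u x))\<^sup>2 \<partial>lborel)"
      unfolding set_lebesgue_integral_def by (rule integral_completion) simp
    then show ?thesis using trig_poly_integrals(1)[OF K, of ?z] S by simp
  qed
  have iu: "set_integrable lebesgue {0..1} (\<lambda>x. (cmod (?u x))\<^sup>2)"
  proof -
    have "set_integrable lborel {0..1} (\<lambda>x. (cmod (?u x))\<^sup>2)"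
      by (intro borel_integrable_atLeastAtMost' continuous_intros)
    then show ?thesis unfolding set_integrable_def by (subst integrable_completion) auto
  qed
  have ic: "set_integrable lebesgue {0..1} (\<lambda>x. ?u x * of_real (f x))"
  proof -
    have "set_integrable lebesgue {0..1} (\<lambda>x. \<Sum>l\<in>?K. ?z l * (fourier_char l x * of_real (f x)))"
      unfolding set_integrable_def scaleR_sum_right
      using integrable_fourier unfolding set_integrable_def
      by (intro Bochner_Integration.integrable_sum) (simp add: mult_scaleR_right[symmetric] del: mult_scaleR_right)
    then show ?thesis by (simp add: sum_distrib_right mult.assoc)
  qed
  have cross: "(\<integral>x\<in>{0..1}. ?u x * of_real (f x) \<partial>lebesgue) = of_real ?S"
  proof -
    have "(\<integral>x\<in>{0..1}. ?u x * of_real (f x) \<partial>lebesgue) = (\<Sum>l\<in>?K. \<integral>x\<in>{0..1}. ?z l * (fourier_char l x * of_real (f x)) \<partial>lebesgue)"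
      unfolding set_lebesgue_integral_def sum_distrib_right scaleR_sum_right mult.assoc
      using integrable_fourier unfolding set_integrable_def
      by (intro Bochner_Integration.integral_sum) (simp add: mult_scaleR_right[symmetric] del: mult_scaleR_right)
    also have "\<dots> = (\<Sum>l\<in>?K. ?z l * fourier_coeff f l)" by (simp add: fourier_coeff_def)
    also have "\<dots> = (\<Sum>k\<in>F. fourier_coeff f k * cnj (fourier_coeff f k))"
      by (subst sum.reindex) (auto simp: o_def fourier_coeff_uminus)
    also have "\<dots> = of_real ?S" by (simp add: complex_norm_square[symmetric])
    finally show ?thesis .
  qed
  have crossR: "(\<integral>x\<in>{0..1}. Re (?u x * of_real (f x)) \<partial>lebesgue) = ?S"
    and icR: "set_integrable lebesgue {0..1} (\<lambda>x. Re (?u x * of_real (f x)))"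
  proof -
    have "(\<integral>x\<in>{0..1}. Re (?u x * of_real (f x)) \<partial>lebesgue) = Re (\<integral>x\<in>{0..1}. ?u x * of_real (f x) \<partial>lebesgue)"
      using ic unfolding set_lebesgue_integral_def set_integrable_def
      by (subst integral_Re[symmetric]) simp_all
    then show "(\<integral>x\<in>{0..1}. Re (?u x * of_real (f x)) \<partial>lebesgue) = ?S" unfolding cross by simp
    have "integrable lebesgue (\<lambda>x. Re (indicator {0..1} x *\<^sub>R (?u x * of_real (f x))))"
      using ic unfolding set_integrable_def by (rule integrable_Re)
    then show "set_integrable lebesgue {0..1} (\<lambda>x. Re (?u x * of_real (f x)))" unfolding set_integrable_def by simp
  qed
  have sq: "(cmod (of_real y - w))\<^sup>2 = y\<^sup>2 - 2 * Re (w * of_real y) + (cmod w)\<^sup>2" for y w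
    unfolding cmod_power2 by (simp add: power2_eq_square algebra_simps)
  have "0 \<le> (\<integral>x\<in>{0..1}. (cmod (of_real (f x) - ?u x))\<^sup>2 \<partial>lebesgue)"
    unfolding set_lebesgue_integral_def by (intro Bochner_Integration.integral_nonneg) simp
  also have "\<dots> = (\<integral>x\<in>{0..1}. (f x)\<^sup>2 \<partial>lebesgue) - 2 * ?S + ?S"
    unfolding sq
    using square_integrable iu icR crossR u2
    by (simp only: set_integral_add set_integral_diff set_integrable_mult_right set_integral_mult_right)
  finally show ?thesis by simp
qed

end

section \<open>Concentration of the empirical shift coefficients\<close>

definition emp_shift :: "nat \<Rightarrow> (nat \<Rightarrow> 'w \<Rightarrow> real) \<Rightarrow> int \<Rightarrow> 'w \<Rightarrow> complex" where
  "emp_shift n \<tau> k \<omega> = (\<Sum>j=1..n. fourier_char k (\<tau> j \<omega>)) / of_nat n"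

locale random_shifts = prob_space M for M :: "'w measure" +
  fixes g :: "real \<Rightarrow> real" and n :: nat and \<tau> :: "nat \<Rightarrow> 'w \<Rightarrow> real"
  assumes n_pos': "n > 0" and density: "prob_density g"
    and dist: "\<And>j. j \<in> {1..n} \<Longrightarrow> distributed M lborel (\<tau> j) (\<lambda>x. ennreal (g x))"
    and indep_\<tau>: "indep_vars (\<lambda>_. borel) \<tau> {1..n}"
begin

lemma measurable_\<tau>: "j \<in> {1..n} \<Longrightarrow> \<tau> j \<in> borel_measurable M"
  using distributed_measurable[OF dist] by simp

lemma measurable_emp_shift [measurable]: "emp_shift n \<tau> k \<in> borel_measurable M"
proof -
  note [measurable] = measurable_\<tau>
  have "(\<lambda>\<omega>. fourier_char k (\<tau> j \<omega>)) \<in> borel_measurable M" if "j \<in> {1..n}" for j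
    using that by measurable
  then show ?thesis unfolding emp_shift_def[abs_def] by (intro borel_measurable_divide borel_measurable_sum) auto
qed

lemma expectation_shift_char:
  assumes j: "j \<in> {1..n}"
  shows "expectation (\<lambda>\<omega>. Re (fourier_char k (\<tau> j \<omega>))) = Re (shift_coeff g k)"
    and "expectation (\<lambda>\<omega>. Im (fourier_char k (\<tau> j \<omega>))) = Im (shift_coeff g k)"
proof -
  have [measurable]: "g \<in> borel_measurable borel" and g0: "\<And>x. g x \<ge> 0" and g1: "(\<integral>\<^sup>+x. ennreal (g x) \<partial>lborel) = 1"
    using density by (auto simp: prob_density_def)
  have gi: "integrable lborel g" by (rule integrableI_nonneg) (auto simp: g0 g1)
  have i: "integrable lborel (\<lambda>x. fourier_char k x * of_real (g x))"
    by (rule Bochner_Integration.integrable_bound[OF gi]) (auto simp: norm_mult)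
  have "expectation (\<lambda>\<omega>. Re (fourier_char k (\<tau> j \<omega>))) = (\<integral>x. g x * Re (fourier_char k x) \<partial>lborel)"
    by (rule distributed_integral[OF dist[OF j], symmetric]) (auto simp: g0)
  also have "\<dots> = Re (shift_coeff g k)"
    unfolding shift_coeff_def using i by (subst integral_Re[symmetric]) (auto simp: mult.commute)
  finally show "expectation (\<lambda>\<omega>. Re (fourier_char k (\<tau> j \<omega>))) = Re (shift_coeff g k)" .
  have "expectation (\<lambda>\<omega>. Im (fourier_char k (\<tau> j \<omega>))) = (\<integral>x. g x * Im (fourier_char k x) \<partial>lborel)"
    by (rule distributed_integral[OF dist[OF j], symmetric]) (auto simp: g0)
  also have "\<dots> = Im (shift_coeff g k)"
    unfolding shift_coeff_def using i by (subst integral_Im[symmetric]) (auto simp: mult.commute)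
  finally show "expectation (\<lambda>\<omega>. Im (fourier_char k (\<tau> j \<omega>))) = Im (shift_coeff g k)" .
qed

text \<open>\<phi> stands for \<open>Re\<close> or \<open>Im\<close>: the complex average is treated
  as two real ones with summands in \<open>{-1..1}\<close>.\<close>

lemma hoeffding_shift:
  fixes \<phi> :: "complex \<Rightarrow> real"
  assumes \<phi>[measurable]: "\<phi> \<in> borel_measurable borel" and bound: "\<And>w. \<bar>\<phi> w\<bar> \<le> cmod w" and y: "y \<ge> 0"
    and mean: "\<And>j. j \<in> {1..n} \<Longrightarrow> expectation (\<lambda>\<omega>. \<phi> (fourier_char k (\<tau> j \<omega>))) = c"
  shows "prob {\<omega>\<in>space M. \<bar>(\<Sum>j=1..n. \<phi> (fourier_char k (\<tau> j \<omega>))) - real n * c\<bar> \<ge> real n * y} \<le> 2 * exp (- real n * y\<^sup>2 / 2)"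
proof -
  interpret H: Hoeffding_ineq M "{1..n}" "\<lambda>j \<omega>. \<phi> (fourier_char k (\<tau> j \<omega>))" "\<lambda>_. -1" "\<lambda>_. 1"
    "\<Sum>j\<in>{1..n}. expectation (\<lambda>\<omega>. \<phi> (fourier_char k (\<tau> j \<omega>)))"
  proof (unfold_locales)
    show "indep_vars (\<lambda>_. borel) (\<lambda>j \<omega>. \<phi> (fourier_char k (\<tau> j \<omega>))) {1..n}"
      by (rule indep_vars_compose2[OF indep_\<tau>]) measurable
    show "AE \<omega> in M. \<phi> (fourier_char k (\<tau> j \<omega>)) \<in> {-1..1}" for j
      using bound[of "fourier_char k (\<tau> j _)"] by (intro AE_I2) (auto simp: abs_le_iff)
  qed auto
  have mu: "(\<Sum>j\<in>{1..n}. expectation (\<lambda>\<omega>. \<phi> (fourier_char k (\<tau> j \<omega>)))) = real n * c"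
    using mean by simp
  have "prob {\<omega>\<in>space M. \<bar>(\<Sum>j=1..n. \<phi> (fourier_char k (\<tau> j \<omega>))) - real n * c\<bar> \<ge> real n * y}
      \<le> 2 * exp (- 2 * (real n * y)\<^sup>2 / (\<Sum>i\<in>{1..n}. (1 - (-1))\<^sup>2))"
    using H.Hoeffding_ineq_abs_ge[of "real n * y"] n_pos' y unfolding mu by simp
  also have "- 2 * (real n * y)\<^sup>2 / (\<Sum>i\<in>{1..n}. (1 - (-1))\<^sup>2) = - real n * y\<^sup>2 / 2"
    using n_pos' by (simp add: power2_eq_square)
  finally show ?thesis .
qed

lemma emp_shift_tail:
  assumes y: "y \<ge> 0"
  shows "prob {\<omega>\<in>space M. (cmod (emp_shift n \<tau> k \<omega> - shift_coeff g k))\<^sup>2 > y} \<le> 4 * exp (- real n * y / 4)"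
proof -
  let ?D = "\<lambda>\<omega>. emp_shift n \<tau> k \<omega> - shift_coeff g k"
  let ?E = "\<lambda>\<phi> c. {\<omega>\<in>space M. \<bar>(\<Sum>j=1..n. \<phi> (fourier_char k (\<tau> j \<omega>))) - real n * c\<bar> \<ge> real n * sqrt (y / 2)}"
  note [measurable] = measurable_\<tau>
  have meas: "?E Re c \<in> sets M" "?E Im c \<in> sets M" for c
    by measurable
  have re: "(\<Sum>j=1..n. Re (fourier_char k (\<tau> j \<omega>))) - real n * Re (shift_coeff g k) = real n * Re (?D \<omega>)" for \<omega>
    using n_pos' by (simp add: emp_shift_def algebra_simps)
  have im: "(\<Sum>j=1..n. Im (fourier_char k (\<tau> j \<omega>))) - real n * Im (shift_coeff g k) = real n * Im (?D \<omega>)" for \<omega>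
    using n_pos' by (simp add: emp_shift_def algebra_simps)
  \<comment> \<open>If the squared modulus exceeds \<open>y\<close>, one of the two squared
    coordinates is at least \<open>y / 2\<close>; hence the threshold
    \<open>sqrt (y / 2)\<close>.\<close>
  have sub: "{\<omega>\<in>space M. (cmod (?D \<omega>))\<^sup>2 > y} \<subseteq> ?E Re (Re (shift_coeff g k)) \<union> ?E Im (Im (shift_coeff g k))"
  proof
    fix \<omega> assume \<omega>: "\<omega> \<in> {\<omega>\<in>space M. (cmod (?D \<omega>))\<^sup>2 > y}"
    then have "(Re (?D \<omega>))\<^sup>2 \<ge> y / 2 \<or> (Im (?D \<omega>))\<^sup>2 \<ge> y / 2"
      by (auto simp: cmod_power2)
    then have "\<bar>Re (?D \<omega>)\<bar> \<ge> sqrt (y / 2) \<or> \<bar>Im (?D \<omega>)\<bar> \<ge> sqrt (y / 2)"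
      by (metis real_sqrt_abs real_sqrt_le_iff)
    then show "\<omega> \<in> ?E Re (Re (shift_coeff g k)) \<union> ?E Im (Im (shift_coeff g k))"
      using \<omega> n_pos' unfolding re im by (auto simp: abs_mult)
  qed
  have "prob {\<omega>\<in>space M. (cmod (?D \<omega>))\<^sup>2 > y} \<le> prob (?E Re (Re (shift_coeff g k)) \<union> ?E Im (Im (shift_coeff g k)))"
    by (intro finite_measure_mono sub) (use meas in auto)
  also have "\<dots> \<le> prob (?E Re (Re (shift_coeff g k))) + prob (?E Im (Im (shift_coeff g k)))"
    by (intro measure_Un_le meas)
  also have "\<dots> \<le> 2 * exp (- real n * (sqrt (y / 2))\<^sup>2 / 2) + 2 * exp (- real n * (sqrt (y / 2))\<^sup>2 / 2)"
    by (intro add_mono hoeffding_shift expectation_shift_char)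
       (use y in \<open>auto simp: abs_Re_le_cmod abs_Im_le_cmod\<close>)
  also have "\<dots> = 4 * exp (- real n * y / 4)" using y by simp
  finally show ?thesis .
qed

lemma norm_shift_coeff_le: "cmod (shift_coeff g k) \<le> 1"
proof -
  have [measurable]: "g \<in> borel_measurable borel" and g0: "\<And>x. g x \<ge> 0" and g1: "(\<integral>\<^sup>+x. ennreal (g x) \<partial>lborel) = 1"
    using density by (auto simp: prob_density_def)
  have gi: "integrable lborel g" by (rule integrableI_nonneg) (auto simp: g0 g1)
  have g1': "integral\<^sup>L lborel g = 1" using g1 nn_integral_eq_integral[OF gi] g0 by simp
  have "cmod (shift_coeff g k) \<le> (\<integral>x. norm (fourier_char k x * complex_of_real (g x)) \<partial>lborel)"
    unfolding shift_coeff_def by (rule integral_norm_bound)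
  also have "\<dots> = 1" using g1' g0 by (simp add: norm_mult)
  finally show ?thesis .
qed

lemma norm_emp_shift_le: "cmod (emp_shift n \<tau> k \<omega>) \<le> 1"
proof -
  have "cmod (\<Sum>j=1..n. fourier_char k (\<tau> j \<omega>)) \<le> (\<Sum>j=1..n. cmod (fourier_char k (\<tau> j \<omega>)))" by (rule norm_sum)
  then show ?thesis using n_pos' by (simp add: emp_shift_def norm_divide)
qed

text \<open>The variable vanishes unless the squared deviation exceeds \<open>a / c\<close>, and is
  at most \<open>4 * c\<close> since the deviation is at most 2. Multiplying by the tail probability
  suffices.\<close>

lemma emp_shift_excess:
  fixes k :: int and c a :: real
  assumes c: "c > 0" and a: "a \<ge> 0"
  defines "X \<equiv> \<lambda>\<omega>. max 0 (c * (cmod (emp_shift n \<tau> k \<omega> - shift_coeff g k))\<^sup>2 - a)"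
  shows "integrable M X" "expectation X \<le> 16 * c * exp (- real n * a / (4 * c))"
proof -
  let ?D = "\<lambda>\<omega>. (cmod (emp_shift n \<tau> k \<omega> - shift_coeff g k))\<^sup>2"
  let ?E = "{\<omega>\<in>space M. ?D \<omega> > a / c}"
  have D4: "?D \<omega> \<le> 4" for \<omega>
  proof -
    have "cmod (emp_shift n \<tau> k \<omega> - shift_coeff g k) \<le> 2"
      using norm_triangle_ineq4[of "emp_shift n \<tau> k \<omega>" "shift_coeff g k"] norm_shift_coeff_le[of k] norm_emp_shift_le[of k \<omega>] by simp
    then have "(cmod (emp_shift n \<tau> k \<omega> - shift_coeff g k))\<^sup>2 \<le> 2\<^sup>2" by (intro power_mono) auto
    then show ?thesis by simp
  qed
  have le: "X \<omega> \<le> 4 * c * indicator ?E \<omega>" if "\<omega> \<in> space M" for \<omega>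
  proof (cases "?D \<omega> > a / c")
    case True
    have "c * ?D \<omega> \<le> c * 4" using D4[of \<omega>] c by (intro mult_left_mono) auto
    then have "X \<omega> \<le> 4 * c" unfolding X_def using a c by (intro max.boundedI; linarith)
    then show ?thesis using True that by simp
  next
    case False
    then have "c * ?D \<omega> \<le> a" using c by (simp add: field_simps)
    then show ?thesis using c by (simp add: X_def)
  qed
  have [measurable]: "X \<in> borel_measurable M" "?E \<in> sets M" unfolding X_def by measurable
  show i: "integrable M X"
  proof (rule integrable_const_bound[of _ "4 * c"])
    show "AE \<omega> in M. norm (X \<omega>) \<le> 4 * c"
    proof (intro AE_I2)
      fix \<omega> assume "\<omega> \<in> space M"
      have "0 \<le> X \<omega>" by (simp add: X_def)
      moreover have "4 * c * indicator ?E \<omega> \<le> 4 * c" using c by (simp add: indicator_def)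
      ultimately show "norm (X \<omega>) \<le> 4 * c" using le[OF \<open>\<omega> \<in> space M\<close>] by simp
    qed
  qed simp
  have "expectation X \<le> expectation (\<lambda>\<omega>. 4 * c * indicator ?E \<omega>)"
    by (intro integral_mono i le) (auto intro!: integrable_mult_right integrable_real_indicator simp: less_top[symmetric])
  also have "\<dots> = 4 * c * prob ?E" by simp
  also have "\<dots> \<le> 4 * c * (4 * exp (- real n * (a / c) / 4))"
    using c a by (intro mult_left_mono emp_shift_tail) auto
  also have "\<dots> = 16 * c * exp (- real n * a / (4 * c))" by (simp add: field_simps)
  finally show "expectation X \<le> 16 * c * exp (- real n * a / (4 * c))" .
qed

end

lemma c_tilde_decomposition:
  assumes f: "periodic_signal f" and n: "n > 0"
  shows "c_tilde f \<epsilon> n \<tau> I \<omega> k = fourier_coeff f k * emp_shift n \<tau> k \<omega>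
    + of_real (\<epsilon> / sqrt (real n)) * ((\<Sum>j=1..n. I j k \<omega>) / of_real (sqrt (real n)))"
proof -
  interpret periodic_signal f by fact
  have "complex_of_real (sqrt (real n)) * complex_of_real (sqrt (real n)) = of_nat n"
    by (metis of_real_mult of_real_of_nat_eq real_sqrt_mult_self abs_of_nat)
  then show ?thesis
    using n unfolding c_tilde_def shifted_fourier_integral emp_shift_def
    by (simp add: sum.distrib sum_distrib_left[symmetric] field_simps)
qed

section \<open>A pathwise oracle inequality\<close>

abbreviation band :: "nat \<Rightarrow> int set" where
  "band N \<equiv> {- int N..int N}"

text \<open>Frequency 0 is its own negative, so it fits neither of the one-sided sets to which the
  quadratic moment bound applies.\<close>

lemma sum_band_split:
  fixes h :: "int \<Rightarrow> real"
  shows "sum h (band N) = h 0 + sum h {1..int N} + sum h {- int N..-1}"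
proof -
  have "band N = insert 0 ({1..int N} \<union> {- int N..-1})" by auto
  then have "sum h (band N) = h 0 + sum h ({1..int N} \<union> {- int N..-1})" by simp
  also have "sum h ({1..int N} \<union> {- int N..-1}) = sum h {1..int N} + sum h {- int N..-1}"
    by (rule sum.union_disjoint) auto
  finally show ?thesis by simp
qed

lemma sum_band_diff:
  fixes h :: "int \<Rightarrow> 'c::ab_group_add"
  assumes "N \<le> N'"
  shows "sum h (band N') - sum h (band N) = sum h {k. int N < \<bar>k\<bar> \<and> \<bar>k\<bar> \<le> int N'}"
proof -
  have e: "band N' = band N \<union> {k. int N < \<bar>k\<bar> \<and> \<bar>k\<bar> \<le> int N'}" using assms by auto
  have f: "finite {k. int N < \<bar>k\<bar> \<and> \<bar>k\<bar> \<le> int N'}"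
    by (rule finite_subset[of _ "band N'"]) auto
  have "sum h (band N') = sum h (band N) + sum h {k. int N < \<bar>k\<bar> \<and> \<bar>k\<bar> \<le> int N'}"
    unfolding e by (rule sum.union_disjoint) (use f in auto)
  then show ?thesis by simp
qed

text \<open>Here \<open>w\<^sub>k\<close> is \<open>\<bar>\<gamma>\<^sub>k\<bar>\<^sup>-\<^sup>2\<close>, \<open>v\<close> is \<open>\<epsilon>\<^sup>2 / n\<close>, \<open>L\<close> is \<open>ln\<^sup>2 n / n\<close>, \<open>x\<^sub>k\<close> is \<open>\<bar>\<xi>\<^sub>k\<bar>\<^sup>2\<close> and \<open>T\<close> is the squared
  norm of \<open>\<theta>\<close>. No randomness is involved.\<close>

locale cutoff_path =
  fixes w b x :: "int \<Rightarrow> real" and \<theta> r s :: "int \<Rightarrow> complex" and A :: "nat \<Rightarrow> real"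
    and v L \<delta> \<kappa> T :: real and m N0 :: nat
  assumes w_pos: "\<And>k. w k > 0" and b_eq: "\<And>k. b k = L * w k" and L_pos: "L \<ge> 0"
    and b_le: "\<And>k. k \<in> band m \<Longrightarrow> b k \<le> 1"
    and v_pos: "v > 0" and \<delta>: "0 < \<delta>" "\<delta> \<le> 1" and \<kappa>: "0 < \<kappa>" "\<kappa> \<le> 1"
    and noise: "\<And>k. (cmod (s k))\<^sup>2 = v * w k * x k" and x_nonneg: "\<And>k. x k \<ge> 0"
    and tail: "\<And>N. A N + (\<Sum>k\<in>band N. (cmod (\<theta> k))\<^sup>2) = T" "\<And>N. A N \<ge> 0"
    and N0: "N0 \<le> m"
begin

definition \<eta> :: "int \<Rightarrow> complex" where "\<eta> k = \<theta> k * r k + s k"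

definition risk :: "nat \<Rightarrow> real" where
  "risk N = A N + v * (\<Sum>k\<in>band N. w k) + (\<Sum>k\<in>band N. b k * (cmod (\<theta> k))\<^sup>2)"

definition crit :: "nat \<Rightarrow> real" where
  "crit N = (\<Sum>k\<in>band N. - (1 - b k) * ((cmod (\<theta> k + \<eta> k))\<^sup>2 - v * w k) + v * w k)"

definition loss :: "nat \<Rightarrow> real" where
  "loss N = A N + (\<Sum>k\<in>band N. (cmod (\<eta> k))\<^sup>2)"

text \<open>Equals \<open>1 + (1 + \<kappa>) * (1 - b k)\<close>: the 1 comes from the loss, the
  rest from the squared error inside the criterion.\<close>

definition wt :: "int \<Rightarrow> real" where "wt k = 2 - b k + \<kappa> * (1 - b k)"

text \<open>The cross term of \<open>(cmod (\<theta> k + z))\<^sup>2\<close>, with its weight in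
  \<open>1 + \<kappa>\<close> times the criterion.\<close>

definition lin :: "int \<Rightarrow> complex \<Rightarrow> real" where
  "lin k z = (1 + \<kappa>) * ((1 - b k) * (2 * Re (cnj (\<theta> k) * z)))"

text \<open>The factor \<open>10 / \<delta>\<close> collects \<open>4 / \<delta>\<close> from cross
  terms and \<open>6 / \<delta>\<close> from squares. Positive parts are taken frequency by
  frequency, so the sum over \<open>band m\<close> dominates every smaller cut-off.\<close>

definition shift_excess :: real where
  "shift_excess = (\<Sum>k\<in>band m. (cmod (\<theta> k))\<^sup>2 * max 0 (10 / \<delta> * (cmod (r k))\<^sup>2 - \<delta> * b k))"

definition amp :: "int \<Rightarrow> real" where "amp k = wt k * (1 + \<delta>) * w k"

definition quad_excess :: "int set \<Rightarrow> real" where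
  "quad_excess K = max 0 ((\<Sum>k\<in>K. amp k * (x k - 1)) - \<delta> * (\<Sum>k\<in>K. w k))"

text \<open>Frequency 0 is kept uncentred and contributes a single bounded expectation. For the
  others the sum over \<open>N\<close> stands in for the supremum over cut-offs.\<close>

definition noise_excess :: real where
  "noise_excess = v * (amp 0 * x 0 + (\<Sum>N=1..m. quad_excess {1..int N} + quad_excess {- int N..-1}))"

definition lin_noise :: "nat \<Rightarrow> real" where
  "lin_noise N = (\<Sum>k\<in>band N. lin k (s k)) - (\<Sum>k\<in>band N0. lin k (s k))"

text \<open>\<open>lin_noise N\<close> lives on the frequencies between \<open>N\<close> and
  \<open>N0\<close>. Its variance is of order \<open>v\<close> times the largest weight times
  \<open>A (min N N0)\<close>; under polynomial decay the product of the two penalties exceeds this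
  by a factor proportional to the larger cut-off.\<close>

definition lin_excess :: "nat \<Rightarrow> real" where
  "lin_excess N = max 0 (lin_noise N - \<delta> * A (min N N0) - \<delta> * v * (\<Sum>k\<in>band (max N N0). w k))"

text \<open>The noise at the deterministic cut-off: it needs no penalty because its expectation is
  zero.\<close>

definition centred :: real where
  "centred = (\<Sum>k\<in>band N0. (1 + \<kappa>) * (1 - b k) * (1 - \<delta>) * v * w k * (x k - 1))"

lemma b_nonneg: "b k \<ge> 0"
  using b_eq[of k] L_pos w_pos[of k] by simp

lemma wt_bounds: "k \<in> band m \<Longrightarrow> 0 \<le> wt k" "k \<in> band m \<Longrightarrow> wt k \<le> 3"
proof -
  assume k: "k \<in> band m"
  have "0 \<le> \<kappa> * (1 - b k)" using \<kappa> b_le[OF k] by simp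
  then show "0 \<le> wt k" using b_le[OF k] by (simp add: wt_def)
  have "\<kappa> * (1 - b k) \<le> 1 * 1" using \<kappa> b_le[OF k] b_nonneg[of k] by (intro mult_mono) auto
  then show "wt k \<le> 3" using b_nonneg[of k] by (simp add: wt_def)
qed

lemma factor_bounds: "k \<in> band m \<Longrightarrow> 0 \<le> (1 + \<kappa>) * (1 - b k)" "k \<in> band m \<Longrightarrow> (1 + \<kappa>) * (1 - b k) \<le> 2"
proof -
  assume k: "k \<in> band m"
  show "0 \<le> (1 + \<kappa>) * (1 - b k)" using \<kappa> b_le[OF k] by simp
  have "(1 + \<kappa>) * (1 - b k) \<le> 2 * 1"
    using \<kappa> b_le[OF k] b_nonneg[of k] by (intro mult_mono) auto
  then show "(1 + \<kappa>) * (1 - b k) \<le> 2" by simp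
qed

lemma amp_bounds: "k \<in> band m \<Longrightarrow> 0 \<le> amp k" "k \<in> band m \<Longrightarrow> amp k \<le> 6 * w k"
proof -
  assume k: "k \<in> band m"
  show "0 \<le> amp k" using wt_bounds[OF k] \<delta> w_pos[of k] by (simp add: amp_def)
  have "wt k * (1 + \<delta>) \<le> 3 * 2" using wt_bounds[OF k] \<delta> by (intro mult_mono) auto
  then show "amp k \<le> 6 * w k" using w_pos[of k] by (simp add: amp_def mult_right_mono)
qed

text \<open>Adding \<open>T\<close> turns the criterion into an empirical version of the risk.
  Replacing \<open>A N\<close> by \<open>T\<close> minus a band sum makes everything a sum over one
  band; the leftover \<open>- b k * (cmod (\<theta> k))\<^sup>2\<close> has a favourable
  sign.\<close>

lemma loss_identity:
  "loss N + \<kappa> * risk N = (1 + \<kappa>) * (crit N + T) +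
     (\<Sum>k\<in>band N. lin k (\<eta> k) + wt k * ((cmod (\<eta> k))\<^sup>2 - v * w k) - b k * (cmod (\<theta> k))\<^sup>2)"
proof -
  have A: "A N = T - (\<Sum>k\<in>band N. (cmod (\<theta> k))\<^sup>2)" using tail(1)[of N] by simp
  have sq: "(cmod (\<theta> k + \<eta> k))\<^sup>2 = (cmod (\<theta> k))\<^sup>2 + 2 * Re (cnj (\<theta> k) * \<eta> k) + (cmod (\<eta> k))\<^sup>2" for k
    unfolding cmod_power2 by (simp add: power2_eq_square algebra_simps)
  define c where "c k = - (1 - b k) * ((cmod (\<theta> k + \<eta> k))\<^sup>2 - v * w k) + v * w k" for k
  define d where "d k = lin k (\<eta> k) + wt k * ((cmod (\<eta> k))\<^sup>2 - v * w k) - b k * (cmod (\<theta> k))\<^sup>2" for k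
  have "loss N + \<kappa> * risk N = (1 + \<kappa>) * T + (\<Sum>k\<in>band N. (cmod (\<eta> k))\<^sup>2 - (1 + \<kappa>) * (cmod (\<theta> k))\<^sup>2 + \<kappa> * (v * w k) + \<kappa> * (b k * (cmod (\<theta> k))\<^sup>2))"
    unfolding loss_def risk_def A sum.distrib sum_subtractf sum_distrib_left[symmetric] by (simp add: algebra_simps)
  also have "(\<Sum>k\<in>band N. (cmod (\<eta> k))\<^sup>2 - (1 + \<kappa>) * (cmod (\<theta> k))\<^sup>2 + \<kappa> * (v * w k) + \<kappa> * (b k * (cmod (\<theta> k))\<^sup>2)) =
    (\<Sum>k\<in>band N. (1 + \<kappa>) * c k + d k)"
    unfolding c_def d_def sq lin_def wt_def by (intro sum.cong refl) (simp add: algebra_simps)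
  also have "(1 + \<kappa>) * T + \<dots> = (1 + \<kappa>) * (sum c (band N) + T) + sum d (band N)"
    unfolding sum.distrib sum_distrib_left[symmetric] by (simp add: distrib_left)
  finally show ?thesis unfolding crit_def c_def d_def .
qed

lemma crit_identity:
  "(1 + \<kappa>) * (crit N0 + T) = (1 + \<kappa>) * risk N0
     - (\<Sum>k\<in>band N0. lin k (\<eta> k) + (1 + \<kappa>) * (1 - b k) * ((cmod (\<eta> k))\<^sup>2 - v * w k))"
proof -
  have A: "A N0 = T - (\<Sum>k\<in>band N0. (cmod (\<theta> k))\<^sup>2)" using tail(1)[of N0] by simp
  have sq: "(cmod (\<theta> k + \<eta> k))\<^sup>2 = (cmod (\<theta> k))\<^sup>2 + 2 * Re (cnj (\<theta> k) * \<eta> k) + (cmod (\<eta> k))\<^sup>2" for k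
    unfolding cmod_power2 by (simp add: power2_eq_square algebra_simps)
  define c where "c k = - (1 - b k) * ((cmod (\<theta> k + \<eta> k))\<^sup>2 - v * w k) + v * w k" for k
  define d where "d k = lin k (\<eta> k) + (1 + \<kappa>) * (1 - b k) * ((cmod (\<eta> k))\<^sup>2 - v * w k)" for k
  have "(1 + \<kappa>) * (sum c (band N0) + T) = (1 + \<kappa>) * T + (\<Sum>k\<in>band N0. (1 + \<kappa>) * c k)"
    unfolding sum_distrib_left[symmetric] by (simp add: distrib_left)
  also have "(\<Sum>k\<in>band N0. (1 + \<kappa>) * c k) =
    (\<Sum>k\<in>band N0. (1 + \<kappa>) * (v * w k) + (1 + \<kappa>) * (b k * (cmod (\<theta> k))\<^sup>2) - (1 + \<kappa>) * (cmod (\<theta> k))\<^sup>2 - d k)"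
    unfolding c_def d_def sq lin_def by (intro sum.cong refl) (simp add: algebra_simps)
  also have "(1 + \<kappa>) * T + \<dots> = (1 + \<kappa>) * risk N0 - sum d (band N0)"
    unfolding risk_def A sum.distrib sum_subtractf sum_distrib_left[symmetric] by (simp add: algebra_simps)
  finally show ?thesis unfolding crit_def c_def d_def .
qed

text \<open>The weights are unequal on purpose: the noise must keep a factor close to 1, since only
  its centred part is small, whereas the shift part may be inflated by
  \<open>1 / \<delta>\<close>.\<close>

lemma \<eta>_upper: "(cmod (\<eta> k))\<^sup>2 \<le> (1 + 1 / \<delta>) * ((cmod (\<theta> k))\<^sup>2 * (cmod (r k))\<^sup>2) + (1 + \<delta>) * (v * w k * x k)"
  using sq_norm_add_le[OF \<delta>(1), of "s k" "\<theta> k * r k"]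
  by (simp add: \<eta>_def noise norm_mult power_mult_distrib add.commute)

lemma \<eta>_lower: "(cmod (\<eta> k))\<^sup>2 \<ge> (1 - \<delta>) * (v * w k * x k) - 1 / \<delta> * ((cmod (\<theta> k))\<^sup>2 * (cmod (r k))\<^sup>2)"
proof -
  let ?a = "cmod (\<theta> k * r k)" and ?b = "cmod (s k)"
  have "\<bar>?b - ?a\<bar> \<le> cmod (\<eta> k)"
    using norm_triangle_ineq3[of "s k" "- (\<theta> k * r k)"] by (simp add: \<eta>_def add.commute)
  then have "(?b - ?a)\<^sup>2 \<le> (cmod (\<eta> k))\<^sup>2"
    by (metis abs_ge_zero power2_abs power_mono)
  moreover have "(?b - ?a)\<^sup>2 = ?b\<^sup>2 - 2 * ?a * ?b + ?a\<^sup>2" by (simp add: power2_eq_square algebra_simps)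
  moreover have "0 \<le> (\<delta> * ?b - ?a)\<^sup>2 / \<delta>" using \<delta> by simp
  then have "0 \<le> \<delta> * ?b\<^sup>2 - 2 * ?a * ?b + ?a\<^sup>2 / \<delta>"
    using \<delta> by (simp add: power2_eq_square field_simps)
  moreover have "0 \<le> ?a\<^sup>2" by simp
  moreover have "(1 - \<delta>) * ?b\<^sup>2 = ?b\<^sup>2 - \<delta> * ?b\<^sup>2" by (simp add: algebra_simps)
  ultimately have "(1 - \<delta>) * ?b\<^sup>2 - ?a\<^sup>2 / \<delta> \<le> (cmod (\<eta> k))\<^sup>2" by linarith
  then show ?thesis by (simp add: noise norm_mult power_mult_distrib)
qed

lemma shift_bound:
  assumes "N \<le> m"
  shows "10 / \<delta> * (\<Sum>k\<in>band N. (cmod (\<theta> k))\<^sup>2 * (cmod (r k))\<^sup>2) \<le> \<delta> * (\<Sum>k\<in>band N. b k * (cmod (\<theta> k))\<^sup>2) + shift_excess"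
proof -
  let ?E = "\<lambda>k. (cmod (\<theta> k))\<^sup>2 * max 0 (10 / \<delta> * (cmod (r k))\<^sup>2 - \<delta> * b k)"
  have "10 / \<delta> * (\<Sum>k\<in>band N. (cmod (\<theta> k))\<^sup>2 * (cmod (r k))\<^sup>2) \<le> (\<Sum>k\<in>band N. \<delta> * (b k * (cmod (\<theta> k))\<^sup>2) + ?E k)"
    unfolding sum_distrib_left
  proof (intro sum_mono)
    fix k
    have "(cmod (\<theta> k))\<^sup>2 * (10 / \<delta> * (cmod (r k))\<^sup>2) \<le> (cmod (\<theta> k))\<^sup>2 * (\<delta> * b k + max 0 (10 / \<delta> * (cmod (r k))\<^sup>2 - \<delta> * b k))"
      by (intro mult_left_mono) auto
    then show "10 / \<delta> * ((cmod (\<theta> k))\<^sup>2 * (cmod (r k))\<^sup>2) \<le> \<delta> * (b k * (cmod (\<theta> k))\<^sup>2) + ?E k"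
      by (simp only: distrib_left) (simp add: mult_ac)
  qed
  also have "\<dots> = \<delta> * (\<Sum>k\<in>band N. b k * (cmod (\<theta> k))\<^sup>2) + (\<Sum>k\<in>band N. ?E k)"
    by (simp add: sum.distrib sum_distrib_left)
  also have "(\<Sum>k\<in>band N. ?E k) \<le> shift_excess"
    unfolding shift_excess_def using assms by (intro sum_mono2) auto
  finally show ?thesis by simp
qed

lemma noise_bound:
  assumes N: "N \<le> m"
  shows "v * (\<Sum>k\<in>band N. amp k * (x k - 1)) \<le> \<delta> * v * (\<Sum>k\<in>band N. w k) + noise_excess"
proof -
  have amp0: "amp 0 \<ge> 0" using amp_bounds(1)[of 0] by simp
  let ?q = "\<lambda>N. quad_excess {1..int N} + quad_excess {- int N..-1}"
  have q0: "?q N \<ge> 0" for N by (simp add: quad_excess_def)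
  have a: "(\<Sum>k\<in>K. amp k * (x k - 1)) \<le> \<delta> * (\<Sum>k\<in>K. w k) + quad_excess K" for K
    by (simp add: quad_excess_def)
  have "(\<Sum>k\<in>band N. amp k * (x k - 1)) = amp 0 * (x 0 - 1) + (\<Sum>k\<in>{1..int N}. amp k * (x k - 1)) + (\<Sum>k\<in>{- int N..-1}. amp k * (x k - 1))"
    by (rule sum_band_split)
  also have "\<dots> \<le> amp 0 * x 0 + (\<delta> * (\<Sum>k\<in>{1..int N}. w k) + quad_excess {1..int N}) + (\<delta> * (\<Sum>k\<in>{- int N..-1}. w k) + quad_excess {- int N..-1})"
    using amp0 by (intro add_mono a) (simp add: algebra_simps)
  also have "\<dots> = amp 0 * x 0 + \<delta> * ((\<Sum>k\<in>band N. w k) - w 0) + ?q N"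
    unfolding sum_band_split[of w] by (simp add: algebra_simps)
  also have "\<dots> \<le> amp 0 * x 0 + \<delta> * (\<Sum>k\<in>band N. w k) + (\<Sum>N=1..m. ?q N)"
  proof -
    have "?q N \<le> (\<Sum>N=1..m. ?q N)"
    \<comment> \<open>At \<open>N = 0\<close> both one-sided sets are empty, so the missing index
      contributes nothing.\<close>
    proof (cases "N = 0")
      case True
      then show ?thesis using q0 by (auto simp: quad_excess_def intro!: sum_nonneg)
    next
      case False
      then show ?thesis using N q0 by (intro member_le_sum) auto
    qed
    moreover have "\<delta> * w 0 \<ge> 0" using \<delta> w_pos[of 0] by simp
    ultimately show ?thesis by (simp add: right_diff_distrib)
  qed
  finally have "v * (\<Sum>k\<in>band N. amp k * (x k - 1)) \<le> v * (amp 0 * x 0 + \<delta> * (\<Sum>k\<in>band N. w k) + (\<Sum>N=1..m. ?q N))"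
    using v_pos by (intro mult_left_mono) auto
  then show ?thesis by (simp add: noise_excess_def algebra_simps)
qed

text \<open>The two sums differ only on the shell between the cut-offs, where the squared
  coefficients add up to at most the tail at the smaller one. That is why the term of order \<delta>
  is absorbed by \<open>A\<close>.\<close>

lemma lin_shift_bound:
  assumes N: "N \<le> m"
  shows "(\<Sum>k\<in>band N. lin k (\<theta> k * r k)) - (\<Sum>k\<in>band N0. lin k (\<theta> k * r k)) \<le>
    \<delta> * (A N + A N0) + 4 / \<delta> * (\<Sum>k\<in>band N. (cmod (\<theta> k))\<^sup>2 * (cmod (r k))\<^sup>2)
      + 4 / \<delta> * (\<Sum>k\<in>band N0. (cmod (\<theta> k))\<^sup>2 * (cmod (r k))\<^sup>2)"
proof -
  let ?h = "\<lambda>k. lin k (\<theta> k * r k)"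
  let ?\<rho> = "\<lambda>k. (cmod (\<theta> k))\<^sup>2 * (cmod (r k))\<^sup>2"
  have h: "\<bar>?h k\<bar> \<le> \<delta> * (cmod (\<theta> k))\<^sup>2 + 4 / \<delta> * ?\<rho> k" if k: "k \<in> band m" for k
  proof -
    have e: "Re (cnj (\<theta> k) * (\<theta> k * r k)) = (cmod (\<theta> k))\<^sup>2 * Re (r k)"
      unfolding cmod_power2 by (simp add: power2_eq_square algebra_simps)
    note f = factor_bounds[OF k]
    have "?h k = (1 + \<kappa>) * (1 - b k) * (2 * (cmod (\<theta> k))\<^sup>2 * Re (r k))"
      unfolding lin_def e by simp
    then have "\<bar>?h k\<bar> = \<bar>(1 + \<kappa>) * (1 - b k)\<bar> * \<bar>2 * (cmod (\<theta> k))\<^sup>2 * Re (r k)\<bar>"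
      by (simp only: abs_mult[of "(1 + \<kappa>) * (1 - b k)"])
    also have "\<dots> = (1 + \<kappa>) * (1 - b k) * (2 * (cmod (\<theta> k))\<^sup>2 * \<bar>Re (r k)\<bar>)"
      unfolding abs_of_nonneg[OF f(1)] by (simp add: abs_mult)
    also have "\<dots> \<le> 2 * (2 * (cmod (\<theta> k))\<^sup>2 * cmod (r k))"
      using f abs_Re_le_cmod[of "r k"] by (intro mult_mono) auto
    also have "\<dots> = (cmod (\<theta> k))\<^sup>2 * (4 * cmod (r k))" by simp
    also have "\<dots> \<le> (cmod (\<theta> k))\<^sup>2 * (\<delta> + 4 / \<delta> * (cmod (r k))\<^sup>2)"
    proof (rule mult_left_mono)
      \<comment> \<open>Arithmetic-geometric inequality; the factor 4 is the bound 2 on the weight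
        times the 2 of the cross term.\<close>
      have "0 \<le> (\<delta> - 2 * cmod (r k))\<^sup>2 / \<delta>" using \<delta> by simp
      also have "\<dots> = \<delta> + 4 / \<delta> * (cmod (r k))\<^sup>2 - 4 * cmod (r k)"
        using \<delta> by (simp add: power2_eq_square field_simps)
      finally show "4 * cmod (r k) \<le> \<delta> + 4 / \<delta> * (cmod (r k))\<^sup>2" by simp
    qed simp
    finally show ?thesis by (simp add: algebra_simps)
  qed
  have main: "\<bar>sum ?h (band N2) - sum ?h (band N1)\<bar> \<le> \<delta> * A N1 + 4 / \<delta> * sum ?\<rho> (band N2)"
    if "N1 \<le> N2" "N2 \<le> m" for N1 N2
  proof -
    let ?K = "{k. int N1 < \<bar>k\<bar> \<and> \<bar>k\<bar> \<le> int N2}"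
    have K: "?K \<subseteq> band N2" "?K \<subseteq> band m" using that by auto
    have "\<bar>sum ?h (band N2) - sum ?h (band N1)\<bar> \<le> (\<Sum>k\<in>?K. \<bar>?h k\<bar>)"
      unfolding sum_band_diff[OF that(1)] by (rule sum_abs)
    also have "\<dots> \<le> (\<Sum>k\<in>?K. \<delta> * (cmod (\<theta> k))\<^sup>2 + 4 / \<delta> * ?\<rho> k)"
      using K by (intro sum_mono h) auto
    also have "\<dots> = \<delta> * (\<Sum>k\<in>?K. (cmod (\<theta> k))\<^sup>2) + 4 / \<delta> * sum ?\<rho> ?K"
      by (simp add: sum.distrib sum_distrib_left)
    also have "(\<Sum>k\<in>?K. (cmod (\<theta> k))\<^sup>2) = A N1 - A N2"
      unfolding sum_band_diff[OF that(1), symmetric] using tail(1)[of N1] tail(1)[of N2] by simp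
    also have "\<delta> * (A N1 - A N2) + 4 / \<delta> * sum ?\<rho> ?K \<le> \<delta> * A N1 + 4 / \<delta> * sum ?\<rho> (band N2)"
      using \<delta> tail(2)[of N2] K by (intro add_mono mult_left_mono sum_mono2) auto
    finally show ?thesis .
  qed
  have nn: "0 \<le> 4 / \<delta> * sum ?\<rho> (band N)" "0 \<le> 4 / \<delta> * sum ?\<rho> (band N0)" "0 \<le> \<delta> * A N" "0 \<le> \<delta> * A N0"
    using \<delta> tail(2) by (intro mult_nonneg_nonneg sum_nonneg; simp)+
  show ?thesis
  proof (cases "N \<le> N0")
    case True
    show ?thesis using main[OF True N0] nn by (simp add: distrib_left)
  next
    case False
    then show ?thesis using main[of N0 N] N nn by (simp add: distrib_left)
  qed
qed

text \<open>At \<open>N0\<close> the difference vanishes identically. Excluding it from the sum also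
  ensures that the larger of the two cut-offs is at least 1, as the decay rates require.\<close>

lemma lin_noise_bound:
  assumes N: "N \<le> m"
  shows "lin_noise N \<le> \<delta> * (A N + A N0) + \<delta> * v * ((\<Sum>k\<in>band N. w k) + (\<Sum>k\<in>band N0. w k))
    + (\<Sum>N'\<in>{..m} - {N0}. lin_excess N')"
proof -
  have w0: "0 \<le> (\<Sum>k\<in>band N'. w k)" for N' by (intro sum_nonneg less_imp_le w_pos)
  have e0: "0 \<le> lin_excess N'" for N' by (simp add: lin_excess_def)
  have nn: "0 \<le> \<delta> * A N'" "0 \<le> \<delta> * v * (\<Sum>k\<in>band N'. w k)" for N'
    using \<delta> tail(2) v_pos w0 by auto
  show ?thesis
  proof (cases "N = N0")
    case True
    have "0 \<le> (\<Sum>N'\<in>{..m} - {N0}. lin_excess N')" using e0 by (intro sum_nonneg) auto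
    then show ?thesis using True nn[of N0] by (simp add: lin_noise_def distrib_left)
  next
    case False
    have "lin_noise N \<le> \<delta> * A (min N N0) + \<delta> * v * (\<Sum>k\<in>band (max N N0). w k) + lin_excess N"
      by (simp add: lin_excess_def)
    also have "lin_excess N \<le> (\<Sum>N'\<in>{..m} - {N0}. lin_excess N')"
      using False N e0 by (intro member_le_sum) auto
    also have "\<delta> * A (min N N0) \<le> \<delta> * (A N + A N0)"
      using nn(1)[of N] nn(1)[of N0] by (simp add: min_def distrib_left)
    also have "\<delta> * v * (\<Sum>k\<in>band (max N N0). w k) \<le> \<delta> * v * ((\<Sum>k\<in>band N. w k) + (\<Sum>k\<in>band N0. w k))"
      using nn(2)[of N] nn(2)[of N0] by (simp add: max_def distrib_left)
    finally show ?thesis by simp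
  qed
qed

text \<open>Every remainder is a multiple of one of the three parts of the risk or an excess. The
  largest multiple is \<open>5 * \<delta>\<close>, on the variance at \<open>N\<close>: 3 from the
  squares, 1 from the linear noise and 1 from the penalty in \<open>quad_excess\<close>.\<close>

lemma oracle_path:
  assumes N: "N \<le> m" and opt: "crit N \<le> crit N0"
  shows "loss N + \<kappa> * risk N \<le> (1 + \<kappa>) * risk N0 + 5 * \<delta> * (risk N + risk N0)
    + 2 * shift_excess + noise_excess + (\<Sum>N'\<in>{..m} - {N0}. lin_excess N') - centred"
proof -
  let ?\<rho> = "\<lambda>k. (cmod (\<theta> k))\<^sup>2 * (cmod (r k))\<^sup>2"
  let ?W = "\<lambda>N. \<Sum>k\<in>band N. w k"
  let ?X = "\<Sum>N'\<in>{..m} - {N0}. lin_excess N'"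
  have bm: "k \<in> band N' \<Longrightarrow> N' \<le> m \<Longrightarrow> k \<in> band m" for k N' by auto
  have \<rho>0: "0 \<le> sum ?\<rho> (band N')" for N' by (auto intro!: sum_nonneg)
  have q: "(\<Sum>k\<in>band N. wt k * ((cmod (\<eta> k))\<^sup>2 - v * w k)) \<le>
      6 / \<delta> * sum ?\<rho> (band N) + (v * (\<Sum>k\<in>band N. amp k * (x k - 1)) + 3 * \<delta> * v * ?W N)"
  proof -
    have "(\<Sum>k\<in>band N. wt k * ((cmod (\<eta> k))\<^sup>2 - v * w k)) \<le>
      (\<Sum>k\<in>band N. 6 / \<delta> * ?\<rho> k + (v * (amp k * (x k - 1)) + 3 * \<delta> * v * w k))"
    proof (intro sum_mono)
      fix k assume "k \<in> band N"
      then have k: "k \<in> band m" using bm N by blast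
      have "wt k * ((cmod (\<eta> k))\<^sup>2 - v * w k) \<le> wt k * ((1 + 1 / \<delta>) * ?\<rho> k + (1 + \<delta>) * (v * w k * x k) - v * w k)"
        using \<eta>_upper[of k] wt_bounds[OF k] by (intro mult_left_mono) auto
      also have "\<dots> = wt k * ((1 + 1 / \<delta>) * ?\<rho> k) + (v * (amp k * (x k - 1)) + wt k * (\<delta> * v * w k))"
        by (simp add: amp_def algebra_simps)
      also have "wt k * ((1 + 1 / \<delta>) * ?\<rho> k) \<le> 3 * ((2 / \<delta>) * ?\<rho> k)"
      proof -
        have "1 + 1 / \<delta> \<le> 2 / \<delta>" using \<delta> by (simp add: field_simps)
        then show ?thesis using wt_bounds[OF k] \<delta> by (intro mult_mono) auto
      qed
      also have "wt k * (\<delta> * v * w k) \<le> 3 * (\<delta> * v * w k)"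
        using wt_bounds[OF k] \<delta> v_pos w_pos[of k] by (intro mult_right_mono) auto
      finally show "wt k * ((cmod (\<eta> k))\<^sup>2 - v * w k) \<le> 6 / \<delta> * ?\<rho> k + (v * (amp k * (x k - 1)) + 3 * \<delta> * v * w k)"
        by simp
    qed
    then show ?thesis by (simp only: sum.distrib sum_distrib_left[symmetric])
  qed
  have t: "- (\<Sum>k\<in>band N0. (1 + \<kappa>) * (1 - b k) * ((cmod (\<eta> k))\<^sup>2 - v * w k)) \<le>
      2 / \<delta> * sum ?\<rho> (band N0) + (2 * \<delta> * v * ?W N0 - centred)"
  proof -
    have "(\<Sum>k\<in>band N0. - ((1 + \<kappa>) * (1 - b k) * ((cmod (\<eta> k))\<^sup>2 - v * w k))) \<le>
      (\<Sum>k\<in>band N0. 2 / \<delta> * ?\<rho> k + (2 * \<delta> * v * w k - (1 + \<kappa>) * (1 - b k) * (1 - \<delta>) * v * w k * (x k - 1)))"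
    proof (intro sum_mono)
      fix k assume "k \<in> band N0"
      then have k: "k \<in> band m" using bm N0 by blast
      let ?f = "(1 + \<kappa>) * (1 - b k)"
      note f = factor_bounds[OF k]
      have "?f * ((1 - \<delta>) * (v * w k * x k) - 1 / \<delta> * ?\<rho> k - v * w k) \<le> ?f * ((cmod (\<eta> k))\<^sup>2 - v * w k)"
        using \<eta>_lower[of k] f by (intro mult_left_mono) auto
      moreover have "?f * ((1 - \<delta>) * (v * w k * x k) - 1 / \<delta> * ?\<rho> k - v * w k) =
          ?f * (1 - \<delta>) * v * w k * (x k - 1) - ?f * (1 / \<delta> * ?\<rho> k) - ?f * (\<delta> * v * w k)"
        by (simp add: algebra_simps)
      moreover have "?f * (1 / \<delta> * ?\<rho> k) \<le> 2 * (1 / \<delta> * ?\<rho> k)"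
        using f \<delta> by (intro mult_right_mono) auto
      moreover have "?f * (\<delta> * v * w k) \<le> 2 * (\<delta> * v * w k)"
        using f \<delta> v_pos w_pos[of k] by (intro mult_right_mono) auto
      ultimately show "- (?f * ((cmod (\<eta> k))\<^sup>2 - v * w k)) \<le>
          2 / \<delta> * ?\<rho> k + (2 * \<delta> * v * w k - ?f * (1 - \<delta>) * v * w k * (x k - 1))"
        by simp
    qed
    then show ?thesis by (simp only: sum.distrib sum_subtractf sum_negf sum_distrib_left[symmetric] centred_def)
  qed
  have lin_add: "lin k (\<eta> k) = lin k (\<theta> k * r k) + lin k (s k)" for k
    by (simp add: lin_def \<eta>_def algebra_simps)
  have linpart: "(\<Sum>k\<in>band N. lin k (\<eta> k)) - (\<Sum>k\<in>band N0. lin k (\<eta> k)) =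
      ((\<Sum>k\<in>band N. lin k (\<theta> k * r k)) - (\<Sum>k\<in>band N0. lin k (\<theta> k * r k))) + lin_noise N"
    unfolding lin_add by (simp add: sum.distrib lin_noise_def)
  have w0: "0 \<le> (\<Sum>k\<in>band N'. w k)" for N' by (intro sum_nonneg less_imp_le w_pos)
  have bq: "0 \<le> (\<Sum>k\<in>band N'. b k * (cmod (\<theta> k))\<^sup>2)" for N'
    using b_nonneg by (intro sum_nonneg) auto
  have "loss N + \<kappa> * risk N \<le> (1 + \<kappa>) * (crit N0 + T) +
     (\<Sum>k\<in>band N. lin k (\<eta> k) + wt k * ((cmod (\<eta> k))\<^sup>2 - v * w k) - b k * (cmod (\<theta> k))\<^sup>2)"
    unfolding loss_identity[of N] using opt \<kappa> by (intro add_right_mono mult_left_mono) auto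
  also have "\<dots> = (1 + \<kappa>) * risk N0 + ((\<Sum>k\<in>band N. lin k (\<eta> k)) - (\<Sum>k\<in>band N0. lin k (\<eta> k)))
      + (\<Sum>k\<in>band N. wt k * ((cmod (\<eta> k))\<^sup>2 - v * w k))
      + - (\<Sum>k\<in>band N0. (1 + \<kappa>) * (1 - b k) * ((cmod (\<eta> k))\<^sup>2 - v * w k)) - (\<Sum>k\<in>band N. b k * (cmod (\<theta> k))\<^sup>2)"
    unfolding crit_identity by (simp add: sum.distrib sum_subtractf)
  also have "\<dots> \<le> (1 + \<kappa>) * risk N0
      + ((\<delta> * (A N + A N0) + 4 / \<delta> * sum ?\<rho> (band N) + 4 / \<delta> * sum ?\<rho> (band N0))
        + (\<delta> * (A N + A N0) + \<delta> * v * (?W N + ?W N0) + ?X))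
      + (6 / \<delta> * sum ?\<rho> (band N) + (v * (\<Sum>k\<in>band N. amp k * (x k - 1)) + 3 * \<delta> * v * ?W N))
      + (2 / \<delta> * sum ?\<rho> (band N0) + (2 * \<delta> * v * ?W N0 - centred)) - 0"
    unfolding linpart
    by (intro add_mono diff_mono order_refl lin_shift_bound[OF N] lin_noise_bound[OF N] q t bq)
  also have "\<dots> \<le> (1 + \<kappa>) * risk N0
      + 2 * \<delta> * (A N + A N0) + 10 / \<delta> * sum ?\<rho> (band N) + 10 / \<delta> * sum ?\<rho> (band N0)
      + v * (\<Sum>k\<in>band N. amp k * (x k - 1)) + 4 * \<delta> * v * ?W N + 3 * \<delta> * v * ?W N0 + ?X - centred"
  proof -
    define p where "p N' = sum ?\<rho> (band N') / \<delta>" for N'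
    have c: "a / \<delta> * sum ?\<rho> (band N') = a * p N'" for a N' by (simp add: p_def)
    \<comment> \<open>At \<open>N0\<close> the shift terms add up to \<open>6 / \<delta>\<close>
      only; they are rounded up so that \<open>shift_bound\<close> serves both cut-offs.\<close>
    have "0 \<le> p N0" using \<delta> \<rho>0[of N0] by (simp add: p_def)
    then show ?thesis unfolding c by (simp add: algebra_simps)
  qed
  also have "\<dots> \<le> (1 + \<kappa>) * risk N0 + 2 * \<delta> * (A N + A N0)
      + (\<delta> * (\<Sum>k\<in>band N. b k * (cmod (\<theta> k))\<^sup>2) + shift_excess) + (\<delta> * (\<Sum>k\<in>band N0. b k * (cmod (\<theta> k))\<^sup>2) + shift_excess)
      + (\<delta> * v * ?W N + noise_excess) + 4 * \<delta> * v * ?W N + 3 * \<delta> * v * ?W N0 + ?X - centred"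
    by (intro add_mono diff_mono order_refl shift_bound noise_bound N N0)
  also have "\<dots> \<le> (1 + \<kappa>) * risk N0 + 5 * \<delta> * (risk N + risk N0) + 2 * shift_excess + noise_excess + ?X - centred"
  proof -
    have "0 \<le> \<delta> * A N'" "0 \<le> \<delta> * v * ?W N'" "0 \<le> \<delta> * (\<Sum>k\<in>band N'. b k * (cmod (\<theta> k))\<^sup>2)" for N'
      using \<delta> tail(2) v_pos bq w0 by (auto intro!: mult_nonneg_nonneg)
    note n1 = this[of N] and n2 = this[of N0]
    have e: "5 * \<delta> * (risk N + risk N0) = 5 * (\<delta> * A N) + 5 * (\<delta> * v * ?W N) + 5 * (\<delta> * (\<Sum>k\<in>band N. b k * (cmod (\<theta> k))\<^sup>2))
      + 5 * (\<delta> * A N0) + 5 * (\<delta> * v * ?W N0) + 5 * (\<delta> * (\<Sum>k\<in>band N0. b k * (cmod (\<theta> k))\<^sup>2))"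
      unfolding risk_def by (simp add: algebra_simps)
    show ?thesis unfolding e using n1 n2 by (simp add: distrib_left mult.assoc)
  qed
  finally show ?thesis .
qed

end

section \<open>The weights under polynomial decay\<close>

lemma summable_powr_exp:
  fixes a c :: real
  assumes "c > 0"
  shows "summable (\<lambda>P. real P * (real P powr a * exp (- c * real P)))"
proof (rule summable_comparison_test_bigo)
  show "summable (\<lambda>P. norm (1 / real P ^ 2))"
    using inverse_power_summable[of 2, where 'a = real] by (simp add: inverse_eq_divide)
  show "(\<lambda>P. real P * (real P powr a * exp (- c * real P))) \<in> O(\<lambda>P. 1 / real P ^ 2)"
    using assms by real_asymp
qed

text \<open>With \<open>y\<close> the fourth root of \<open>n\<close>,
  \<open>ln n = 4 * ln y < 4 * (y - 1) \<le> y\<^sup>2\<close>. It keeps frequency 0 out of the set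
  that defines \<open>m_zero\<close>.\<close>

lemma ln_square_less:
  assumes "n \<ge> (2::nat)"
  shows "(ln (real n))\<^sup>2 / real n < 1"
proof -
  define y where "y = sqrt (sqrt (real n))"
  have y: "y > 1" "y ^ 4 = real n"
  proof -
    show "y > 1" using assms by (simp add: y_def)
    have "y ^ 4 = (y\<^sup>2)\<^sup>2" by (simp flip: power_mult)
    also have "y\<^sup>2 = sqrt (real n)" by (simp add: y_def)
    finally show "y ^ 4 = real n" by simp
  qed
  have "ln (real n) = 4 * ln y" using y(1) ln_realpow[of y 4] unfolding y(2) by simp
  also have "\<dots> < 4 * (y - 1)" using ln_add_one_self_less_self[of "y - 1"] y(1) by simp
  also have "\<dots> \<le> y\<^sup>2" using zero_le_power2[of "y - 2"] by (simp add: power2_eq_square algebra_simps)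
  finally have "ln (real n) < y\<^sup>2" .
  moreover have "0 \<le> ln (real n)" using assms by simp
  ultimately have "(ln (real n))\<^sup>2 < (y\<^sup>2)\<^sup>2" by (intro power_strict_mono) auto
  also have "\<dots> = real n" using y(2) by (simp flip: power_mult)
  finally show ?thesis using assms by simp
qed

locale shift_density =
  fixes g :: "real \<Rightarrow> real" and \<beta> C_min C_max :: real
  assumes g_density: "prob_density g"
    and nonzero: "\<And>k. shift_coeff g k \<noteq> 0"
    and \<beta>: "\<beta> \<ge> 0" and C: "C_max \<ge> C_min" "C_min > 0"
    and decay_lower: "\<And>k. k \<noteq> 0 \<Longrightarrow> C_min * \<bar>real_of_int k\<bar> powr (- \<beta>) \<le> cmod (shift_coeff g k)"
    and decay_upper: "\<And>k. k \<noteq> 0 \<Longrightarrow> cmod (shift_coeff g k) \<le> C_max * \<bar>real_of_int k\<bar> powr (- \<beta>)"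
begin

definition w :: "int \<Rightarrow> real" where "w k = 1 / (cmod (shift_coeff g k))\<^sup>2"

text \<open>\<open>c1\<close> bounds single weights above and \<open>c3\<close> bounds one-sided
  sums of weights below. In \<open>c3\<close>, the factor 2 reflects that half of the frequencies
  are used, the power of 2 that these are at least \<open>P / 2\<close>.\<close>

definition c1 :: real where "c1 = 1 / C_min\<^sup>2"
definition c3 :: real where "c3 = 1 / (C_max\<^sup>2 * 2 * 2 powr (2 * \<beta>))"
definition B :: "nat \<Rightarrow> real" where "B P = real P powr (2 * \<beta>)"

lemma w_pos: "w k > 0" using nonzero by (simp add: w_def)
lemma c1_pos: "c1 > 0" using C by (simp add: c1_def)
lemma c3_pos: "c3 > 0" using C by (auto simp: c3_def intro!: mult_pos_pos)
lemma B_pos: "P \<ge> 1 \<Longrightarrow> B P > 0" by (simp add: B_def)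

lemma shift_coeff_uminus: "shift_coeff g (- k) = cnj (shift_coeff g k)"
proof -
  have "shift_coeff g (- k) = (\<integral>x. cnj (fourier_char k x * of_real (g x)) \<partial>lborel)"
    unfolding shift_coeff_def by (intro Bochner_Integration.integral_cong refl) (simp add: cnj_fourier_char)
  also have "\<dots> = cnj (shift_coeff g k)"
    unfolding shift_coeff_def by (rule Bochner_Integration.integral_cnj)
  finally show ?thesis .
qed

lemma w_uminus: "w (- k) = w k" by (simp add: w_def shift_coeff_uminus)

lemma shift_coeff_0: "shift_coeff g 0 = 1"
proof -
  have [measurable]: "g \<in> borel_measurable borel" and g0: "\<And>x. g x \<ge> 0" and g1: "(\<integral>\<^sup>+x. ennreal (g x) \<partial>lborel) = 1"
    using g_density by (auto simp: prob_density_def)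
  have gi: "integrable lborel g" by (rule integrableI_nonneg) (auto simp: g0 g1)
  have "integral\<^sup>L lborel g = 1" using g1 nn_integral_eq_integral[OF gi] g0 by simp
  then show ?thesis by (simp add: shift_coeff_def)
qed

lemma w_powr_bounds:
  assumes "k \<noteq> 0"
  shows "w k \<le> c1 * \<bar>real_of_int k\<bar> powr (2 * \<beta>)" "\<bar>real_of_int k\<bar> powr (2 * \<beta>) / C_max\<^sup>2 \<le> w k"
proof -
  let ?x = "\<bar>real_of_int k\<bar>"
  have x: "?x > 0" using assms by simp
  have p: "(?x powr (- \<beta>))\<^sup>2 = 1 / ?x powr (2 * \<beta>)"
    using x by (simp add: powr_minus power2_eq_square field_simps flip: powr_add)
  have g: "cmod (shift_coeff g k) > 0" using nonzero by simp
  have "(C_min * ?x powr (- \<beta>))\<^sup>2 \<le> (cmod (shift_coeff g k))\<^sup>2"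
    using decay_lower[OF assms] C by (intro power_mono) auto
  then have l: "C_min\<^sup>2 / ?x powr (2 * \<beta>) \<le> (cmod (shift_coeff g k))\<^sup>2" by (simp add: power_mult_distrib p)
  have "w k \<le> 1 / (C_min\<^sup>2 / ?x powr (2 * \<beta>))"
    unfolding w_def using l C x g by (intro divide_left_mono) (auto intro!: mult_pos_pos divide_pos_pos)
  then show "w k \<le> c1 * ?x powr (2 * \<beta>)" by (simp add: c1_def)
  have "(cmod (shift_coeff g k))\<^sup>2 \<le> (C_max * ?x powr (- \<beta>))\<^sup>2"
    using decay_upper[OF assms] by (intro power_mono) auto
  then have u: "(cmod (shift_coeff g k))\<^sup>2 \<le> C_max\<^sup>2 / ?x powr (2 * \<beta>)" by (simp add: power_mult_distrib p)
  have "1 / (C_max\<^sup>2 / ?x powr (2 * \<beta>)) \<le> w k"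
    unfolding w_def using u C x g by (intro divide_left_mono) (auto intro!: mult_pos_pos divide_pos_pos)
  then show "?x powr (2 * \<beta>) / C_max\<^sup>2 \<le> w k" by simp
qed

lemma w_le: "k \<noteq> 0 \<Longrightarrow> \<bar>k\<bar> \<le> int P \<Longrightarrow> w k \<le> c1 * B P"
proof -
  assume k: "k \<noteq> 0" "\<bar>k\<bar> \<le> int P"
  have "\<bar>real_of_int k\<bar> powr (2 * \<beta>) \<le> B P"
    unfolding B_def using k \<beta> by (intro powr_mono2) linarith+
  then show ?thesis using w_powr_bounds(1)[OF k(1)] c1_pos
    by (meson less_imp_le mult_left_mono order_trans)
qed

text \<open>The upper half of the frequencies already gives the order \<open>P * B P\<close>.
  Compared with the bound \<open>c1 * B P\<close> on single weights, this gains the factor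
  \<open>P\<close> behind the exponential decay.\<close>

lemma w_sum_ge_pos:
  assumes P: "P \<ge> 1"
  shows "c3 * real P * B P \<le> (\<Sum>k\<in>{1..int P}. w k)"
proof -
  define q where "q = (P + 1) div 2"
  have q: "1 \<le> q" "q \<le> P" "P \<le> 2 * q" "2 * q \<le> P + 1" using P by (auto simp: q_def)
  let ?K = "{int q..int P}"
  have "c3 * real P * B P = (real P / 2) * ((B P / 2 powr (2 * \<beta>)) / C_max\<^sup>2)"
    by (simp add: c3_def)
  also have "\<dots> \<le> real (card ?K) * ((B P / 2 powr (2 * \<beta>)) / C_max\<^sup>2)"
  proof (intro mult_right_mono)
    have "real (card ?K) = real P - real q + 1" using q by simp
    then show "real P / 2 \<le> real (card ?K)" using q(4) by linarith
  qed (simp add: B_def)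
  also have "\<dots> = (\<Sum>k\<in>?K. (B P / 2 powr (2 * \<beta>)) / C_max\<^sup>2)" by simp
  also have "\<dots> \<le> (\<Sum>k\<in>?K. w k)"
  proof (intro sum_mono)
    fix k assume "k \<in> ?K"
    then have k: "k \<noteq> 0" "real P / 2 \<le> \<bar>real_of_int k\<bar>" using q by auto
    have "B P / 2 powr (2 * \<beta>) = (real P / 2) powr (2 * \<beta>)" by (simp add: B_def powr_divide)
    also have "\<dots> \<le> \<bar>real_of_int k\<bar> powr (2 * \<beta>)" using k \<beta> by (intro powr_mono2) auto
    finally have "(B P / 2 powr (2 * \<beta>)) / C_max\<^sup>2 \<le> \<bar>real_of_int k\<bar> powr (2 * \<beta>) / C_max\<^sup>2"
      by (intro divide_right_mono) auto
    then show "(B P / 2 powr (2 * \<beta>)) / C_max\<^sup>2 \<le> w k" using w_powr_bounds(2)[OF k(1)] by simp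
  qed
  also have "\<dots> \<le> (\<Sum>k\<in>{1..int P}. w k)"
    using q by (intro sum_mono2) (auto intro: less_imp_le w_pos)
  finally show ?thesis .
qed

lemma w_sum_ge_neg:
  assumes P: "P \<ge> 1"
  shows "c3 * real P * B P \<le> (\<Sum>k\<in>{- int P..-1}. w k)"
proof -
  have "(\<Sum>k\<in>{- int P..-1}. w k) = (\<Sum>k\<in>uminus ` {1..int P}. w k)" by simp
  also have "\<dots> = (\<Sum>k\<in>{1..int P}. w k)" by (subst sum.reindex) (auto simp: w_uminus)
  finally show ?thesis using w_sum_ge_pos[OF P] by simp
qed

lemma w_sum_ge_band: "P \<ge> 1 \<Longrightarrow> c3 * real P * B P \<le> (\<Sum>k\<in>band P. w k)"
  unfolding sum_band_split[of w]
  using w_sum_ge_pos[of P] w_pos[of 0] sum_nonneg[of "{- int P..-1}" w, OF less_imp_le[OF w_pos]] by linarith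

text \<open>\<open>G d P\<close> bounds the excess of the noise over the penalty at cut-off \<open>P\<close>. The factor \<open>P\<close> in \<open>Gam\<close>
  accounts for the \<open>N\<^sub>0\<close> cut-offs below \<open>N\<^sub>0\<close>, which all contribute \<open>G d N\<^sub>0\<close>.\<close>

definition G :: "real \<Rightarrow> nat \<Rightarrow> real" where
  "G d P = 144 * c1 * B P / d * exp (- (d\<^sup>2 * c3 / (288 * c1)) * real P)"

definition Gam :: "real \<Rightarrow> real" where "Gam d = (\<Sum>P. real P * G d P)"

lemma G_nonneg: "d > 0 \<Longrightarrow> 0 \<le> G d P"
  using c1_pos by (simp add: G_def B_def)

lemma G_summable:
  assumes d: "d > 0"
  shows "summable (\<lambda>P. real P * G d P)"
proof -
  have "d\<^sup>2 * c3 / (288 * c1) > 0" using d c1_pos c3_pos by simp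
  from summable_mult[OF summable_powr_exp[OF this, of "2 * \<beta>"], of "144 * c1 / d"]
  show ?thesis by (simp add: G_def B_def mult_ac)
qed

lemma sum_G_le:
  assumes d: "d > 0" and F: "finite F" "0 \<notin> F"
  shows "(\<Sum>P\<in>F. G d P) \<le> Gam d"
proof -
  have "(\<Sum>P\<in>F. G d P) \<le> (\<Sum>P\<in>F. real P * G d P)"
  proof (intro sum_mono)
    fix P assume "P \<in> F"
    then have "1 * G d P \<le> real P * G d P"
      using F G_nonneg[OF d, of P] by (intro mult_right_mono) (auto simp: Suc_le_eq intro: ccontr)
    then show "G d P \<le> real P * G d P" by simp
  qed
  also have "\<dots> \<le> Gam d"
    unfolding Gam_def using F(1) G_nonneg[OF d] by (intro sum_le_suminf G_summable d) auto
  finally show ?thesis .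
qed

lemma sum_G_max_le:
  assumes d: "d > 0"
  shows "(\<Sum>N\<in>{..m} - {N0}. G d (max N N0)) \<le> 2 * Gam d"
proof -
  have "(\<Sum>N\<in>{..m} - {N0}. G d (max N N0)) \<le> (\<Sum>N\<in>{..<N0} \<union> {N0<..m}. G d (max N N0))"
    by (intro sum_mono2) (auto simp: G_nonneg[OF d])
  also have "\<dots> = (\<Sum>N\<in>{..<N0}. G d (max N N0)) + (\<Sum>N\<in>{N0<..m}. G d (max N N0))"
    by (rule sum.union_disjoint) auto
  also have "(\<Sum>N\<in>{..<N0}. G d (max N N0)) = (\<Sum>P\<in>{N0}. real P * G d P)" by (simp add: max_def)
  also have "\<dots> \<le> Gam d"
    unfolding Gam_def using G_nonneg[OF d] by (intro sum_le_suminf G_summable d) auto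
  also have "(\<Sum>N\<in>{N0<..m}. G d (max N N0)) = (\<Sum>P\<in>{N0<..m}. G d P)"
    by (intro sum.cong) (auto simp: max_def)
  also have "\<dots> \<le> Gam d" by (rule sum_G_le[OF d]) auto
  finally show ?thesis by simp
qed

lemma Gam_nonneg: "d > 0 \<Longrightarrow> 0 \<le> Gam d"
  using sum_G_le[of d "{}"] by simp

text \<open>The 36 is the square of the bound \<open>amp k \<le> 6 * w k\<close>. With
  \<open>l * (c1 * B P) = d / 144\<close> the quadratic term uses exactly half of the penalty, as
  \<open>72 / 144 = 1 / 2\<close>; the other half yields the 288 in \<open>G\<close>.\<close>

lemma quadratic_rate:
  assumes d: "0 < d" and P: "P \<ge> 1" and W: "c3 * real P * B P \<le> W"
    and q: "0 \<le> q" "q \<le> 36 * (c1 * B P) * W"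
  defines "l \<equiv> d / (144 * (c1 * B P))"
  shows "exp (2 * l\<^sup>2 * q - l * (d * W)) / l \<le> G d P"
proof -
  have cb: "c1 * B P > 0" using c1_pos B_pos[OF P] by simp
  have l: "l > 0" using d cb by (simp add: l_def)
  have lc: "l * (c1 * B P) = d / 144" using cb c1_pos B_pos[OF P] by (simp add: l_def)
  have "2 * l\<^sup>2 * q \<le> 2 * l\<^sup>2 * (36 * (c1 * B P) * W)" using q by (intro mult_left_mono) auto
  also have "\<dots> = 72 * l * (l * (c1 * B P)) * W" by (simp add: power2_eq_square)
  also have "\<dots> = l * (d * W) / 2" unfolding lc by simp
  finally have "2 * l\<^sup>2 * q - l * (d * W) \<le> - (l * d / 2) * W" by simp
  also have "\<dots> \<le> - (l * d / 2) * (c3 * real P * B P)" using W l d by (intro mult_left_mono_neg) auto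
  also have "\<dots> = - (d\<^sup>2 * c3 / (288 * c1)) * real P"
    using c1_pos B_pos[OF P] by (simp add: l_def power2_eq_square field_simps)
  finally have "exp (2 * l\<^sup>2 * q - l * (d * W)) / l \<le> exp (- (d\<^sup>2 * c3 / (288 * c1)) * real P) / l"
    using l by (intro divide_right_mono) auto
  also have "\<dots> = G d P" by (simp add: l_def G_def)
  finally show ?thesis .
qed

text \<open>This \<open>l\<close> makes the quadratic term equal at most to the tail penalty
  \<open>l * (d * A)\<close>. The variance penalty remains in full and decays faster than
  \<open>G\<close>, which thus serves both kinds of excess.\<close>

lemma linear_rate:
  assumes d: "0 < d" and P: "P \<ge> 1" and W: "c3 * real P * B P \<le> W" and v: "v > 0" and A: "A \<ge> 0"
    and q: "0 \<le> q" "q \<le> 16 * v * (c1 * B P) * A"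
  defines "l \<equiv> d / (8 * v * (c1 * B P))"
  shows "exp (l\<^sup>2 / 2 * q - l * (d * A + d * v * W)) / l \<le> v * G d P"
proof -
  have cb: "c1 * B P > 0" using c1_pos B_pos[OF P] by simp
  have l: "l > 0" using d cb v by (simp add: l_def)
  have lc: "l * (v * (c1 * B P)) = d / 8" using cb c1_pos B_pos[OF P] v by (simp add: l_def)
  have "l\<^sup>2 / 2 * q \<le> l\<^sup>2 / 2 * (16 * v * (c1 * B P) * A)" using q by (intro mult_left_mono) auto
  also have "\<dots> = 8 * l * (l * (v * (c1 * B P))) * A" by (simp add: power2_eq_square)
  also have "\<dots> = l * (d * A)" unfolding lc by simp
  finally have "l\<^sup>2 / 2 * q - l * (d * A + d * v * W) \<le> - (l * d * v) * W" by (simp add: algebra_simps)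
  also have "\<dots> \<le> - (l * d * v) * (c3 * real P * B P)" using W l d v by (intro mult_left_mono_neg) auto
  also have "\<dots> = - (d\<^sup>2 * c3 / (8 * c1)) * real P"
    using c1_pos B_pos[OF P] v by (simp add: l_def power2_eq_square field_simps)
  also have "\<dots> \<le> - (d\<^sup>2 * c3 / (288 * c1)) * real P"
    using c1_pos c3_pos d by (intro mult_right_mono le_imp_neg_le divide_left_mono) auto
  finally have "exp (l\<^sup>2 / 2 * q - l * (d * A + d * v * W)) / l \<le> exp (- (d\<^sup>2 * c3 / (288 * c1)) * real P) / l"
    using l by (intro divide_right_mono) auto
  also have "\<dots> = v * (8 * c1 * B P / d * exp (- (d\<^sup>2 * c3 / (288 * c1)) * real P))" by (simp add: l_def)
  also have "\<dots> \<le> v * G d P"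
    unfolding G_def using v d cb c1_pos B_pos[OF P]
    by (intro mult_left_mono mult_right_mono divide_right_mono) auto
  finally show ?thesis .
qed

lemma penalty_le_one:
  assumes n: "n \<ge> 2" and k: "k \<in> band (m_zero g n)"
  shows "(ln (real n))\<^sup>2 / real n * w k \<le> 1"
proof -
  let ?L = "(ln (real n))\<^sup>2 / real n"
  let ?S = "{k::nat. (cmod (shift_coeff g (int k)))\<^sup>2 \<le> ?L}"
  define j where "j = nat \<bar>k\<bar>"
  have j: "j \<le> m_zero g n" "\<bar>k\<bar> = int j" using k by (auto simp: j_def)
  have e: "cmod (shift_coeff g k) = cmod (shift_coeff g (int j))"
    using j(2) shift_coeff_uminus[of k] by (cases "k \<ge> 0") auto
  \<comment> \<open>Membership would give \<open>Inf ?S \<le> j \<le> Inf ?S - 1\<close>,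
    contradictory because \<open>Inf ?S\<close> is positive and the subtraction is not truncated. An
    empty set needs no separate case.\<close>
  have "j \<notin> ?S"
  proof
    assume S: "j \<in> ?S"
    then have "Inf ?S \<in> ?S" by (intro Inf_nat_def1) auto
    moreover have "0 \<notin> ?S" using ln_square_less[OF n] by (simp add: shift_coeff_0)
    ultimately have "Inf ?S \<noteq> 0" by metis
    moreover have "Inf ?S \<le> j" using S by (intro cInf_lower) auto
    ultimately show False using j(1) unfolding m_zero_def by linarith
  qed
  then have "?L < (cmod (shift_coeff g k))\<^sup>2" by (simp add: e)
  moreover have "(cmod (shift_coeff g k))\<^sup>2 > 0" using nonzero by simp
  ultimately show ?thesis by (simp only: w_def times_divide_eq_right mult_1_right divide_le_eq_1_pos less_imp_le)
qed

end

section \<open>The oracle inequality with a fixed precision\<close>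

lemma integrable_nonneg_bounded:
  fixes X :: "'a \<Rightarrow> real"
  assumes "X \<in> borel_measurable M" "\<And>\<omega>. 0 \<le> X \<omega>" "(\<integral>\<^sup>+\<omega>. ennreal (X \<omega>) \<partial>M) \<le> ennreal c" "c \<ge> 0"
  shows "integrable M X" "integral\<^sup>L M X \<le> c"
proof -
  show i: "integrable M X"
    by (rule integrableI_nonneg) (use assms in \<open>auto intro: le_less_trans\<close>)
  show "integral\<^sup>L M X \<le> c"
    using assms nn_integral_eq_integral[OF i] by simp
qed

section \<open>Energy, tails and the loss in terms of the Fourier coefficients\<close>

context periodic_signal
begin

abbreviation \<theta> :: "int \<Rightarrow> complex" where "\<theta> \<equiv> fourier_coeff f"

definition energy :: real where "energy = (\<Sum>\<^sub>\<infinity>k. (cmod (\<theta> k))\<^sup>2)"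

definition tail :: "nat \<Rightarrow> real" where "tail N = (\<Sum>\<^sub>\<infinity>k\<in>{k. \<bar>k\<bar> > int N}. (cmod (\<theta> k))\<^sup>2)"

lemma summable_\<theta>: "(\<lambda>k. (cmod (\<theta> k))\<^sup>2) summable_on K"
proof (rule nonneg_bdd_above_summable_on)
  show "bdd_above (sum (\<lambda>k. (cmod (\<theta> k))\<^sup>2) ` {F. F \<subseteq> K \<and> finite F})"
    by (rule bdd_aboveI[of _ "\<integral>x\<in>{0..1}. (f x)\<^sup>2 \<partial>lebesgue"]) (auto intro: bessel)
qed simp

lemma tail_nonneg: "tail N \<ge> 0"
  unfolding tail_def by (rule infsum_nonneg) simp

lemma tail_add_band: "tail N + (\<Sum>k\<in>band N. (cmod (\<theta> k))\<^sup>2) = energy"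
proof -
  have "UNIV = {k. \<bar>k\<bar> > int N} \<union> band N" by auto
  then have "energy = infsum (\<lambda>k. (cmod (\<theta> k))\<^sup>2) ({k. \<bar>k\<bar> > int N} \<union> band N)"
    unfolding energy_def by simp
  also have "\<dots> = tail N + infsum (\<lambda>k. (cmod (\<theta> k))\<^sup>2) (band N)"
    unfolding tail_def by (rule infsum_Un_disjoint[OF summable_\<theta> summable_\<theta>]) auto
  finally show ?thesis by simp
qed

lemma energy_nonneg: "energy \<ge> 0"
  unfolding energy_def by (rule infsum_nonneg) simp

text \<open>Outside the band the error is the coefficient itself. Finite partial sums link the
  \<open>ennreal\<close> sum to the real \<open>tail\<close>.\<close>

lemma l2_dist_sq_theta_star:
  "l2_dist_sq (theta_star g c N) \<theta> \<le> ennreal (tail N + (\<Sum>k\<in>band N. (cmod (c k / shift_coeff g k - \<theta> k))\<^sup>2))"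
proof -
  let ?h = "\<lambda>k. ennreal ((cmod (theta_star g c N k - \<theta> k))\<^sup>2)"
  have s: "h summable_on K" for h :: "int \<Rightarrow> ennreal" and K by (rule nonneg_summable_on_complete) simp
  have "UNIV = {k. \<bar>k\<bar> > int N} \<union> band N" by auto
  then have "l2_dist_sq (theta_star g c N) \<theta> = infsum ?h ({k. \<bar>k\<bar> > int N} \<union> band N)"
    unfolding l2_dist_sq_def by simp
  also have "\<dots> = infsum ?h {k. \<bar>k\<bar> > int N} + infsum ?h (band N)"
    by (rule infsum_Un_disjoint[OF s s]) auto
  also have "infsum ?h (band N) = ennreal (\<Sum>k\<in>band N. (cmod (c k / shift_coeff g k - \<theta> k))\<^sup>2)"
  proof -
    have "infsum ?h (band N) = (\<Sum>k\<in>band N. ennreal ((cmod (c k / shift_coeff g k - \<theta> k))\<^sup>2))"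
      unfolding infsum_finite[OF finite_atLeastAtMost_int] by (intro sum.cong refl) (auto simp: theta_star_def abs_le_iff)
    then show ?thesis by (simp add: sum_ennreal)
  qed
  also have "infsum ?h {k. \<bar>k\<bar> > int N} \<le> ennreal (tail N)"
  proof (rule infsum_le_finite_sums[OF s])
    fix F assume F: "finite F" "F \<subseteq> {k. \<bar>k\<bar> > int N}"
    have "sum ?h F = ennreal (\<Sum>k\<in>F. (cmod (\<theta> k))\<^sup>2)"
    proof -
      have "sum ?h F = (\<Sum>k\<in>F. ennreal ((cmod (\<theta> k))\<^sup>2))"
        by (intro sum.cong refl) (use F in \<open>auto simp: theta_star_def\<close>)
      then show ?thesis by (simp add: sum_ennreal)
    qed
    also have "\<dots> \<le> ennreal (tail N)"
      unfolding tail_def by (intro ennreal_leI finite_sum_le_infsum summable_\<theta> F) auto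
    finally show "sum ?h F \<le> ennreal (tail N)" .
  qed
  finally show ?thesis
    using tail_nonneg by (simp add: ennreal_plus sum_nonneg add_right_mono)
qed

end

text \<open>With \<open>y = ln n\<close>, the square \<open>c * (y - 1 / c)\<^sup>2\<close> gives
  \<open>y - c * y\<^sup>2 \<le> 1 / c - y\<close>. The factor \<open>n\<close> on the left comes
  from the largest admissible weight.\<close>

lemma exp_log_square_le:
  assumes "c > 0" "n \<ge> (2::nat)"
  shows "real n * exp (- c * (ln (real n))\<^sup>2) \<le> exp (1 / c) / real n"
proof -
  let ?y = "ln (real n)"
  have n: "real n = exp ?y" using assms by simp
  have "0 \<le> c * (?y - 1 / c)\<^sup>2" using assms by simp
  also have "\<dots> = c * ?y\<^sup>2 - 2 * ?y + 1 / c" using assms by (simp add: power2_eq_square field_simps)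
  finally have "?y + - c * ?y\<^sup>2 \<le> 1 / c - ?y" by simp
  then have "exp (?y + - c * ?y\<^sup>2) \<le> exp (1 / c - ?y)" by simp
  then show ?thesis by (simp only: exp_add exp_diff n[symmetric])
qed

section \<open>Expected excesses in the random model, for a fixed precision\<close>

locale shift_experiment = wiener_noise M n W I + random_shifts M g n \<tau> + periodic_signal f +
    shift_density g \<beta> C_min C_max
  for M :: "'w measure" and n W I g \<tau> f \<beta> C_min C_max +
  fixes \<epsilon> \<kappa> :: real and N0 :: nat
  assumes \<epsilon>: "\<epsilon> > 0" and n2: "n \<ge> 2" and \<kappa>: "0 < \<kappa>" "\<kappa> \<le> 1" and N0: "N0 \<le> m_zero g n"
begin

definition v :: real where "v = \<epsilon>\<^sup>2 / real n"
definition L :: real where "L = (ln (real n))\<^sup>2 / real n"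
text \<open>Chosen so that \<open>5 * \<delta> = \<kappa>\<close>: the risk at the random cut-off
  then cancels in \<open>oracle_path\<close>.\<close>

definition \<delta> :: real where "\<delta> = \<kappa> / 5"
definition m :: nat where "m = m_zero g n"
definition x :: "'w \<Rightarrow> int \<Rightarrow> real" where "x \<omega> k = (cmod (\<Xi> k \<omega>))\<^sup>2"
definition r :: "'w \<Rightarrow> int \<Rightarrow> complex" where "r \<omega> k = emp_shift n \<tau> k \<omega> / shift_coeff g k - 1"
definition s :: "'w \<Rightarrow> int \<Rightarrow> complex" where "s \<omega> k = of_real (\<epsilon> / sqrt (real n)) * \<Xi> k \<omega> / shift_coeff g k"

lemma v_pos: "v > 0" using \<epsilon> n2 by (simp add: v_def)
lemma L_pos: "L > 0" using n2 by (simp add: L_def)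
lemma \<delta>_pos: "0 < \<delta>" "\<delta> \<le> 1" using \<kappa> by (auto simp: \<delta>_def)

lemma noise_scale: "(\<epsilon> / sqrt (real n))\<^sup>2 = v"
  using n2 by (simp add: v_def power_divide)

text \<open>One deterministic instance for each outcome. Quantities free of \<open>x\<close>,
  \<open>r\<close> and \<open>s\<close>, such as the risk and the amplitudes, do not depend on
  \<omega>.\<close>

sublocale path: cutoff_path w "\<lambda>k. L * w k" "x \<omega>" \<theta> "r \<omega>" "s \<omega>" tail v L \<delta> \<kappa> energy m N0 for \<omega>
proof unfold_locales
  show "L * w k \<le> 1" if "k \<in> band m" for k
    using penalty_le_one[OF n2, of k] that by (simp add: L_def m_def)
  show "(cmod (s \<omega> k))\<^sup>2 = v * w k * x \<omega> k" for k
    unfolding s_def x_def w_def noise_scale[symmetric]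
    by (simp add: norm_mult norm_divide power_mult_distrib power_divide)
qed (use w_pos L_pos v_pos \<delta>_pos \<kappa> N0 tail_nonneg tail_add_band in \<open>auto simp: m_def x_def\<close>)

lemma c_tilde_eq: "c_tilde f \<epsilon> n \<tau> I \<omega> k / shift_coeff g k = \<theta> k + path.\<eta> \<omega> k"
proof -
  have "c_tilde f \<epsilon> n \<tau> I \<omega> k = \<theta> k * emp_shift n \<tau> k \<omega> + of_real (\<epsilon> / sqrt (real n)) * \<Xi> k \<omega>"
    using c_tilde_decomposition[OF periodic_signal_axioms, of n \<epsilon> \<tau> I \<omega> k] n2 by (simp add: \<Xi>_def)
  then show ?thesis
    using nonzero[of k] by (simp add: path.\<eta>_def r_def s_def field_simps)
qed

lemma U_bar_eq: "U_bar g \<epsilon> n (c_tilde f \<epsilon> n \<tau> I \<omega>) N = path.crit \<omega> N"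
proof -
  let ?c = "c_tilde f \<epsilon> n \<tau> I \<omega>"
  let ?y = "\<lambda>k. (cmod (\<theta> k + path.\<eta> \<omega> k))\<^sup>2 - v * w k"
  have 1: "((cmod (?c k))\<^sup>2 - \<epsilon>\<^sup>2 / real n) / (cmod (shift_coeff g k))\<^sup>2 = ?y k" for k
    unfolding c_tilde_eq[symmetric] by (simp add: norm_divide power_divide w_def v_def diff_divide_distrib)
  have 2: "((cmod (?c k))\<^sup>2 - \<epsilon>\<^sup>2 / real n) / (cmod (shift_coeff g k)) ^ 4 = ?y k * w k" for k
  proof -
    have "(cmod (shift_coeff g k)) ^ 4 = (cmod (shift_coeff g k))\<^sup>2 * (cmod (shift_coeff g k))\<^sup>2"
      by (simp flip: power_add)
    then show ?thesis unfolding 1[symmetric] by (simp add: w_def)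
  qed
  have "U_bar g \<epsilon> n ?c N = (\<Sum>k\<in>band N. - ?y k + v * w k + L * (?y k * w k))"
    unfolding U_bar_def 1 2 sum.distrib sum_negf sum_distrib_left[symmetric] by (simp add: v_def L_def w_def)
  also have "\<dots> = path.crit \<omega> N"
    unfolding path.crit_def by (intro sum.cong refl) (simp add: algebra_simps)
  finally show ?thesis .
qed

lemma R_bar_eq: "R_bar g \<epsilon> n \<theta> N = path.risk N"
  unfolding R_bar_def path.risk_def tail_def
  by (simp add: v_def L_def w_def sum_distrib_left)

lemma loss_bound: "l2_dist_sq (theta_star g (c_tilde f \<epsilon> n \<tau> I \<omega>) N) \<theta> \<le> ennreal (path.loss \<omega> N)"
  using l2_dist_sq_theta_star[of g "c_tilde f \<epsilon> n \<tau> I \<omega>" N] unfolding path.loss_def c_tilde_eq by simp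

text \<open>Both the squared relative error and its penalty carry the factor \<open>w k\<close>,
  which therefore leaves the positive part. On \<open>band m\<close> it is at most
  \<open>1 / L\<close>, of order \<open>n\<close>, and the Hoeffding bound reduces the product to
  order \<open>1 / n\<close>.\<close>

lemma shift_excess_expectation:
  "integrable M (\<lambda>\<omega>. path.shift_excess \<omega>)"
  "expectation (\<lambda>\<omega>. path.shift_excess \<omega>) \<le> energy * (160 / \<delta> / (ln 2)\<^sup>2) * exp (40 / \<delta>\<^sup>2) / real n"
proof -
  let ?D = "\<lambda>k \<omega>. max 0 (10 / \<delta> * (cmod (emp_shift n \<tau> k \<omega> - shift_coeff g k))\<^sup>2 - \<delta> * L)"
  have c: "10 / \<delta> > 0" "\<delta> * L \<ge> 0" using \<delta>_pos L_pos by auto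
  have term_eq: "(cmod (\<theta> k))\<^sup>2 * max 0 (10 / \<delta> * (cmod (r \<omega> k))\<^sup>2 - \<delta> * (L * w k)) = (cmod (\<theta> k))\<^sup>2 * w k * ?D k \<omega>" for k \<omega>
  proof -
    have "r \<omega> k = (emp_shift n \<tau> k \<omega> - shift_coeff g k) / shift_coeff g k"
      using nonzero[of k] by (simp add: r_def field_simps)
    then have "(cmod (r \<omega> k))\<^sup>2 = w k * (cmod (emp_shift n \<tau> k \<omega> - shift_coeff g k))\<^sup>2"
      by (simp add: norm_divide power_divide w_def)
    then have "10 / \<delta> * (cmod (r \<omega> k))\<^sup>2 - \<delta> * (L * w k) = w k * (10 / \<delta> * (cmod (emp_shift n \<tau> k \<omega> - shift_coeff g k))\<^sup>2 - \<delta> * L)"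
      by (simp add: algebra_simps)
    moreover have "max 0 (w k * y) = w k * max 0 y" for y
      using w_pos[of k] by (simp add: max_def mult_le_0_iff zero_le_mult_iff)
    ultimately show ?thesis by simp
  qed
  have e: "path.shift_excess \<omega> = (\<Sum>k\<in>band m. (cmod (\<theta> k))\<^sup>2 * w k * ?D k \<omega>)" for \<omega>
    unfolding path.shift_excess_def term_eq ..
  have i: "integrable M (?D k)" for k by (rule emp_shift_excess(1)[OF c])
  show "integrable M (\<lambda>\<omega>. path.shift_excess \<omega>)"
    unfolding e using i by (intro Bochner_Integration.integrable_sum integrable_mult_right)
  let ?q = "16 * (10 / \<delta>) * exp (- real n * (\<delta> * L) / (4 * (10 / \<delta>)))"
  have "expectation (\<lambda>\<omega>. path.shift_excess \<omega>) = (\<Sum>k\<in>band m. (cmod (\<theta> k))\<^sup>2 * w k * expectation (?D k))"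
    unfolding e using i by (subst Bochner_Integration.integral_sum) auto
  also have "\<dots> \<le> (\<Sum>k\<in>band m. (cmod (\<theta> k))\<^sup>2 * (real n / (ln 2)\<^sup>2) * ?q)"
  proof (intro sum_mono mult_mono)
    fix k assume k: "k \<in> band m"
    have "w k \<le> 1 / L" using path.b_le[OF k] L_pos by (simp add: field_simps)
    also have "\<dots> = real n / (ln (real n))\<^sup>2" by (simp add: L_def)
    also have "\<dots> \<le> real n / (ln 2)\<^sup>2"
      using n2 by (intro divide_left_mono power_mono) auto
    finally show "w k \<le> real n / (ln 2)\<^sup>2" .
    show "expectation (?D k) \<le> ?q" by (rule emp_shift_excess(2)[OF c])
    show "0 \<le> expectation (?D k)" by (intro Bochner_Integration.integral_nonneg) simp
  qed (use w_pos[THEN less_imp_le] in auto)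
  also have "\<dots> = (\<Sum>k\<in>band m. (cmod (\<theta> k))\<^sup>2) * ((real n / (ln 2)\<^sup>2) * ?q)"
    by (simp only: sum_distrib_right mult.assoc)
  also have "\<dots> \<le> energy * ((real n / (ln 2)\<^sup>2) * ?q)"
    using tail_add_band[of m] tail_nonneg[of m] \<delta>_pos by (intro mult_right_mono) auto
  also have "(real n / (ln 2)\<^sup>2) * ?q = 160 / \<delta> / (ln 2)\<^sup>2 * (real n * exp (- (\<delta>\<^sup>2 / 40) * (ln (real n))\<^sup>2))"
  proof -
    have e: "- real n * (\<delta> * L) / (4 * (10 / \<delta>)) = - (\<delta>\<^sup>2 / 40) * (ln (real n))\<^sup>2"
      using n2 \<delta>_pos by (simp add: L_def power2_eq_square field_simps)
    show ?thesis unfolding e by (simp add: mult_ac)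
  qed
  also have "energy * \<dots> \<le> energy * (160 / \<delta> / (ln 2)\<^sup>2 * (exp (1 / (\<delta>\<^sup>2 / 40)) / real n))"
    using exp_log_square_le[of "\<delta>\<^sup>2 / 40" n] n2 \<delta>_pos energy_nonneg by (intro mult_left_mono) auto
  finally show "expectation (\<lambda>\<omega>. path.shift_excess \<omega>) \<le> energy * (160 / \<delta> / (ln 2)\<^sup>2) * exp (40 / \<delta>\<^sup>2) / real n"
    by simp
qed

lemma quad_excess_expectation:
  assumes N: "1 \<le> N" "N \<le> m" and K: "K = {1..int N} \<or> K = {- int N..-1}"
  shows "integrable M (\<lambda>\<omega>. path.quad_excess \<omega> K)" "expectation (\<lambda>\<omega>. path.quad_excess \<omega> K) \<le> G \<delta> N"
proof -
  have fin: "finite K" and nz: "\<And>k l. k \<in> K \<Longrightarrow> l \<in> K \<Longrightarrow> k + l \<noteq> 0" and sub: "K \<subseteq> band m"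
    and k0: "\<And>k. k \<in> K \<Longrightarrow> k \<noteq> 0 \<and> \<bar>k\<bar> \<le> int N" and W: "c3 * real N * B N \<le> (\<Sum>k\<in>K. w k)"
    using K N w_sum_ge_pos[OF N(1)] w_sum_ge_neg[OF N(1)] by auto
  define l where "l = \<delta> / (144 * (c1 * B N))"
  have cb: "c1 * B N > 0" using c1_pos B_pos[OF N(1)] by simp
  have l: "l > 0" using \<delta>_pos cb by (simp add: l_def)
  have amp: "0 \<le> path.amp k" "path.amp k \<le> 6 * w k" "w k \<le> c1 * B N" if "k \<in> K" for k
    using path.amp_bounds[of k] sub w_le[of k N] k0[OF that] that by auto
  have q: "(\<Sum>k\<in>K. (path.amp k)\<^sup>2) \<le> 36 * (c1 * B N) * (\<Sum>k\<in>K. w k)"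
    unfolding sum_distrib_left
  proof (intro sum_mono)
    fix k assume k: "k \<in> K"
    have "(path.amp k)\<^sup>2 \<le> (6 * w k)\<^sup>2" using amp[OF k] by (intro power_mono) auto
    also have "\<dots> = 36 * w k * w k" by (simp add: power2_eq_square)
    also have "\<dots> \<le> 36 * (c1 * B N) * w k"
      using amp[OF k] w_pos[of k] by (intro mult_right_mono mult_left_mono) auto
    finally show "(path.amp k)\<^sup>2 \<le> 36 * (c1 * B N) * w k" .
  qed
  \<comment> \<open>The parameter fixed by \<open>quadratic_rate\<close> also meets the smallness
    condition of \<open>quadratic_excess\<close>, since \<open>6 / 144 = 1 / 24\<close>.\<close>
  have la: "l * path.amp k \<le> 1 / 2" if "k \<in> K" for k
  proof -
    have "l * path.amp k \<le> l * (6 * (c1 * B N))" using amp[OF that] l by (intro mult_left_mono) auto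
    also have "\<dots> = \<delta> / 24" using cb c1_pos B_pos[OF N(1)] by (simp add: l_def)
    also have "\<dots> \<le> 1 / 2" using \<delta>_pos by simp
    finally show ?thesis .
  qed
  have nn: "(\<integral>\<^sup>+\<omega>. ennreal (path.quad_excess \<omega> K) \<partial>M) \<le> ennreal (G \<delta> N)"
  proof -
    have "(\<integral>\<^sup>+\<omega>. ennreal (path.quad_excess \<omega> K) \<partial>M) \<le>
        ennreal (exp (2 * l\<^sup>2 * (\<Sum>k\<in>K. (path.amp k)\<^sup>2) - l * (\<delta> * (\<Sum>k\<in>K. w k))) / l)"
      unfolding path.quad_excess_def x_def by (rule quadratic_excess[OF fin nz amp(1) la l])
    also have "\<dots> \<le> ennreal (G \<delta> N)"
      unfolding l_def using q by (intro ennreal_leI quadratic_rate \<delta>_pos N(1) W) (auto intro: sum_nonneg)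
    finally show ?thesis .
  qed
  have meas: "(\<lambda>\<omega>. path.quad_excess \<omega> K) \<in> borel_measurable M"
    unfolding path.quad_excess_def x_def by measurable
  have pos: "0 \<le> path.quad_excess \<omega> K" for \<omega> by (simp add: path.quad_excess_def)
  show "integrable M (\<lambda>\<omega>. path.quad_excess \<omega> K)" "expectation (\<lambda>\<omega>. path.quad_excess \<omega> K) \<le> G \<delta> N"
    by (rule integrable_nonneg_bounded[OF meas pos nn G_nonneg[OF \<delta>_pos(1)]])+
qed

lemma noise_excess_expectation:
  "integrable M (\<lambda>\<omega>. path.noise_excess \<omega>)"
  "expectation (\<lambda>\<omega>. path.noise_excess \<omega>) \<le> v * (6 * w 0 + 2 * Gam \<delta>)"
proof -
  have ix: "integrable M (\<lambda>\<omega>. x \<omega> 0)" "expectation (\<lambda>\<omega>. x \<omega> 0) = 1"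
    unfolding x_def by (rule integrable_sq_\<Xi> expectation_sq_\<Xi>)+
  have i: "integrable M (\<lambda>\<omega>. path.quad_excess \<omega> {1..int N})" "integrable M (\<lambda>\<omega>. path.quad_excess \<omega> {- int N..-1})"
    and e: "expectation (\<lambda>\<omega>. path.quad_excess \<omega> {1..int N}) \<le> G \<delta> N" "expectation (\<lambda>\<omega>. path.quad_excess \<omega> {- int N..-1}) \<le> G \<delta> N"
    if "N \<in> {1..m}" for N
    using quad_excess_expectation[of N] that by auto
  have isum: "integrable M (\<lambda>\<omega>. \<Sum>N=1..m. path.quad_excess \<omega> {1..int N} + path.quad_excess \<omega> {- int N..-1})"
    using i by (intro Bochner_Integration.integrable_sum Bochner_Integration.integrable_add) auto
  show "integrable M (\<lambda>\<omega>. path.noise_excess \<omega>)"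
    unfolding path.noise_excess_def using ix isum by simp
  have "expectation (\<lambda>\<omega>. path.noise_excess \<omega>) = v * (path.amp 0 * 1 + (\<Sum>N=1..m. expectation (\<lambda>\<omega>. path.quad_excess \<omega> {1..int N}) + expectation (\<lambda>\<omega>. path.quad_excess \<omega> {- int N..-1})))"
    unfolding path.noise_excess_def using ix isum i by (simp add: Bochner_Integration.integral_sum)
  also have "\<dots> \<le> v * (6 * w 0 + (\<Sum>N=1..m. G \<delta> N + G \<delta> N))"
    using path.amp_bounds[of 0] v_pos e by (intro mult_left_mono add_mono sum_mono) auto
  also have "(\<Sum>N=1..m. G \<delta> N + G \<delta> N) \<le> 2 * Gam \<delta>"
    using sum_G_le[OF \<delta>_pos(1), of "{1..m}"] by (simp add: sum_distrib_left[symmetric])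
  finally show "expectation (\<lambda>\<omega>. path.noise_excess \<omega>) \<le> v * (6 * w 0 + 2 * Gam \<delta>)"
    using v_pos by simp
qed

lemma lin_excess_expectation:
  assumes N: "N \<le> m" "N \<noteq> N0"
  shows "integrable M (\<lambda>\<omega>. path.lin_excess \<omega> N)" "expectation (\<lambda>\<omega>. path.lin_excess \<omega> N) \<le> v * G \<delta> (max N N0)"
proof -
  let ?P = "max N N0" and ?Q = "min N N0"
  let ?K = "{k. int ?Q < \<bar>k\<bar> \<and> \<bar>k\<bar> \<le> int ?P}"
  \<comment> \<open>The difference of the two band sums is plus or minus the sum over the shell; the
    sign is absorbed into the coefficients.\<close>
  define sg :: real where "sg = (if N0 < N then 1 else - 1)"
  define z where "z k = of_real (sg * (1 + \<kappa>) * (1 - L * w k) * 2) * cnj (\<theta> k) * (of_real (\<epsilon> / sqrt (real n)) / shift_coeff g k)" for k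
  have P: "?P \<ge> 1" using N by auto
  have fin: "finite ?K" by (rule finite_subset[of _ "band ?P"]) auto
  have Km: "?K \<subseteq> band m" using N N0 by (auto simp: m_def)
  have re_scale: "Re (of_real a * u) = a * Re u" for a u by simp
  have lin: "path.lin k (s \<omega> k) = sg * Re (z k * \<Xi> k \<omega>)" for k \<omega>
  proof -
    have "z k * \<Xi> k \<omega> = of_real (sg * (1 + \<kappa>) * (1 - L * w k) * 2) * (cnj (\<theta> k) * s \<omega> k)"
      by (simp add: z_def s_def)
    then have "Re (z k * \<Xi> k \<omega>) = sg * (1 + \<kappa>) * (1 - L * w k) * 2 * Re (cnj (\<theta> k) * s \<omega> k)"
      by (simp only: re_scale)
    then show ?thesis unfolding path.lin_def by (simp add: sg_def)
  qed
  have ln: "path.lin_noise \<omega> N = Re (\<Sum>k\<in>?K. z k * \<Xi> k \<omega>)" for \<omega>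
  proof (cases "N0 < N")
    case True
    then have "path.lin_noise \<omega> N = (\<Sum>k\<in>?K. path.lin k (s \<omega> k))"
      unfolding path.lin_noise_def by (subst sum_band_diff) (auto simp: max_def min_def)
    also have "\<dots> = Re (\<Sum>k\<in>?K. z k * \<Xi> k \<omega>)"
      unfolding lin Re_sum using True by (simp only: sg_def if_True mult_1)
    finally show ?thesis .
  next
    case False
    then have "path.lin_noise \<omega> N = - (\<Sum>k\<in>?K. path.lin k (s \<omega> k))"
      unfolding path.lin_noise_def using N
      by (subst minus_diff_eq[symmetric], subst sum_band_diff) (auto simp: max_def min_def)
    also have "\<dots> = Re (\<Sum>k\<in>?K. z k * \<Xi> k \<omega>)"
      unfolding lin Re_sum using False by (simp only: sg_def if_False sum_negf[symmetric] mult_minus1 minus_minus)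
    finally show ?thesis .
  qed
  \<comment> \<open>The 16 is \<open>2\<^sup>2\<close> for the bound on the weight times
    \<open>2\<^sup>2\<close> for the cross term. The weights are bounded at the larger cut-off, the
    signal by the tail at the smaller.\<close>
  have zb: "(\<Sum>k\<in>?K. (cmod (z k))\<^sup>2) \<le> 16 * v * (c1 * B ?P) * tail ?Q"
  proof -
    have "(\<Sum>k\<in>?K. (cmod (z k))\<^sup>2) \<le> (\<Sum>k\<in>?K. 16 * v * (c1 * B ?P) * (cmod (\<theta> k))\<^sup>2)"
    proof (intro sum_mono)
      fix k assume k: "k \<in> ?K"
      have kb: "k \<in> band m" using k Km by blast
      let ?f = "(1 + \<kappa>) * (1 - L * w k)"
      have f: "?f\<^sup>2 \<le> 2\<^sup>2" using path.factor_bounds[OF kb] by (intro power_mono)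
      have sg2: "sg\<^sup>2 = 1" by (simp add: sg_def)
      have "(cmod (z k))\<^sup>2 = (sg * ?f * 2)\<^sup>2 * (cmod (\<theta> k))\<^sup>2 * ((\<epsilon> / sqrt (real n))\<^sup>2 * w k)"
        unfolding z_def norm_mult norm_divide norm_of_real complex_mod_cnj power_mult_distrib power_divide power2_abs w_def
        by simp
      also have "\<dots> = ?f\<^sup>2 * (4 * (cmod (\<theta> k))\<^sup>2 * v * w k)"
        unfolding noise_scale power_mult_distrib[of "sg * ?f"] power_mult_distrib[of sg] sg2 by simp
      also have "\<dots> \<le> 2\<^sup>2 * (4 * (cmod (\<theta> k))\<^sup>2 * v * w k)"
        using f v_pos w_pos[of k] by (intro mult_right_mono) auto
      also have "\<dots> \<le> 2\<^sup>2 * (4 * (cmod (\<theta> k))\<^sup>2 * v * (c1 * B ?P))"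
        using w_le[of k ?P] k v_pos by (intro mult_left_mono) auto
      finally show "(cmod (z k))\<^sup>2 \<le> 16 * v * (c1 * B ?P) * (cmod (\<theta> k))\<^sup>2" by (simp add: mult_ac)
    qed
    also have "\<dots> = 16 * v * (c1 * B ?P) * (\<Sum>k\<in>?K. (cmod (\<theta> k))\<^sup>2)" by (simp add: sum_distrib_left)
    also have "\<dots> \<le> 16 * v * (c1 * B ?P) * tail ?Q"
    proof (intro mult_left_mono)
      show "(\<Sum>k\<in>?K. (cmod (\<theta> k))\<^sup>2) \<le> tail ?Q"
        unfolding tail_def by (intro finite_sum_le_infsum summable_\<theta> fin) auto
      show "0 \<le> 16 * v * (c1 * B ?P)" using v_pos c1_pos B_pos[OF P] by simp
    qed
    finally show ?thesis .
  qed
  define l where "l = \<delta> / (8 * v * (c1 * B ?P))"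
  have l: "l > 0" using \<delta>_pos v_pos c1_pos B_pos[OF P] by (simp add: l_def)
  let ?D = "\<delta> * tail ?Q + \<delta> * v * (\<Sum>k\<in>band ?P. w k)"
  have le: "path.lin_excess \<omega> N = max 0 (Re (\<Sum>k\<in>?K. z k * \<Xi> k \<omega>) - ?D)" for \<omega>
    unfolding path.lin_excess_def ln by (simp only: diff_diff_eq)
  have nn: "(\<integral>\<^sup>+\<omega>. ennreal (path.lin_excess \<omega> N) \<partial>M) \<le> ennreal (v * G \<delta> ?P)"
  proof -
    have "(\<integral>\<^sup>+\<omega>. ennreal (path.lin_excess \<omega> N) \<partial>M) \<le> ennreal (exp (l\<^sup>2 / 2 * (\<Sum>k\<in>?K. (cmod (z k))\<^sup>2) - l * ?D) / l)"
      unfolding le by (rule linear_excess[OF fin l])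
    also have "\<dots> \<le> ennreal (v * G \<delta> ?P)"
      unfolding l_def
      by (intro ennreal_leI linear_rate \<delta>_pos P w_sum_ge_band v_pos tail_nonneg zb sum_nonneg) auto
    finally show ?thesis .
  qed
  have meas: "(\<lambda>\<omega>. path.lin_excess \<omega> N) \<in> borel_measurable M"
    unfolding le by measurable
  have pos: "0 \<le> path.lin_excess \<omega> N" for \<omega> by (simp add: path.lin_excess_def)
  have "0 \<le> v * G \<delta> ?P" using v_pos G_nonneg[OF \<delta>_pos(1)] by simp
  from integrable_nonneg_bounded[OF meas pos nn this]
  show "integrable M (\<lambda>\<omega>. path.lin_excess \<omega> N)" "expectation (\<lambda>\<omega>. path.lin_excess \<omega> N) \<le> v * G \<delta> ?P" .
qed

lemma centred_expectation: "integrable M (\<lambda>\<omega>. path.centred \<omega>)" "expectation (\<lambda>\<omega>. path.centred \<omega>) = 0"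
proof -
  have i: "integrable M (\<lambda>\<omega>. x \<omega> k)" "expectation (\<lambda>\<omega>. x \<omega> k) = 1" for k
    unfolding x_def by (rule integrable_sq_\<Xi> expectation_sq_\<Xi>)+
  show "integrable M (\<lambda>\<omega>. path.centred \<omega>)"
    unfolding path.centred_def using i by simp
  show "expectation (\<lambda>\<omega>. path.centred \<omega>) = 0"
    unfolding path.centred_def using i by (simp add: Bochner_Integration.integral_sum prob_space)
qed

lemma oracle_inequality:
  assumes opt: "\<And>\<omega>. \<omega> \<in> space M \<Longrightarrow> is_arg_min (U_bar g \<epsilon> n (c_tilde f \<epsilon> n \<tau> I \<omega>)) (\<lambda>N. N \<le> m_zero g n) (Ns \<omega>)"
  shows "(\<integral>\<^sup>+\<omega>. l2_dist_sq (theta_star g (c_tilde f \<epsilon> n \<tau> I \<omega>) (Ns \<omega>)) \<theta> \<partial>M) \<le>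
    ennreal ((1 + 2 * \<kappa>) * R_bar g \<epsilon> n \<theta> N0 + (6 * w 0 + 4 * Gam \<delta>) * \<epsilon>\<^sup>2 / real n
      + 2 * (energy * (160 / \<delta> / (ln 2)\<^sup>2) * exp (40 / \<delta>\<^sup>2)) / real n)"
proof -
  define Y where "Y \<omega> = (1 + 2 * \<kappa>) * path.risk N0 + 2 * path.shift_excess \<omega> + path.noise_excess \<omega>
    + (\<Sum>N\<in>{..m} - {N0}. path.lin_excess \<omega> N) - path.centred \<omega>" for \<omega>
  have N: "Ns \<omega> \<le> m" "path.crit \<omega> (Ns \<omega>) \<le> path.crit \<omega> N0" if "\<omega> \<in> space M" for \<omega>
    using opt[OF that] N0 unfolding is_arg_min_def U_bar_eq m_def by (auto simp: not_less)
  \<comment> \<open>Since \<open>5 * \<delta> = \<kappa>\<close>, the risk at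
    \<open>Ns \<omega>\<close> cancels, and \<open>1 + 2 * \<kappa>\<close> times the risk at
    \<open>N0\<close> is left.\<close>
  have le: "path.loss \<omega> (Ns \<omega>) \<le> Y \<omega>" if "\<omega> \<in> space M" for \<omega>
    using path.oracle_path[OF N[OF that]] unfolding Y_def \<delta>_def by (simp add: algebra_simps)
  have loss0: "0 \<le> path.loss \<omega> N" for \<omega> N
    unfolding path.loss_def using tail_nonneg[of N] by (simp add: sum_nonneg)
  have il: "integrable M (\<lambda>\<omega>. \<Sum>N\<in>{..m} - {N0}. path.lin_excess \<omega> N)"
    using lin_excess_expectation(1) by (intro Bochner_Integration.integrable_sum) auto
  have el: "expectation (\<lambda>\<omega>. \<Sum>N\<in>{..m} - {N0}. path.lin_excess \<omega> N) \<le> v * (2 * Gam \<delta>)"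
  proof -
    have "expectation (\<lambda>\<omega>. \<Sum>N\<in>{..m} - {N0}. path.lin_excess \<omega> N) = (\<Sum>N\<in>{..m} - {N0}. expectation (\<lambda>\<omega>. path.lin_excess \<omega> N))"
      using lin_excess_expectation(1) by (intro Bochner_Integration.integral_sum) auto
    also have "\<dots> \<le> (\<Sum>N\<in>{..m} - {N0}. v * G \<delta> (max N N0))"
      using lin_excess_expectation(2) by (intro sum_mono) auto
    also have "\<dots> = v * (\<Sum>N\<in>{..m} - {N0}. G \<delta> (max N N0))" by (simp add: sum_distrib_left)
    also have "\<dots> \<le> v * (2 * Gam \<delta>)"
      using v_pos sum_G_max_le[OF \<delta>_pos(1)] by (intro mult_left_mono) auto
    finally show ?thesis .
  qed
  note ints = shift_excess_expectation(1) noise_excess_expectation(1) il centred_expectation(1)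
  have iY: "integrable M Y" unfolding Y_def using ints by simp
  have "expectation Y = (1 + 2 * \<kappa>) * path.risk N0 + 2 * expectation (\<lambda>\<omega>. path.shift_excess \<omega>)
      + expectation (\<lambda>\<omega>. path.noise_excess \<omega>) + expectation (\<lambda>\<omega>. \<Sum>N\<in>{..m} - {N0}. path.lin_excess \<omega> N)"
    unfolding Y_def using ints centred_expectation(2) by (simp add: prob_space)
  also have "\<dots> \<le> (1 + 2 * \<kappa>) * path.risk N0 + 2 * (energy * (160 / \<delta> / (ln 2)\<^sup>2) * exp (40 / \<delta>\<^sup>2) / real n)
      + v * (6 * w 0 + 2 * Gam \<delta>) + v * (2 * Gam \<delta>)"
    by (intro add_mono mult_left_mono order_refl shift_excess_expectation noise_excess_expectation el) auto
  also have "\<dots> = (1 + 2 * \<kappa>) * R_bar g \<epsilon> n \<theta> N0 + (6 * w 0 + 4 * Gam \<delta>) * \<epsilon>\<^sup>2 / real n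
      + 2 * (energy * (160 / \<delta> / (ln 2)\<^sup>2) * exp (40 / \<delta>\<^sup>2)) / real n"
  proof -
    have "v * (6 * w 0 + 2 * Gam \<delta>) + v * (2 * Gam \<delta>) = (6 * w 0 + 4 * Gam \<delta>) * v" by (simp add: algebra_simps)
    then show ?thesis unfolding R_bar_eq by (simp add: v_def)
  qed
  finally have EY: "expectation Y \<le> \<dots>" .
  have "(\<integral>\<^sup>+\<omega>. l2_dist_sq (theta_star g (c_tilde f \<epsilon> n \<tau> I \<omega>) (Ns \<omega>)) \<theta> \<partial>M) \<le> (\<integral>\<^sup>+\<omega>. ennreal (Y \<omega>) \<partial>M)"
    using le by (intro nn_integral_mono order_trans[OF loss_bound] ennreal_leI)
  \<comment> \<open>\<open>Y\<close> dominates a nonnegative loss, hence is nonnegative although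
    \<open>centred\<close> is subtracted.\<close>
  also have "\<dots> = ennreal (expectation Y)"
    using le loss0 by (intro nn_integral_eq_integral iY AE_I2) (meson order_trans)
  also have "\<dots> \<le> ennreal ((1 + 2 * \<kappa>) * R_bar g \<epsilon> n \<theta> N0 + (6 * w 0 + 4 * Gam \<delta>) * \<epsilon>\<^sup>2 / real n
      + 2 * (energy * (160 / \<delta> / (ln 2)\<^sup>2) * exp (40 / \<delta>\<^sup>2)) / real n)"
    by (rule ennreal_leI[OF EY])
  finally show ?thesis .
qed

end

text \<open>A diagonal choice for an arbitrary \<open>C\<close>, with no monotonicity: \<kappa> is
  \<open>1 / (j + 1)\<close> for the largest \<open>j\<close> whose constant is at most
  \<open>1 / \<gamma>\<close>. The condition \<open>real j \<le> 1 / \<gamma>\<close> keeps the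
  candidates finite, so that a largest one exists.\<close>

lemma slow_rate:
  fixes C :: "real \<Rightarrow> real"
  shows "\<exists>(\<gamma>1::real) \<kappa>. 0 < \<gamma>1 \<and> \<gamma>1 < 1 \<and> (\<kappa> \<longlongrightarrow> 0) (at_right 0) \<and>
    (\<forall>\<gamma>. 0 < \<gamma> \<longrightarrow> \<gamma> < \<gamma>1 \<longrightarrow> 0 < \<kappa> \<gamma> \<and> \<kappa> \<gamma> \<le> 1 \<and> C (\<kappa> \<gamma>) \<le> 1 / \<gamma>)"
proof -
  define S where "S \<gamma> = {j::nat. real j \<le> 1 / \<gamma> \<and> C (1 / (real j + 1)) \<le> 1 / \<gamma>}" for \<gamma> :: real
  define \<kappa> where "\<kappa> \<gamma> = 1 / (real (Max (S \<gamma>)) + 1)" for \<gamma>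
  \<comment> \<open>Below \<open>t j\<close> the index \<open>j\<close> is a candidate. The term
    \<open>2 + \<bar>C (1 / (real j + 1))\<bar>\<close> keeps the denominator at least 2, even for
    negative values of \<open>C\<close>, so \<open>t 0 < 1\<close> can serve as the range of
    \<gamma>.\<close>
  define t where "t j = 1 / (max (real j) (C (1 / (real j + 1))) + 2 + \<bar>C (1 / (real j + 1))\<bar>)" for j :: nat
  have den: "max (real j) (C (1 / (real j + 1))) + 2 + \<bar>C (1 / (real j + 1))\<bar> \<ge> 2" for j by simp
  have t: "0 < t j" "t j \<le> 1 / 2" for j
    using den[of j] by (auto simp: t_def intro!: divide_left_mono)
  have mem: "j \<in> S \<gamma>" if "0 < \<gamma>" "\<gamma> < t j" for j \<gamma>
  proof -
    have "1 / t j \<le> 1 / \<gamma>" using that t(1)[of j] by (intro divide_left_mono) auto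
    moreover have "1 / t j = max (real j) (C (1 / (real j + 1))) + 2 + \<bar>C (1 / (real j + 1))\<bar>" by (simp add: t_def)
    moreover have "real j \<le> max (real j) (C (1 / (real j + 1)))" "C (1 / (real j + 1)) \<le> max (real j) (C (1 / (real j + 1)))"
      by auto
    ultimately show ?thesis unfolding S_def mem_Collect_eq by linarith
  qed
  have fin: "finite (S \<gamma>)" if "0 < \<gamma>" for \<gamma>
  proof (rule finite_subset)
    show "S \<gamma> \<subseteq> {..nat \<lfloor>1 / \<gamma>\<rfloor>}" by (auto simp: S_def le_nat_floor)
  qed simp
  have le: "\<kappa> \<gamma> \<le> 1 / (real j + 1)" if "0 < \<gamma>" "\<gamma> < t j" for j \<gamma>
  proof -
    have "j \<le> Max (S \<gamma>)" using mem[OF that] fin[OF that(1)] by (intro Max_ge)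
    then show ?thesis unfolding \<kappa>_def by (intro divide_left_mono) auto
  qed
  show ?thesis
  proof (intro exI[of _ "t 0"] exI[of _ \<kappa>] conjI allI impI)
    show "0 < t 0" "t 0 < 1" using t[of 0] by auto
    show "(\<kappa> \<longlongrightarrow> 0) (at_right 0)"
    proof (rule order_tendstoI)
      fix a :: real assume "a < 0"
      moreover have "0 < \<kappa> \<gamma>" for \<gamma> by (simp add: \<kappa>_def add_pos_nonneg)
      ultimately have "a < \<kappa> \<gamma>" for \<gamma> by (rule less_trans)
      then show "eventually (\<lambda>\<gamma>. a < \<kappa> \<gamma>) (at_right 0)" by simp
    next
      fix a :: real assume "0 < a"
      then obtain j :: nat where j: "1 / (real j + 1) < a"
        by (metis of_nat_Suc add.commute nat_approx_posE)
      show "eventually (\<lambda>\<gamma>. \<kappa> \<gamma> < a) (at_right 0)"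
        unfolding eventually_at_right_field using t(1)[of j] le j
        by (intro exI[of _ "t j"]) (auto intro: le_less_trans)
    qed
    fix \<gamma> :: real assume \<gamma>: "0 < \<gamma>" "\<gamma> < t 0"
    show "0 < \<kappa> \<gamma>" "\<kappa> \<gamma> \<le> 1" by (auto simp: \<kappa>_def)
    have "Max (S \<gamma>) \<in> S \<gamma>" using mem[OF \<gamma>] fin[OF \<gamma>(1)] by (intro Max_in) auto
    then show "C (\<kappa> \<gamma>) \<le> 1 / \<gamma>" by (simp add: S_def \<kappa>_def)
  qed
qed

theorem theorem2p1:
  fixes f g :: "real \<Rightarrow> real" and \<beta> C_min C_max :: real
  assumes f_periodic: "\<And>x. f (x + 1) = f x"
    and f_measurable: "f \<in> borel_measurable lebesgue"
    and f_square_integrable: "set_integrable lebesgue {0..1} (\<lambda>x. (f x)\<^sup>2)"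
    and g_density: "prob_density g"
    and nonzero: "\<And>k. shift_coeff g k \<noteq> 0"
    and "\<beta> \<ge> 0" and "C_max \<ge> C_min" and "C_min > 0"
    and decay_lower: "\<And>k. k \<noteq> 0 \<Longrightarrow> C_min * \<bar>real_of_int k\<bar> powr (- \<beta>) \<le> cmod (shift_coeff g k)"
    and decay_upper: "\<And>k. k \<noteq> 0 \<Longrightarrow> cmod (shift_coeff g k) \<le> C_max * \<bar>real_of_int k\<bar> powr (- \<beta>)"
  shows "\<exists>(\<gamma>\<^sub>1::real) (h\<^sub>1::real \<Rightarrow> real) (C\<^sub>1::real).
    0 < \<gamma>\<^sub>1 \<and> \<gamma>\<^sub>1 < 1 \<and> (h\<^sub>1 \<longlongrightarrow> 0) (at_right 0) \<and> 0 < C\<^sub>1 \<and>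
    (\<forall>\<epsilon>>0. \<forall>n\<ge>2. \<forall>(M::'w measure) \<tau> W I N_star.
       shifted_curves_model M g n \<tau> W \<longrightarrow>
       (\<forall>j\<in>{1..n}. \<forall>k. has_wiener_integral M (W j) (fourier_char k) (I j k)) \<longrightarrow>
       N_star \<in> measurable M (count_space UNIV) \<longrightarrow>
       (\<forall>\<omega>\<in>space M.
          is_arg_min (U_bar g \<epsilon> n (c_tilde f \<epsilon> n \<tau> I \<omega>)) (\<lambda>N. N \<le> m_zero g n) (N_star \<omega>)) \<longrightarrow>
       (\<forall>\<gamma>. 0 < \<gamma> \<longrightarrow> \<gamma> < \<gamma>\<^sub>1 \<longrightarrow>
          (\<integral>\<^sup>+\<omega>. l2_dist_sq (theta_star g (c_tilde f \<epsilon> n \<tau> I \<omega>) (N_star \<omega>)) (fourier_coeff f) \<partial>M)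
          \<le> ennreal ((1 + h\<^sub>1 \<gamma>) * (INF N\<in>{..m_zero g n}. R_bar g \<epsilon> n (fourier_coeff f) N)
              + C\<^sub>1 * \<epsilon>\<^sup>2 / real n * (1 / \<gamma> powr (4 * \<beta> + 1))
              + C\<^sub>1 / (real n * \<gamma>))))"
proof -
  interpret P: periodic_signal f
    by unfold_locales (rule f_periodic f_measurable f_square_integrable)+
  interpret D: shift_density g \<beta> C_min C_max
    by unfold_locales (use assms in auto)
  \<comment> \<open>The sum of the constants of both remainders, which a single choice of \<kappa>
    then controls.\<close>
  define C where "C \<kappa> = (6 * D.w 0 + 4 * D.Gam (\<kappa> / 5))
    + 2 * (P.energy * (160 / (\<kappa> / 5) / (ln 2)\<^sup>2) * exp (40 / (\<kappa> / 5)\<^sup>2))" for \<kappa>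
  obtain \<gamma>1 \<kappa> where \<gamma>1: "0 < \<gamma>1" "\<gamma>1 < (1::real)" and \<kappa>0: "(\<kappa> \<longlongrightarrow> 0) (at_right 0)"
    and \<kappa>: "\<And>\<gamma>. 0 < \<gamma> \<Longrightarrow> \<gamma> < \<gamma>1 \<Longrightarrow> 0 < \<kappa> \<gamma> \<and> \<kappa> \<gamma> \<le> 1 \<and> C (\<kappa> \<gamma>) \<le> 1 / \<gamma>"
    using slow_rate[of C] by blast
  show ?thesis
  \<comment> \<open>The last constant can be 1, because all others are absorbed into
    \<open>1 / \<gamma>\<close>.\<close>
  proof (rule exI[of _ \<gamma>1], rule exI[of _ "\<lambda>\<gamma>. 2 * \<kappa> \<gamma>"], rule exI[of _ 1], intro conjI allI impI)
    show "((\<lambda>\<gamma>. 2 * \<kappa> \<gamma>) \<longlongrightarrow> 0) (at_right 0)"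
      using tendsto_mult_left[OF \<kappa>0, of 2] by simp
    fix \<epsilon> :: real and n :: nat and M :: "'w measure" and \<tau> W I N_star and \<gamma> :: real
    assume \<epsilon>: "0 < \<epsilon>" and n: "2 \<le> n" and model: "shifted_curves_model M g n \<tau> W"
      and wiener: "\<forall>j\<in>{1..n}. \<forall>k. has_wiener_integral M (W j) (fourier_char k) (I j k)"
      and opt: "\<forall>\<omega>\<in>space M. is_arg_min (U_bar g \<epsilon> n (c_tilde f \<epsilon> n \<tau> I \<omega>)) (\<lambda>N. N \<le> m_zero g n) (N_star \<omega>)"
      and \<gamma>: "0 < \<gamma>" "\<gamma> < \<gamma>1"
    let ?R = "R_bar g \<epsilon> n (fourier_coeff f)"
    let ?inf = "INF N\<in>{..m_zero g n}. ?R N"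
    note k = \<kappa>[OF \<gamma>]
    \<comment> \<open>The infimum over finitely many cut-offs is attained, so it is the risk at an
      admissible deterministic \<open>N0\<close>.\<close>
    have "?inf \<in> ?R ` {..m_zero g n}"
      by (subst cInf_eq_Min) (auto intro!: Min_in)
    then obtain N0 where N0: "N0 \<le> m_zero g n" "?inf = ?R N0" by auto
    interpret prob_space M using model by (simp add: shifted_curves_model_def)
    interpret E: shift_experiment M n W I g \<tau> f \<beta> C_min C_max \<epsilon> "\<kappa> \<gamma>" N0
      by unfold_locales
         (use model wiener n \<epsilon> k N0 g_density in \<open>auto simp: shifted_curves_model_def\<close>)
    note bound = E.oracle_inequality[OF bspec[OF opt], unfolded E.\<delta>_def]
    let ?a = "6 * D.w 0 + 4 * D.Gam (\<kappa> \<gamma> / 5)"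
    let ?b = "2 * (P.energy * (160 / (\<kappa> \<gamma> / 5) / (ln 2)\<^sup>2) * exp (40 / (\<kappa> \<gamma> / 5)\<^sup>2))"
    have ab: "0 \<le> ?a" "0 \<le> ?b"
      using D.w_pos[of 0] D.Gam_nonneg[of "\<kappa> \<gamma> / 5"] k P.energy_nonneg by auto
    then have a: "?a \<le> 1 / \<gamma>" and b: "?b \<le> 1 / \<gamma>" using k unfolding C_def by linarith+
    \<comment> \<open>As \<open>\<gamma> < 1\<close> and the exponent is at least 1, the bound
      \<open>1 / \<gamma>\<close> on the noise constant is stronger than the power asked
      for.\<close>
    have "\<gamma> powr (4 * \<beta> + 1) \<le> \<gamma> powr 1"
      using \<gamma> \<gamma>1 \<open>\<beta> \<ge> 0\<close> by (intro powr_mono') auto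
    then have "1 / \<gamma> \<le> 1 / \<gamma> powr (4 * \<beta> + 1)" using \<gamma> by (intro divide_left_mono) auto
    with a have a': "?a \<le> 1 / \<gamma> powr (4 * \<beta> + 1)" by linarith
    have "(1 + 2 * \<kappa> \<gamma>) * ?R N0 + ?a * \<epsilon>\<^sup>2 / real n + ?b / real n
      \<le> (1 + 2 * \<kappa> \<gamma>) * ?inf + 1 * \<epsilon>\<^sup>2 / real n * (1 / \<gamma> powr (4 * \<beta> + 1)) + 1 / (real n * \<gamma>)"
    proof (intro add_mono)
      have "?a * (\<epsilon>\<^sup>2 / real n) \<le> 1 / \<gamma> powr (4 * \<beta> + 1) * (\<epsilon>\<^sup>2 / real n)"
        using a' by (intro mult_right_mono) auto
      then show "?a * \<epsilon>\<^sup>2 / real n \<le> 1 * \<epsilon>\<^sup>2 / real n * (1 / \<gamma> powr (4 * \<beta> + 1))" by (simp add: mult_ac)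
      have "?b / real n \<le> (1 / \<gamma>) / real n" using b by (intro divide_right_mono) auto
      then show "?b / real n \<le> 1 / (real n * \<gamma>)" by (simp add: mult_ac)
    qed (simp add: N0)
    from order_trans[OF bound ennreal_leI[OF this]]
    show "(\<integral>\<^sup>+\<omega>. l2_dist_sq (theta_star g (c_tilde f \<epsilon> n \<tau> I \<omega>) (N_star \<omega>)) (fourier_coeff f) \<partial>M)
          \<le> ennreal ((1 + 2 * \<kappa> \<gamma>) * ?inf + 1 * \<epsilon>\<^sup>2 / real n * (1 / \<gamma> powr (4 * \<beta> + 1)) + 1 / (real n * \<gamma>))"
      .
  qed (use \<gamma>1 in auto)
qed

end
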